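(* (i) $C^{\omega,(k)}(V)_{\pi_k}\subseteq C^\infty(V_{reg})_{\pi_k}$ is an $H_k$-submodule. (ii) The propagation operator $T_k$ restricts to an isomorphism $$T_k: C^\omega(V)_{Q_k}\overset{\sim}{\longrightarrow}C^{\omega,(k)}(V)_{\pi_k}$$ of $H_k$-modules.
   Context: Root systems. Let $V$ be a Euclidean space of dimension $n$ and $V^*$ the dual Euclidean space, with norm $\|\cdot\|$ and inner product $\langle\cdot,\cdot\rangle$ on $V^*$. Let $\Sigma_0\subset V^*$ be a finite, irreducible, reduced crystallographic root system. The co-root $\alpha^\vee\in V$ of $\alpha\in\Sigma_0$ is determined by $\xi(\alpha^\vee)=2\langle\xi,\alpha\rangle/\|\alpha\|^2$ for all $\xi\in V^*$. Fix a basis $I_0=\{a_1,\ldots,a_n\}$ of $\Sigma_0$, with highest root $\varphi$. For $\alpha\in\Sigma_0$, $s_\alpha v=v-\alpha(v)\alpha^\vee$ on $V$. $S(V)_{\mathbb{C}}$ is the complexified symmetric algebra of $V$. Affine root system. Affine linear functionals on $V$ are written as elements of $V^*\oplus\mathbb{R}$, and $D$ denotes the projection onto $V^*$ (the gradient). The affine root system is $\Sigma=\Sigma_0+\mathbb{Z}$, with basis $I=\{a_0=-\varphi+1,a_1,\ldots,a_n\}$ and corresponding positive roots $\Sigma^+$. For $a\in\Sigma$ write $Da^\vee=(Da)^\vee$, $V_a=a^{-1}(0)$, and $s_a(v)=v-a(v)Da^\vee$. The affine Weyl group $W$ is generated by all $s_a$ ($a\in\Sigma$); it is a Coxeter group with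 generators $s_a$ ($a\in I$). $W$ acts on functions on $V$ (including affine functionals) and on $V_{reg}=V\setminus\bigcup_{a\in\Sigma^+}V_a$ by $(wf)(v)=f(w^{-1}v)$. The connected components of $V_{reg}$ are called alcoves; $C_+=\{v\in V:a_j(v)>0,\ j=0,\ldots,n\}$ is the fundamental alcove. A vector $v\in V_a$ ($a\in\Sigma^+$) is sub-regular if it lies on no other $V_b$ ($b\in\Sigma^+$, $b\ne a$). Multiplicity function. $k:\Sigma\to\mathbb{R}_{>0}$ is a fixed $W$-invariant function with $k(a)=k(Da)$ for all $a\in\Sigma$; write $k_a=k(a)$. The algebra $H_k$. $H_k$ is the unique complex unital associative algebra with $H_k=S(V)_{\mathbb{C}}\otimes\mathbb{C}[W]$ as vector spaces, containing $S(V)_{\mathbb{C}}$ and $\mathbb{C}[W]$ as subalgebras via $p\mapsto p\otimes e$, $w\mapsto1\otimes w$, and with cross relations $s_a\cdot v-(s_{Da}v)\cdot s_a=k_aDa(v)$ for $a\in I$, $v\in V$. The representation $\pi_k$. Let $\chi_a(v)=1$ if $a(v)<0$ and $0$ if $a(v)>0$ ($v\in V_{reg}$). On the space $C^\infty(V_{reg})$ of complex-valued smooth functions put $\mathcal{D}_v^k=\partial_v+\sum_{a\in\Sigma^+}k_aDa(v)\chi_a(\cdot)s_a$ ($v\in V$; $\partial_v$ the directional derivative). The assignment $v\mapsto\mathcal{D}_v^k$ together with the $W$-action $(wf)(v)=f(w^{-1}v)$ defines a representation $\pi_k$ of $H_k$ on $C^\infty(V_{reg})$. The subscript $\pi_k$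 on a subspace indicates that it is considered with respect to the $\pi_k$-action. The representation $Q_k$. On the space $C(V)$ of complex-valued continuous functions put $(Q_{k,a}f)(v)=f(s_av)+k_a\int_0^{a(v)}f(v-tDa^\vee)\,dt$. The assignment $s_a\mapsto Q_{k,a}$ ($a\in I$) extends to an action $w\mapsto Q_k(w)$ of $W$ on $C(V)$; on $C^\infty(V)$, together with $v\mapsto\partial_v$ ($v\in V$), it defines a representation $Q_k$ of $H_k$. The space $C^\omega(V)$ of complex-valued real analytic functions on $V$ is an $H_k$-submodule, written $C^\omega(V)_{Q_k}$. Propagation operator. $T_k$ is the endomorphism of $C(V)$ defined by $(T_kf)(w^{-1}v)=(Q_k(w)f)(v)$ for $v\in\overline{C_+}$, $w\in W$. The spaces. $CB^\omega(V)$ is the space of $f\in C(V)$ such that for every alcove $C$, $f|_C$ is the restriction of an analytic function on $V$. $C^{\omega,(k)}(V)$ is the space of $f\in CB^\omega(V)$ satisfying $$\partial^r_{Db^\vee}f(v+0Db^\vee)-\partial^r_{Db^\vee}f(v-0Db^\vee)=(1-(-1)^r)k_b\,\partial^{r-1}_{Db^\vee}f(v+0Db^\vee)$$ for all $b\in\Sigma^+$, $v\in V_b$ sub-regular and $r\in\mathbb{Z}_{>0}$, where $v\pm0Db^\vee$ denotes the limit along $v\pm tDb^\vee$, $t\downarrow0$. By restriction to $V_{reg}$, $C^{\omega,(k)}(V)$ is viewed as a subspace of $C^\infty(V_{reg})$. *)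

theory Defs
  imports "HOL-Analysis.Analysis"
begin

text \<open>
  The Euclidean space $V$ is a type of class \<^class>\<open>euclidean_space\<close>. Its dual Euclidean space
  $V^*$ is identified with $V$ through the inner product (an isometry): a vector $\alpha$ stands for
  the functional $v \mapsto \alpha \bullet v$. Accordingly an element of $V^* \oplus \mathbb{R}$ is a pair
  $(\alpha, c)$, its gradient is \<^const>\<open>fst\<close>, and it stands for the affine functional
  $v \mapsto \alpha \bullet v + c$.
\<close>

section \<open>Root systems\<close>

definition coroot :: "'v::euclidean_space \<Rightarrow> 'v" where
  "coroot \<alpha> = (2 / (\<alpha> \<bullet> \<alpha>)) *\<^sub>R \<alpha>"

text \<open>The first line is the definition of a root system in $V^*$; the remaining lines say that it
  is crystallographic, reduced and irreducible.\<close>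

definition irreducible_root_system :: "'v::euclidean_space set \<Rightarrow> bool" where
  "irreducible_root_system R \<longleftrightarrow>
     finite R \<and> 0 \<notin> R \<and> span R = UNIV \<and> (\<forall>\<alpha>\<in>R. \<forall>\<beta>\<in>R. \<beta> - (\<beta> \<bullet> coroot \<alpha>) *\<^sub>R \<alpha> \<in> R) \<and>
     (\<forall>\<alpha>\<in>R. \<forall>\<beta>\<in>R. \<beta> \<bullet> coroot \<alpha> \<in> \<int>) \<and>
     (\<forall>\<alpha>\<in>R. \<forall>c. c *\<^sub>R \<alpha> \<in> R \<longrightarrow> c = 1 \<or> c = -1) \<and>
     R \<noteq> {} \<and>
     \<not> (\<exists>R1 R2. R1 \<noteq> {} \<and> R2 \<noteq> {} \<and> R1 \<union> R2 = R \<and> (\<forall>\<alpha>\<in>R1. \<forall>\<beta>\<in>R2. \<alpha> \<bullet> \<beta> = 0))"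

definition nat_combination :: "'a::real_vector set \<Rightarrow> 'a \<Rightarrow> bool" where
  "nat_combination B x \<longleftrightarrow> (\<exists>c :: 'a \<Rightarrow> nat. x = (\<Sum>b\<in>B. real (c b) *\<^sub>R b))"

definition root_basis :: "'v::euclidean_space set \<Rightarrow> 'v set \<Rightarrow> bool" where
  "root_basis R B \<longleftrightarrow> B \<subseteq> R \<and> independent B \<and>
     (\<forall>\<alpha>\<in>R. nat_combination B \<alpha> \<or> nat_combination B (- \<alpha>))"

definition highest_root :: "'v::euclidean_space set \<Rightarrow> 'v set \<Rightarrow> 'v \<Rightarrow> bool" where
  "highest_root R B \<phi> \<longleftrightarrow> \<phi> \<in> R \<and> (\<forall>\<alpha>\<in>R. nat_combination B (\<phi> - \<alpha>))"

section \<open>The affine root system\<close>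

definition aff :: "'v::euclidean_space \<times> real \<Rightarrow> 'v \<Rightarrow> real" where
  "aff a x = fst a \<bullet> x + snd a"

definition aff_roots :: "'v::euclidean_space set \<Rightarrow> ('v \<times> real) set" where
  "aff_roots R = R \<times> \<int>"

definition simple_aff_roots :: "'v::euclidean_space set \<Rightarrow> 'v \<Rightarrow> ('v \<times> real) set" where
  "simple_aff_roots B \<phi> = insert (- \<phi>, 1) (B \<times> {0})"

definition pos_aff_roots :: "'v::euclidean_space set \<Rightarrow> 'v set \<Rightarrow> 'v \<Rightarrow> ('v \<times> real) set" where
  "pos_aff_roots R B \<phi> = {a \<in> aff_roots R. nat_combination (simple_aff_roots B \<phi>) a}"

definition hyperplane :: "'v::euclidean_space \<times> real \<Rightarrow> 'v set" where
  "hyperplane a = {x. aff a x = 0}"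

definition refl :: "'v::euclidean_space \<times> real \<Rightarrow> 'v \<Rightarrow> 'v" where
  "refl a x = x - aff a x *\<^sub>R coroot (fst a)"

text \<open>The affine Weyl group, as a group of bijections of $V$. Closure under inverses is automatic,
  the generators being involutions.\<close>

inductive_set weyl :: "'v::euclidean_space set \<Rightarrow> ('v \<Rightarrow> 'v) set" for R where
  weyl_id: "id \<in> weyl R"
| weyl_refl: "a \<in> aff_roots R \<Longrightarrow> w \<in> weyl R \<Longrightarrow> refl a \<circ> w \<in> weyl R"

definition act :: "('v \<Rightarrow> 'v) \<Rightarrow> ('v \<Rightarrow> 'a) \<Rightarrow> 'v \<Rightarrow> 'a" where
  "act w f = (\<lambda>x. f (inv w x))"

definition V_reg :: "'v::euclidean_space set \<Rightarrow> 'v set \<Rightarrow> 'v \<Rightarrow> 'v set" where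
  "V_reg R B \<phi> = UNIV - (\<Union>a\<in>pos_aff_roots R B \<phi>. hyperplane a)"

definition alcoves :: "'v::euclidean_space set \<Rightarrow> 'v set \<Rightarrow> 'v \<Rightarrow> 'v set set" where
  "alcoves R B \<phi> = components (V_reg R B \<phi>)"

definition fund_alcove :: "'v::euclidean_space set \<Rightarrow> 'v \<Rightarrow> 'v set" where
  "fund_alcove B \<phi> = {x. \<forall>a\<in>simple_aff_roots B \<phi>. aff a x > 0}"

definition subregular ::
  "'v::euclidean_space set \<Rightarrow> 'v set \<Rightarrow> 'v \<Rightarrow> 'v \<times> real \<Rightarrow> 'v \<Rightarrow> bool" where
  "subregular R B \<phi> b x \<longleftrightarrow>
     x \<in> hyperplane b \<and> (\<forall>c\<in>pos_aff_roots R B \<phi>. c \<noteq> b \<longrightarrow> x \<notin> hyperplane c)"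

text \<open>The second conjunct is invariance: $b = w a$ as affine functionals implies $k_b = k_a$. In the
  last one the gradient of $a$ is regarded as the element $Da + 0$ of $\Sigma$.\<close>

definition multiplicity_function ::
  "'v::euclidean_space set \<Rightarrow> ('v \<times> real \<Rightarrow> real) \<Rightarrow> bool" where
  "multiplicity_function R k \<longleftrightarrow>
     (\<forall>a\<in>aff_roots R. k a > 0) \<and>
     (\<forall>w\<in>weyl R. \<forall>a\<in>aff_roots R. \<forall>b\<in>aff_roots R. aff b = act w (aff a) \<longrightarrow> k b = k a) \<and>
     (\<forall>a\<in>aff_roots R. k a = k (fst a, 0))"

section \<open>Function spaces\<close>

definition dderiv :: "'v::euclidean_space \<Rightarrow> ('v \<Rightarrow> complex) \<Rightarrow> 'v \<Rightarrow> complex" where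
  "dderiv v f x = vector_derivative (\<lambda>t. f (x + t *\<^sub>R v)) (at 0)"

text \<open>Intended for open sets.\<close>

primrec Ck_on :: "nat \<Rightarrow> 'v::euclidean_space set \<Rightarrow> ('v \<Rightarrow> complex) \<Rightarrow> bool" where
  "Ck_on 0 S f \<longleftrightarrow> continuous_on S f"
| "Ck_on (Suc n) S f \<longleftrightarrow> f differentiable_on S \<and> (\<forall>v. Ck_on n S (dderiv v f))"

text \<open>A function on $S$ is represented by its extension by zero, so that functions on $S$ which are
  equal as functions on $S$ are equal.\<close>

definition restr :: "'v set \<Rightarrow> ('v \<Rightarrow> complex) \<Rightarrow> 'v \<Rightarrow> complex" where
  "restr S f = (\<lambda>x. if x \<in> S then f x else 0)"

definition C_inf :: "'v::euclidean_space set \<Rightarrow> ('v \<Rightarrow> complex) set" where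
  "C_inf S = {f. (\<forall>n. Ck_on n S f) \<and> (\<forall>x. x \<notin> S \<longrightarrow> f x = 0)}"

definition C_cont :: "('v::euclidean_space \<Rightarrow> complex) set" where
  "C_cont = {f. continuous_on UNIV f}"

text \<open>Real analyticity: near every point $f$ is the sum of a multivariate power series in the
  coordinates with respect to the standard basis; a multi-index is a function that vanishes
  outside \<^const>\<open>Basis\<close>.\<close>

definition C_omega :: "('v::euclidean_space \<Rightarrow> complex) set" where
  "C_omega = {f. \<forall>x. \<exists>r>0. \<exists>c :: ('v \<Rightarrow> nat) \<Rightarrow> complex. \<forall>y\<in>ball x r.
     ((\<lambda>m. c m * of_real (\<Prod>b\<in>Basis. ((y - x) \<bullet> b) ^ m b)) has_sum f y)
       {m. \<forall>b. b \<notin> Basis \<longrightarrow> m b = 0}}"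

definition CB_omega ::
  "'v::euclidean_space set \<Rightarrow> 'v set \<Rightarrow> 'v \<Rightarrow> ('v \<Rightarrow> complex) set" where
  "CB_omega R B \<phi> =
     {f \<in> C_cont. \<forall>C\<in>alcoves R B \<phi>. \<exists>g\<in>C_omega. \<forall>x\<in>C. f x = g x}"

text \<open>The limits along the rays exist for all functions in \<^term>\<open>CB_omega R B \<phi>\<close>: near a sub-regular
  point, either side of the hyperplane lies in a single alcove.\<close>

definition C_omega_k ::
  "'v::euclidean_space set \<Rightarrow> 'v set \<Rightarrow> 'v \<Rightarrow> ('v \<times> real \<Rightarrow> real) \<Rightarrow> ('v \<Rightarrow> complex) set" where
  "C_omega_k R B \<phi> k =
     {f \<in> CB_omega R B \<phi>. \<forall>b\<in>pos_aff_roots R B \<phi>. \<forall>v. subregular R B \<phi> b v \<longrightarrow> (\<forall>r>0.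
        let u = coroot (fst b) in
        Lim (at_right 0) (\<lambda>t. (dderiv u ^^ r) f (v + t *\<^sub>R u)) -
        Lim (at_right 0) (\<lambda>t. (dderiv u ^^ r) f (v - t *\<^sub>R u)) =
        (1 - (-1) ^ r) * of_real (k b) *
          Lim (at_right 0) (\<lambda>t. (dderiv u ^^ (r - 1)) f (v + t *\<^sub>R u)))}"

section \<open>The algebra\<close>

text \<open>
  $S(V)_{\mathbb{C}}$ is realised as the algebra of complex-valued polynomial functions on $V^*$, where
  $v \in V$ is the function $\xi \mapsto \xi(v)$. The tensor product $S(V)_{\mathbb{C}} \otimes \mathbb{C}[W]$
  is realised as the space of finitely supported functions $W \to S(V)_{\mathbb{C}}$: the function $h$ stands
  for the sum of the elements $h(w) \otimes w$.
\<close>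

type_synonym 'v hecke = "('v \<Rightarrow> 'v) \<Rightarrow> 'v \<Rightarrow> complex"

definition H_space :: "'v::euclidean_space set \<Rightarrow> 'v hecke set" where
  "H_space R = {h. (\<forall>w. polynomial_function (h w)) \<and>
     finite {w. h w \<noteq> (\<lambda>_. 0)} \<and> {w. h w \<noteq> (\<lambda>_. 0)} \<subseteq> weyl R}"

definition tensor :: "('v \<Rightarrow> complex) \<Rightarrow> ('v \<Rightarrow> 'v) \<Rightarrow> 'v hecke" where
  "tensor p w = (\<lambda>u. if u = w then p else (\<lambda>_. 0))"

definition lin_poly :: "'v::euclidean_space \<Rightarrow> 'v \<Rightarrow> complex" where
  "lin_poly v = (\<lambda>\<xi>. of_real (\<xi> \<bullet> v))"

definition H_plus :: "'v hecke \<Rightarrow> 'v hecke \<Rightarrow> 'v hecke" where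
  "H_plus x y = (\<lambda>w \<xi>. x w \<xi> + y w \<xi>)"

definition H_minus :: "'v hecke \<Rightarrow> 'v hecke \<Rightarrow> 'v hecke" where
  "H_minus x y = (\<lambda>w \<xi>. x w \<xi> - y w \<xi>)"

definition H_scale :: "complex \<Rightarrow> 'v hecke \<Rightarrow> 'v hecke" where
  "H_scale c x = (\<lambda>w \<xi>. c * x w \<xi>)"

definition H_one :: "'v hecke" where
  "H_one = tensor (\<lambda>_. 1) id"

text \<open>\<open>m\<close> is the multiplication of $H_k$ on $S(V)_{\mathbb{C}} \otimes \mathbb{C}[W]$. That $p \otimes w$ is the product
  of $p$ and $w$ is the sense in which the algebra equals the tensor product of its two
  subalgebras.\<close>

definition H_algebra ::
  "'v::euclidean_space set \<Rightarrow> 'v set \<Rightarrow> 'v \<Rightarrow> ('v \<times> real \<Rightarrow> real) \<Rightarrow>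
   ('v hecke \<Rightarrow> 'v hecke \<Rightarrow> 'v hecke) \<Rightarrow> bool" where
  "H_algebra R B \<phi> k m \<longleftrightarrow>
     (\<forall>x\<in>H_space R. \<forall>y\<in>H_space R. m x y \<in> H_space R) \<and>
     (\<forall>x\<in>H_space R. \<forall>y\<in>H_space R. \<forall>z\<in>H_space R.
        m (H_plus x y) z = H_plus (m x z) (m y z) \<and>
        m z (H_plus x y) = H_plus (m z x) (m z y)) \<and>
     (\<forall>c. \<forall>x\<in>H_space R. \<forall>y\<in>H_space R.
        m (H_scale c x) y = H_scale c (m x y) \<and> m x (H_scale c y) = H_scale c (m x y)) \<and>
     (\<forall>x\<in>H_space R. \<forall>y\<in>H_space R. \<forall>z\<in>H_space R. m (m x y) z = m x (m y z)) \<and>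
     (\<forall>x\<in>H_space R. m H_one x = x \<and> m x H_one = x) \<and>
     (\<forall>p q. polynomial_function p \<longrightarrow> polynomial_function q \<longrightarrow>
        m (tensor p id) (tensor q id) = tensor (\<lambda>\<xi>. p \<xi> * q \<xi>) id) \<and>
     (\<forall>u\<in>weyl R. \<forall>w\<in>weyl R.
        m (tensor (\<lambda>_. 1) u) (tensor (\<lambda>_. 1) w) = tensor (\<lambda>_. 1) (u \<circ> w)) \<and>
     (\<forall>p. \<forall>w\<in>weyl R. polynomial_function p \<longrightarrow>
        m (tensor p id) (tensor (\<lambda>_. 1) w) = tensor p w) \<and>
     (\<forall>a\<in>simple_aff_roots B \<phi>. \<forall>v.
        H_minus (m (tensor (\<lambda>_. 1) (refl a)) (tensor (lin_poly v) id))
                (m (tensor (lin_poly (refl (fst a, 0) v)) id) (tensor (\<lambda>_. 1) (refl a))) =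
        H_scale (of_real (k a * (fst a \<bullet> v))) H_one)"

section \<open>Modules over the algebra\<close>

definition fun_subspace :: "('v \<Rightarrow> complex) set \<Rightarrow> bool" where
  "fun_subspace X \<longleftrightarrow> (\<lambda>_. 0) \<in> X \<and>
     (\<forall>f\<in>X. \<forall>g\<in>X. (\<lambda>x. f x + g x) \<in> X) \<and> (\<forall>c. \<forall>f\<in>X. (\<lambda>x. c * f x) \<in> X)"

definition fun_linear_on ::
  "('v \<Rightarrow> complex) set \<Rightarrow> (('v \<Rightarrow> complex) \<Rightarrow> 'v \<Rightarrow> complex) \<Rightarrow> bool" where
  "fun_linear_on X A \<longleftrightarrow>
     (\<forall>f\<in>X. \<forall>g\<in>X. A (\<lambda>x. f x + g x) = (\<lambda>x. A f x + A g x)) \<and>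
     (\<forall>c. \<forall>f\<in>X. A (\<lambda>x. c * f x) = (\<lambda>x. c * A f x))"

definition H_module ::
  "'v::euclidean_space set \<Rightarrow> ('v hecke \<Rightarrow> 'v hecke \<Rightarrow> 'v hecke) \<Rightarrow>
   ('v hecke \<Rightarrow> ('v \<Rightarrow> complex) \<Rightarrow> 'v \<Rightarrow> complex) \<Rightarrow> ('v \<Rightarrow> complex) set \<Rightarrow> bool" where
  "H_module R m \<rho> X \<longleftrightarrow>
     fun_subspace X \<and>
     (\<forall>h\<in>H_space R. (\<forall>f\<in>X. \<rho> h f \<in> X) \<and> fun_linear_on X (\<rho> h)) \<and>
     (\<forall>h\<in>H_space R. \<forall>h'\<in>H_space R. \<forall>f\<in>X. \<rho> (H_plus h h') f = (\<lambda>x. \<rho> h f x + \<rho> h' f x)) \<and>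
     (\<forall>c. \<forall>h\<in>H_space R. \<forall>f\<in>X. \<rho> (H_scale c h) f = (\<lambda>x. c * \<rho> h f x)) \<and>
     (\<forall>h\<in>H_space R. \<forall>h'\<in>H_space R. \<forall>f\<in>X. \<rho> (m h h') f = \<rho> h (\<rho> h' f)) \<and>
     (\<forall>f\<in>X. \<rho> H_one f = f)"

definition H_submodule ::
  "'v::euclidean_space set \<Rightarrow> ('v hecke \<Rightarrow> 'v hecke \<Rightarrow> 'v hecke) \<Rightarrow>
   ('v hecke \<Rightarrow> ('v \<Rightarrow> complex) \<Rightarrow> 'v \<Rightarrow> complex) \<Rightarrow>
   ('v \<Rightarrow> complex) set \<Rightarrow> ('v \<Rightarrow> complex) set \<Rightarrow> bool" where
  "H_submodule R m \<rho> X Y \<longleftrightarrow>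
     H_module R m \<rho> X \<and> Y \<subseteq> X \<and> fun_subspace Y \<and> (\<forall>h\<in>H_space R. \<forall>f\<in>Y. \<rho> h f \<in> Y)"

definition H_module_iso ::
  "'v::euclidean_space set \<Rightarrow> ('v hecke \<Rightarrow> 'v hecke \<Rightarrow> 'v hecke) \<Rightarrow>
   ('v hecke \<Rightarrow> ('v \<Rightarrow> complex) \<Rightarrow> 'v \<Rightarrow> complex) \<Rightarrow> ('v \<Rightarrow> complex) set \<Rightarrow>
   ('v hecke \<Rightarrow> ('v \<Rightarrow> complex) \<Rightarrow> 'v \<Rightarrow> complex) \<Rightarrow> ('v \<Rightarrow> complex) set \<Rightarrow>
   (('v \<Rightarrow> complex) \<Rightarrow> 'v \<Rightarrow> complex) \<Rightarrow> bool" where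
  "H_module_iso R m \<rho> X \<sigma> Y T \<longleftrightarrow>
     H_module R m \<rho> X \<and> H_module R m \<sigma> Y \<and>
     bij_betw T X Y \<and> fun_linear_on X T \<and> (\<forall>h\<in>H_space R. \<forall>f\<in>X. T (\<rho> h f) = \<sigma> h (T f))"

section \<open>The two representations and the propagation operator\<close>

definition chi :: "'v::euclidean_space \<times> real \<Rightarrow> 'v \<Rightarrow> complex" where
  "chi a x = (if aff a x < 0 then 1 else 0)"

text \<open>The sum over all positive affine roots is infinite, but at each point only finitely many terms
  are non-zero; since \<^const>\<open>sum\<close> is 0 on infinite sets, it is restricted to the roots with
  $\chi_a(x) \neq 0$.\<close>

definition dunkl ::
  "'v::euclidean_space set \<Rightarrow> 'v set \<Rightarrow> 'v \<Rightarrow> ('v \<times> real \<Rightarrow> real) \<Rightarrow>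
   'v \<Rightarrow> ('v \<Rightarrow> complex) \<Rightarrow> 'v \<Rightarrow> complex" where
  "dunkl R B \<phi> k v f = restr (V_reg R B \<phi>) (\<lambda>x. dderiv v f x +
     (\<Sum>a\<in>{a \<in> pos_aff_roots R B \<phi>. chi a x \<noteq> 0}.
        of_real (k a * (fst a \<bullet> v)) * chi a x * act (refl a) f x))"

definition pi_representation ::
  "'v::euclidean_space set \<Rightarrow> 'v set \<Rightarrow> 'v \<Rightarrow> ('v \<times> real \<Rightarrow> real) \<Rightarrow>
   ('v hecke \<Rightarrow> 'v hecke \<Rightarrow> 'v hecke) \<Rightarrow>
   ('v hecke \<Rightarrow> ('v \<Rightarrow> complex) \<Rightarrow> 'v \<Rightarrow> complex) \<Rightarrow> bool" where
  "pi_representation R B \<phi> k m \<pi> \<longleftrightarrow>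
     H_module R m \<pi> (C_inf (V_reg R B \<phi>)) \<and>
     (\<forall>f\<in>C_inf (V_reg R B \<phi>).
        (\<forall>v. \<pi> (tensor (lin_poly v) id) f = dunkl R B \<phi> k v f) \<and>
        (\<forall>w\<in>weyl R. \<pi> (tensor (\<lambda>_. 1) w) f = act w f))"

definition Q_op ::
  "('v::euclidean_space \<times> real \<Rightarrow> real) \<Rightarrow> 'v \<times> real \<Rightarrow> ('v \<Rightarrow> complex) \<Rightarrow> 'v \<Rightarrow> complex" where
  "Q_op k a f = (\<lambda>x. f (refl a x) +
     of_real (k a) * (LBINT t=0..aff a x. f (x - t *\<^sub>R coroot (fst a))))"

definition Q_action ::
  "'v::euclidean_space set \<Rightarrow> 'v set \<Rightarrow> 'v \<Rightarrow> ('v \<times> real \<Rightarrow> real) \<Rightarrow>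
   (('v \<Rightarrow> 'v) \<Rightarrow> ('v \<Rightarrow> complex) \<Rightarrow> 'v \<Rightarrow> complex) \<Rightarrow> bool" where
  "Q_action R B \<phi> k QW \<longleftrightarrow>
     (\<forall>w\<in>weyl R. (\<forall>f\<in>C_cont. QW w f \<in> C_cont) \<and> fun_linear_on C_cont (QW w)) \<and>
     (\<forall>u\<in>weyl R. \<forall>w\<in>weyl R. \<forall>f\<in>C_cont. QW (u \<circ> w) f = QW u (QW w f)) \<and>
     (\<forall>f\<in>C_cont. QW id f = f) \<and>
     (\<forall>a\<in>simple_aff_roots B \<phi>. \<forall>f\<in>C_cont. QW (refl a) f = Q_op k a f)"

definition Q_representation ::
  "'v::euclidean_space set \<Rightarrow> ('v hecke \<Rightarrow> 'v hecke \<Rightarrow> 'v hecke) \<Rightarrow>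
   (('v \<Rightarrow> 'v) \<Rightarrow> ('v \<Rightarrow> complex) \<Rightarrow> 'v \<Rightarrow> complex) \<Rightarrow>
   ('v hecke \<Rightarrow> ('v \<Rightarrow> complex) \<Rightarrow> 'v \<Rightarrow> complex) \<Rightarrow> bool" where
  "Q_representation R m QW Q \<longleftrightarrow>
     H_module R m Q (C_inf UNIV) \<and>
     (\<forall>f\<in>C_inf UNIV.
        (\<forall>v. Q (tensor (lin_poly v) id) f = dderiv v f) \<and>
        (\<forall>w\<in>weyl R. Q (tensor (\<lambda>_. 1) w) f = QW w f))"

text \<open>\<open>QW\<close> is the action $Q_k$ of $W$ on $C(V)$. The value at $x$ is the common value of
  $(Q_k(w) f)(v)$ over all $w \in W$ and $v \in \overline{C_+}$ with $x = w^{-1} v$.\<close>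

definition T_op ::
  "'v::euclidean_space set \<Rightarrow> 'v set \<Rightarrow> 'v \<Rightarrow>
   (('v \<Rightarrow> 'v) \<Rightarrow> ('v \<Rightarrow> complex) \<Rightarrow> 'v \<Rightarrow> complex) \<Rightarrow> ('v \<Rightarrow> complex) \<Rightarrow> 'v \<Rightarrow> complex" where
  "T_op R B \<phi> QW f x =
     (THE y. \<exists>w\<in>weyl R. \<exists>v\<in>closure (fund_alcove B \<phi>). x = inv w v \<and> y = QW w f v)"

end

theory Submission
  imports Defs
begin

text \<open>
  On the chamber $w^{-1} C_+$ the function $T_k f$ is $(Q_k(w) f) \circ w$. Since the simple affine
  reflections vanishing at a point of $\overline{C_+}$ generate its stabiliser, and $Q_{k,a}$ does not
  change values on $V_a$, this defines a continuous function. Crossing a wall replaces $Q_k(w) f$ by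
  $Q_{k,a} Q_k(w) f$, and the cross relation in $Q_k$ computes the normal derivatives of the latter
  on $V_a$; these are exactly the prescribed jumps. Conversely the jump conditions determine all normal
  derivatives on one side of a wall from those on the other side, so that by the identity theorem an
  element of $C^{\omega,(k)}(V)$ is determined by its restriction to $C_+$; hence $T_k$ is bijective.
  It intertwines $\partial_v$ with the Dunkl operator trivially on $C_+$, and the cross relations in
  the two representations carry the identity from a chamber $C$ to $s_a C$, $a$ simple. Part (i)
  follows, the image of a submodule under an intertwiner being a submodule.
\<close>

section \<open>Power series indexed by words\<close>

text \<open>The delicate point is analyticity. The module \<open>Q\<close> acts on smooth functions,
  so it has to be proved that \<open>Q_op\<close> preserves \<open>C_omega\<close>, and the
  multi-index series in the definition of \<open>C_omega\<close> behave badly under reflections and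
  integrals. They are traded for locally uniform bounds \<open>C M^n n!\<close> on iterated
  derivatives in arbitrary directions, weighted by the norms of the directions. Reflections preserve
  norms, so the twisted direction \<open>s_a v\<close> in the cross relation does no harm to such a
  bound; each use of the relation adds one lower-order term, and the resulting factor linear in
  \<open>n\<close> is absorbed by doubling \<open>M\<close>. The same bounds give Taylor expansions
  with a locally uniform radius, hence the identity theorem. A second obstacle is that only normal
  jumps are prescribed. They suffice because every point near a wall lies on a normal line through
  the wall, and Taylor's formula along that line involves normal derivatives alone. Finally, the
  algebra is given by axioms: compatibility is established for \<open>v\<close> and \<open>w\<close>
  and carried to all elements by sums, scalars and products.\<close>

text \<open>\<open>psum n d h\<close> sums $d_l\, h^l$ over the words $l$ of length $n$ in the standard basis. Indexing by
  words instead of multi-indices avoids multinomial coefficients: in the Taylor expansion of $f$ the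
  coefficient of $l$ is the iterated derivative along $l$, divided by $n!$. The coefficients of the
  $b$-th partial derivative are given by \<open>deriv_coeff b\<close>, which inserts $b$ at every position.\<close>

primrec psum :: "nat \<Rightarrow> ('v::euclidean_space list \<Rightarrow> complex) \<Rightarrow> 'v \<Rightarrow> complex" where
  "psum 0 d h = d []"
| "psum (Suc n) d h = (\<Sum>b\<in>Basis. of_real (h \<bullet> b) * psum n (\<lambda>l. d (b # l)) h)"

primrec deriv_coeff :: "'v \<Rightarrow> 'v list \<Rightarrow> ('v list \<Rightarrow> complex) \<Rightarrow> complex" where
  "deriv_coeff b [] d = d [b]"
| "deriv_coeff b (c # l) d = d (b # c # l) + deriv_coeff b l (\<lambda>l. d (c # l))"

lemma psum_add: "psum n (\<lambda>l. c l + d l) h = psum n c h + psum n d h"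
  by (induction n arbitrary: c d) (auto simp: sum.distrib ring_distribs)

lemma psum_cmult: "psum n (\<lambda>l. z * d l) h = z * psum n d h"
  by (induction n arbitrary: d) (auto simp: sum_distrib_left algebra_simps)

lemma psum_sum: "finite A \<Longrightarrow> psum n (\<lambda>l. \<Sum>a\<in>A. d a l) h = (\<Sum>a\<in>A. psum n (d a) h)"
proof (induction A rule: finite_induct)
  case empty
  \<comment> \<open>Homogeneity with the scalar \<open>0\<close> shows that zero coefficients give
    the sum \<open>0\<close>.\<close>
  show ?case using psum_cmult[of n 0 "\<lambda>_. 0" h] by simp
qed (simp add: psum_add)

text \<open>There are \<open>DIM('v) ^ n\<close> words of length \<open>n\<close>, and each
  coordinate of \<open>h\<close> is at most \<open>norm h\<close>.\<close>

lemma norm_psum_le: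
  assumes "\<And>l. length l = n \<Longrightarrow> norm (d l) \<le> g"
  shows "norm (psum n d (h::'v::euclidean_space)) \<le> g * (DIM('v) * norm h) ^ n"
  using assms
proof (induction n arbitrary: d)
  case (Suc n)
  have "norm (psum (Suc n) d h) \<le> (\<Sum>b\<in>(Basis::'v set). norm h * (g * (DIM('v) * norm h) ^ n))"
    unfolding psum.simps
  proof (rule sum_norm_le)
    fix b :: 'v assume b: "b \<in> Basis"
    have "norm (psum n (\<lambda>l. d (b # l)) h) \<le> g * (DIM('v) * norm h) ^ n"
      by (rule Suc.IH) (use Suc.prems in auto)
    then show "norm (of_real (h \<bullet> b) * psum n (\<lambda>l. d (b # l)) h) \<le> norm h * (g * (DIM('v) * norm h) ^ n)"
      using Basis_le_norm[OF b, of h] by (auto simp: norm_mult intro!: mult_mono)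
  qed
  then show ?case by (simp add: algebra_simps)
qed auto

text \<open>The partial derivative of the part of degree \<open>n\<close> has degree
  \<open>n - 1\<close>. The index keeps the original degree, so that a series can be differentiated
  term by term without reindexing.\<close>

definition dpsum :: "nat \<Rightarrow> ('v::euclidean_space list \<Rightarrow> complex) \<Rightarrow> 'v \<Rightarrow> 'v \<Rightarrow> complex" where
  "dpsum n d b h = (case n of 0 \<Rightarrow> 0 | Suc m \<Rightarrow> psum m (\<lambda>l. deriv_coeff b l d) h)"

lemma dpsum_simps [simp]: "dpsum 0 d b h = 0" "dpsum (Suc m) d b h = psum m (\<lambda>l. deriv_coeff b l d) h"
  by (auto simp: dpsum_def)

text \<open>Leibniz rule for the leading letter: either its coordinate is differentiated, or it
  stays and a later letter is.\<close>

lemma dpsum_Suc: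
  "dpsum (Suc n) d b h = psum n (\<lambda>l. d (b # l)) h
     + (\<Sum>c\<in>Basis. of_real (h \<bullet> c) * dpsum n (\<lambda>l. d (c # l)) b h)"
  by (cases n) (auto simp: psum_add ring_distribs sum.distrib)

lemma psum_has_derivative:
  "(psum n d has_derivative (\<lambda>v. \<Sum>b\<in>Basis. of_real (v \<bullet> b) * dpsum n d b h)) (at h)"
proof (induction n arbitrary: d)
  case 0
  have "psum 0 d = (\<lambda>_. d [])" by auto
  then show ?case by simp
next
  case (Suc n)
  let ?D = "\<lambda>c v. \<Sum>b\<in>Basis. of_real (v \<bullet> b) * dpsum n (\<lambda>l. d (c # l)) b h"
  have eq: "psum (Suc n) d = (\<lambda>h. \<Sum>b\<in>Basis. of_real (h \<bullet> b) * psum n (\<lambda>l. d (b # l)) h)"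
    by auto
  have "(psum (Suc n) d has_derivative (\<lambda>v. \<Sum>c\<in>Basis. of_real (h \<bullet> c) * ?D c v
      + of_real (v \<bullet> c) * psum n (\<lambda>l. d (c # l)) h)) (at h)"
    unfolding eq by (rule has_derivative_sum, rule has_derivative_mult[OF _ Suc.IH])
      (auto intro!: derivative_eq_intros)
  moreover have "(\<Sum>c\<in>Basis. of_real (h \<bullet> c) * ?D c v + of_real (v \<bullet> c) * psum n (\<lambda>l. d (c # l)) h)
     = (\<Sum>b\<in>Basis. of_real (v \<bullet> b) * dpsum (Suc n) d b h)" for v
    unfolding dpsum_Suc
    by (simp add: ring_distribs sum.distrib sum_distrib_left mult_ac)
       (subst sum.swap, simp add: mult_ac)
  ultimately show ?case by (simp only:)
qed

text \<open>A word of length \<open>n\<close> has \<open>n + 1\<close> places at which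
  \<open>b\<close> can be inserted. \<open>G\<close> is an arbitrary function because the induction
  strips the first letter and thereby shifts the bound.\<close>

lemma norm_deriv_coeff_le:
  fixes G :: "nat \<Rightarrow> real"
  assumes "\<And>l. norm (d l) \<le> G (length l)"
  shows "norm (deriv_coeff b l d) \<le> (real (length l) + 1) * G (length l + 1)"
  using assms
proof (induction l arbitrary: d G)
  case Nil
  show ?case using Nil[of "[b]"] by simp
next
  case (Cons c l)
  have "norm (deriv_coeff b l (\<lambda>l. d (c # l))) \<le> (real (length l) + 1) * G (Suc (length l + 1))"
    by (rule Cons.IH[where G = "\<lambda>n. G (Suc n)"]) (use Cons.prems[of "c # _"] in simp)
  moreover have "norm (d (b # c # l)) \<le> G (length l + 2)"
    using Cons.prems[of "b # c # l"] by simp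
  ultimately show ?case
    by (auto simp: algebra_simps intro: norm_triangle_le)
qed

text \<open>The bound satisfied by the coefficients of a $k$-th derivative of a power series whose
  coefficients are bounded by $K N^n$.\<close>

definition majorized :: "real \<Rightarrow> real \<Rightarrow> nat \<Rightarrow> ('v list \<Rightarrow> complex) \<Rightarrow> bool" where
  "majorized K N k d \<longleftrightarrow>
     (\<forall>l. norm (d l) \<le> K * N ^ (length l + k) * fact (length l + k) / fact (length l))"

text \<open>The factor \<open>length l + 1\<close> from the insertions turns the denominator
  \<open>fact (length l + 1)\<close> into \<open>fact (length l)\<close>; the quotient of factorials
  is chosen so that it reproduces itself with \<open>k\<close> raised by one.\<close>

lemma majorized_deriv_coeff:
  assumes "majorized K N k d"
  shows "majorized K N (Suc k) (\<lambda>l. deriv_coeff b l d)"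
  unfolding majorized_def
proof
  fix l
  have "norm (deriv_coeff b l d) \<le> (real (length l) + 1) *
      (K * N ^ (length l + 1 + k) * fact (length l + 1 + k) / fact (length l + 1))"
    by (rule norm_deriv_coeff_le) (use assms in \<open>auto simp: majorized_def\<close>)
  also have "\<dots> = K * N ^ (length l + Suc k) * fact (length l + Suc k) / fact (length l)"
    by (simp add: divide_simps)
  finally show "norm (deriv_coeff b l d) \<le> K * N ^ (length l + Suc k) * fact (length l + Suc k) / fact (length l)" .
qed

lemma majorized_sum:
  fixes v :: "'v::euclidean_space" and d :: "'v \<Rightarrow> 'v list \<Rightarrow> complex"
  assumes "\<And>b. b \<in> Basis \<Longrightarrow> majorized K N k (d b)" "K \<ge> 0" "N \<ge> 0"
  shows "majorized (K * (DIM('v) * norm v)) N k (\<lambda>l. \<Sum>b\<in>Basis. of_real (v \<bullet> b) * d b l)"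
  unfolding majorized_def
proof
  fix l :: "'v list"
  let ?B = "K * N ^ (length l + k) * fact (length l + k) / fact (length l)"
  have "norm (\<Sum>b\<in>Basis. of_real (v \<bullet> b) * d b l) \<le> (\<Sum>b\<in>(Basis::'v set). norm v * ?B)"
  proof (rule sum_norm_le)
    fix b :: 'v assume b: "b \<in> Basis"
    then have "norm (d b l) \<le> ?B" using assms by (auto simp: majorized_def)
    then show "norm (of_real (v \<bullet> b) * d b l) \<le> norm v * ?B"
      unfolding norm_mult norm_of_real using Basis_le_norm[OF b, of v] by (intro mult_mono) auto
  qed
  then show "norm (\<Sum>b\<in>Basis. of_real (v \<bullet> b) * d b l)
      \<le> K * (DIM('v) * norm v) * N ^ (length l + k) * fact (length l + k) / fact (length l)"
    by (simp add: mult_ac)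
qed

text \<open>The quotient is \<open>fact k\<close> times a binomial coefficient, which is at most a
  power of two. This separates the order \<open>k\<close> of the derivative from the degree
  \<open>n\<close>.\<close>

lemma fact_add_le: "fact (n + k) / fact n \<le> (2::real) ^ (n + k) * fact k"
proof -
  have "fact (n + k) / fact n = real ((n + k) choose k) * fact k"
    by (subst binomial_fact) (auto simp: field_simps)
  also have "\<dots> \<le> 2 ^ (n + k) * fact k"
  proof (rule mult_right_mono)
    have "real ((n + k) choose k) \<le> real (2 ^ (n + k))"
      using binomial_le_pow2[of "n + k" k] by linarith
    then show "real ((n + k) choose k) \<le> 2 ^ (n + k)" by simp
  qed auto
  finally show ?thesis .
qed

text \<open>In the radius, \<open>N\<close> compensates the growth of the coefficients,
  \<open>DIM('v)\<close> the number of words and one factor 2 the bound \<open>fact_add_le\<close>;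
  the other factor 2 leaves the ratio \<open>1/2\<close>. The radius does not depend on
  \<open>k\<close>, so all derivatives converge on the same ball.\<close>

lemma norm_psum_majorized:
  fixes h :: "'v::euclidean_space"
  assumes "majorized K N k d" "K \<ge> 0" "N > 0" "norm h \<le> 1 / (4 * N * DIM('v))"
  shows "norm (psum n d h) \<le> K * (2 * N) ^ k * fact k * (1/2) ^ n"
proof -
  have D: "0 < DIM('v)" by simp
  have "norm (psum n d h) \<le> (K * N ^ (n + k) * (2 ^ (n + k) * fact k)) * (DIM('v) * norm h) ^ n"
  proof (rule norm_psum_le)
    fix l :: "'v list" assume "length l = n"
    then have "norm (d l) \<le> K * N ^ (n + k) * (fact (n + k) / fact n)"
      using assms(1) by (auto simp: majorized_def)
    also have "\<dots> \<le> K * N ^ (n + k) * (2 ^ (n + k) * fact k)"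
      using fact_add_le assms by (intro mult_left_mono) auto
    finally show "norm (d l) \<le> K * N ^ (n + k) * (2 ^ (n + k) * fact k)" .
  qed
  also have "\<dots> \<le> (K * N ^ (n + k) * (2 ^ (n + k) * fact k)) * (1 / (4 * N)) ^ n"
    using assms D by (intro mult_left_mono power_mono) (auto simp: field_simps)
  also have "\<dots> = K * (2 * N) ^ k * fact k * (1/2) ^ n"
  proof -
    have "(1 / (4 * N)) ^ n * (N ^ n * 2 ^ n) = (1/2) ^ n" using assms
      unfolding power_mult_distrib[symmetric] by (simp add: field_simps)
    then show ?thesis
      by (simp only: power_add power_mult_distrib mult_ac) (metis mult.assoc mult.commute mult.left_commute)
  qed
  finally show ?thesis .
qed

lemma psum_summable:
  fixes h :: "'v::euclidean_space"
  assumes "majorized K N k d" "K \<ge> 0" "N > 0" "norm h \<le> 1 / (4 * N * DIM('v))"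
  shows "summable (\<lambda>n. psum n d h)"
    and "norm (\<Sum>n. psum n d h) \<le> 2 * K * (2 * N) ^ k * fact k"
proof -
  have s: "summable (\<lambda>n. K * (2 * N) ^ k * fact k * (1/2) ^ n :: real)"
    by (intro summable_mult summable_geometric) auto
  show "summable (\<lambda>n. psum n d h)"
    by (rule summable_comparison_test[OF _ s]) (use norm_psum_majorized[OF assms] in blast)
  have "norm (\<Sum>n. psum n d h) \<le> (\<Sum>n. K * (2 * N) ^ k * fact k * (1/2) ^ n)"
    by (rule norm_suminf_le[OF norm_psum_majorized[OF assms] s])
  also have "\<dots> = K * (2 * N) ^ k * fact k * 2"
    by (subst suminf_mult) (auto simp: suminf_geometric intro: summable_geometric)
  finally show "norm (\<Sum>n. psum n d h) \<le> 2 * K * (2 * N) ^ k * fact k" by simp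
qed

text \<open>The bound on the differentiated terms is uniform on the ball, so the series may be
  differentiated termwise. The result is again a series over words, which makes iteration
  possible.\<close>

lemma psum_series_has_derivative:
  fixes h :: "'v::euclidean_space"
  assumes maj: "majorized K N k d" and "K \<ge> 0" "N > 0"
    and h: "norm h < 1 / (4 * N * DIM('v))"
  shows "((\<lambda>h. \<Sum>n. psum n d h) has_derivative
           (\<lambda>v. \<Sum>n. psum n (\<lambda>l. \<Sum>b\<in>Basis. of_real (v \<bullet> b) * deriv_coeff b l d) h)) (at h)"
proof -
  define S where "S = ball (0::'v) (1 / (4 * N * DIM('v)))"
  define C where "C = K * (2 * N) ^ Suc k * fact (Suc k)"
  have C: "C \<ge> 0" using assms unfolding C_def by auto
  have del: "norm (psum n (\<lambda>l. deriv_coeff b l d) x) \<le> C * (1/2) ^ n" if "x \<in> S" for n b x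
    using norm_psum_majorized[OF majorized_deriv_coeff[OF maj]] that assms by (auto simp: C_def S_def)
  \<comment> \<open>The \<open>n\<close>-th term is a sum of degree \<open>n - 1\<close>, hence the
    factor 2 against \<open>C * (1/2) ^ n\<close>.\<close>
  have dp: "norm (dpsum n d b x) \<le> 2 * C * (1/2) ^ n" if "x \<in> S" for n b x
    using del[OF that, of "n - 1" b] C by (cases n) auto
  have sb: "summable (\<lambda>n. 2 * C * (1/2) ^ n :: real)"
    by (intro summable_mult summable_geometric) auto
  have ul: "uniform_limit S (\<lambda>n x. \<Sum>i<n. dpsum i d b x) (\<lambda>x. \<Sum>i. dpsum i d b x) sequentially" for b
    by (rule Weierstrass_m_test[OF _ sb]) (use dp in auto)
  have sm: "summable (\<lambda>i. dpsum i d b x)" if "x \<in> S" for b x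
    by (rule summable_comparison_test[OF _ sb]) (use dp that in blast)
  define g' where "g' x v = (\<Sum>b\<in>Basis. of_real (v \<bullet> b) * (\<Sum>i. dpsum i d b x))" for x v :: 'v
  have hS: "h \<in> S" using h by (auto simp: S_def)
  have "\<exists>g. \<forall>x\<in>S. (\<lambda>n. psum n d x) sums g x \<and> (g has_derivative g' x) (at x within S)"
  proof (rule has_derivative_series[where f = "\<lambda>n. psum n d" and x = 0 and l = "\<Sum>n. psum n d 0"])
    show "convex S" by (auto simp: S_def)
    show "(psum n d has_derivative (\<lambda>v. \<Sum>b\<in>Basis. of_real (v \<bullet> b) * dpsum n d b x)) (at x within S)" for n x
      by (rule has_derivative_at_withinI[OF psum_has_derivative])
    show "0 \<in> S" using assms by (auto simp: S_def)
    show "(\<lambda>n. psum n d 0) sums (\<Sum>n. psum n d 0)"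
      using psum_summable(1)[OF maj] assms by (auto intro: summable_sums)
    \<comment> \<open>\<open>v\<close> is expanded in the basis, so each of the
      \<open>DIM('v)\<close> partial derivatives is approximated up to \<open>e / DIM('v)\<close> to
      reach \<open>e * norm v\<close>.\<close>
    fix e :: real assume e: "e > 0"
    have "\<forall>\<^sub>F n in sequentially. \<forall>b\<in>Basis. \<forall>x\<in>S.
        dist (\<Sum>i<n. dpsum i d b x) (\<Sum>i. dpsum i d b x) < e / DIM('v)"
      using ul e unfolding uniform_limit_iff
      by (intro eventually_ball_finite) auto
    then show "\<forall>\<^sub>F n in sequentially. \<forall>x\<in>S. \<forall>v.
      norm ((\<Sum>i<n. \<Sum>b\<in>Basis. of_real (v \<bullet> b) * dpsum i d b x) - g' x v) \<le> e * norm v"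
    proof eventually_elim
      case (elim n)
      show ?case
      proof (intro ballI allI)
        fix x v :: 'v assume x: "x \<in> S"
        have "(\<Sum>i<n. \<Sum>b\<in>Basis. of_real (v \<bullet> b) * dpsum i d b x) - g' x v
          = (\<Sum>b\<in>Basis. of_real (v \<bullet> b) * ((\<Sum>i<n. dpsum i d b x) - (\<Sum>i. dpsum i d b x)))"
          unfolding g'_def by (subst sum.swap) (simp add: sum_subtractf right_diff_distrib sum_distrib_left)
        also have "norm \<dots> \<le> (\<Sum>b\<in>(Basis::'v set). norm v * (e / DIM('v)))"
        proof (rule sum_norm_le)
          fix b :: 'v assume b: "b \<in> Basis"
          have "norm ((\<Sum>i<n. dpsum i d b x) - (\<Sum>i. dpsum i d b x)) \<le> e / DIM('v)"
            using elim b x by (auto simp: dist_norm intro: less_imp_le)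
          then show "norm (of_real (v \<bullet> b) * ((\<Sum>i<n. dpsum i d b x) - (\<Sum>i. dpsum i d b x)))
              \<le> norm v * (e / DIM('v))"
            unfolding norm_mult norm_of_real using Basis_le_norm[OF b, of v] by (intro mult_mono) auto
        qed
        also have "\<dots> = e * norm v" by simp
        finally show "norm ((\<Sum>i<n. \<Sum>b\<in>Basis. of_real (v \<bullet> b) * dpsum i d b x) - g' x v) \<le> e * norm v" .
      qed
    qed
  qed
  then obtain g where g: "\<And>x. x \<in> S \<Longrightarrow> (\<lambda>n. psum n d x) sums g x"
    and g': "\<And>x. x \<in> S \<Longrightarrow> (g has_derivative g' x) (at x within S)" by blast
  have "(g has_derivative g' h) (at h)"
    using g'[OF hS] at_within_open[OF hS] by (simp add: S_def)
  then have "((\<lambda>h. \<Sum>n. psum n d h) has_derivative g' h) (at h)"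
    by (rule has_derivative_transform_within_open[where s = S])
       (use hS g in \<open>auto simp: S_def sums_iff\<close>)
  moreover have "g' h = (\<lambda>v. \<Sum>n. psum n (\<lambda>l. \<Sum>b\<in>Basis. of_real (v \<bullet> b) * deriv_coeff b l d) h)"
  proof
    fix v
    have "(\<Sum>n. psum n (\<lambda>l. \<Sum>b\<in>Basis. of_real (v \<bullet> b) * deriv_coeff b l d) h)
       = (\<Sum>n. \<Sum>b\<in>Basis. of_real (v \<bullet> b) * dpsum (Suc n) d b h)"
      by (simp add: psum_sum psum_cmult)
    also have "\<dots> = (\<Sum>b\<in>Basis. \<Sum>n. of_real (v \<bullet> b) * dpsum (Suc n) d b h)"
      by (rule suminf_sum, rule summable_mult, subst summable_Suc_iff, rule sm[OF hS])
    also have "\<dots> = (\<Sum>b\<in>Basis. of_real (v \<bullet> b) * (\<Sum>n. dpsum (Suc n) d b h))"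
      by (intro sum.cong refl suminf_mult, subst summable_Suc_iff, rule sm[OF hS])
    \<comment> \<open>The term \<open>dpsum 0\<close> vanishes, so shifting the index by one leaves
      the sum unchanged.\<close>
    also have "\<dots> = g' h v" unfolding g'_def
      using suminf_split_head[OF sm[OF hS]] by simp
    finally show "g' h v = (\<Sum>n. psum n (\<lambda>l. \<Sum>b\<in>Basis. of_real (v \<bullet> b) * deriv_coeff b l d) h)" by simp
  qed
  ultimately show ?thesis by simp
qed

section \<open>Analyticity through Cauchy estimates\<close>

lemma dderiv_has_derivative:
  assumes "(f has_derivative f') (at x)"
  shows "dderiv v f x = f' v"
proof -
  have "((\<lambda>t. f (x + t *\<^sub>R v)) has_derivative (\<lambda>t. f' (t *\<^sub>R v))) (at 0)"
    by (rule has_derivative_compose[where g = f and f = "\<lambda>t. x + t *\<^sub>R v"])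
       (use assms in \<open>auto intro!: derivative_eq_intros\<close>)
  moreover have "(\<lambda>t. f' (t *\<^sub>R v)) = (\<lambda>t. t *\<^sub>R f' v)"
    using has_derivative_linear[OF assms] by (simp add: linear_cmul)
  ultimately show ?thesis
    unfolding dderiv_def by (intro vector_derivative_at) (simp add: has_vector_derivative_def)
qed

lemma has_derivative_dderiv:
  assumes "f differentiable (at x)"
  shows "(f has_derivative (\<lambda>v. dderiv v f x)) (at x)"
proof -
  obtain f' where f': "(f has_derivative f') (at x)" using assms by (auto simp: differentiable_def)
  moreover have "f' = (\<lambda>v. dderiv v f x)" using dderiv_has_derivative[OF f'] by auto
  ultimately show ?thesis by simp
qed

lemma dderiv_cong_open:
  assumes "open S" "x \<in> S" "\<And>y. y \<in> S \<Longrightarrow> f y = g y"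
  shows "dderiv v f x = dderiv v g x"
proof -
  have "open ((\<lambda>t. x + t *\<^sub>R v) -` S)"
    by (intro open_vimage assms(1) continuous_intros)
  then have "eventually (\<lambda>t. t \<in> (\<lambda>t. x + t *\<^sub>R v) -` S) (nhds (0::real))"
    by (rule eventually_nhds_in_open) (use assms(2) in auto)
  then have ev: "eventually (\<lambda>t. f (x + t *\<^sub>R v) = g (x + t *\<^sub>R v)) (nhds (0::real))"
    by eventually_elim (use assms(3) in auto)
  show ?thesis unfolding dderiv_def
    by (rule vector_derivative_cong_eq) (use ev in \<open>auto elim: eventually_mono\<close>)
qed

lemma dderiv_funpow_cong_open:
  assumes "open S" "\<And>y. y \<in> S \<Longrightarrow> f y = g y" "x \<in> S"
  shows "(dderiv v ^^ r) f x = (dderiv v ^^ r) g x"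
  using assms(3)
proof (induction r arbitrary: x)
  case (Suc r)
  show ?case unfolding funpow.simps o_def
    by (rule dderiv_cong_open[OF assms(1) Suc.prems]) (rule Suc.IH)
qed (simp add: assms(2))

lemma C_inf_UNIV_iff: "f \<in> C_inf UNIV \<longleftrightarrow> (\<forall>n. Ck_on n UNIV f)"
  by (simp add: C_inf_def)

lemma C_inf_differentiable: "f \<in> C_inf UNIV \<Longrightarrow> f differentiable (at x)"
  unfolding C_inf_UNIV_iff by (drule spec[of _ 1]) (simp add: differentiable_on_def)

lemma C_inf_dderiv: "f \<in> C_inf UNIV \<Longrightarrow> dderiv v f \<in> C_inf UNIV"
  unfolding C_inf_UNIV_iff
proof
  fix n assume "\<forall>n. Ck_on n UNIV f"
  then have "Ck_on (Suc n) UNIV f" by blast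
  then show "Ck_on n UNIV (dderiv v f)" by simp
qed

lemma C_inf_funpow_dderiv: "f \<in> C_inf UNIV \<Longrightarrow> (dderiv v ^^ r) f \<in> C_inf UNIV"
  by (induction r) (auto intro: C_inf_dderiv)

lemma C_inf_continuous: "f \<in> C_inf UNIV \<Longrightarrow> continuous_on A f"
  using C_inf_differentiable differentiable_imp_continuous_within
  by (metis continuous_at_imp_continuous_on)

text \<open>The induction on the order of differentiability, carried out once. Closure properties of
  the smooth functions then reduce to exhibiting a class of differentiable functions that is stable
  under directional derivatives.\<close>

lemma C_inf_coinduct:
  assumes "P f" and step: "\<And>g. P g \<Longrightarrow> (\<forall>x. g differentiable (at x)) \<and> (\<forall>v. P (dderiv v g))"
  shows "f \<in> C_inf UNIV"
proof -
  have "P g \<Longrightarrow> Ck_on n UNIV g" for n g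
  proof (induction n arbitrary: g)
    case 0
    then show ?case using step[OF 0]
      by (auto intro!: continuous_at_imp_continuous_on differentiable_imp_continuous_within)
  next
    case (Suc n)
    then show ?case using step[OF Suc.prems]
      by (auto intro!: differentiable_at_imp_differentiable_on)
  qed
  then show ?thesis using assms(1) by (simp add: C_inf_UNIV_iff)
qed

lemma dderiv_add:
  assumes "f \<in> C_inf UNIV" "g \<in> C_inf UNIV"
  shows "dderiv v (\<lambda>x. f x + g x) = (\<lambda>x. dderiv v f x + dderiv v g x)"
  using dderiv_has_derivative[OF has_derivative_add[OF has_derivative_dderiv[OF C_inf_differentiable[OF assms(1)]]
    has_derivative_dderiv[OF C_inf_differentiable[OF assms(2)]]]] by (intro ext)

lemma dderiv_cmult:
  assumes "f \<in> C_inf UNIV"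
  shows "dderiv v (\<lambda>x. c * f x) = (\<lambda>x. c * dderiv v f x)"
  using dderiv_has_derivative[OF has_derivative_mult_right[OF has_derivative_dderiv[OF C_inf_differentiable[OF assms]]]]
  by (intro ext)

lemma C_inf_add:
  assumes "f \<in> C_inf UNIV" "g \<in> C_inf UNIV"
  shows "(\<lambda>x. f x + g x) \<in> C_inf UNIV"
proof (rule C_inf_coinduct[where P = "\<lambda>h. \<exists>f g. f \<in> C_inf UNIV \<and> g \<in> C_inf UNIV \<and> h = (\<lambda>x. f x + g x)"])
  fix h :: "'a \<Rightarrow> complex"
  assume "\<exists>f g. f \<in> C_inf UNIV \<and> g \<in> C_inf UNIV \<and> h = (\<lambda>x. f x + g x)"
  then obtain f g where *: "f \<in> C_inf UNIV" "g \<in> C_inf UNIV" "h = (\<lambda>x. f x + g x)" by blast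
  show "(\<forall>x. h differentiable at x) \<and>
        (\<forall>v. \<exists>f g. f \<in> C_inf UNIV \<and> g \<in> C_inf UNIV \<and> dderiv v h = (\<lambda>x. f x + g x))"
    unfolding *(3) dderiv_add[OF *(1,2)]
    using C_inf_dderiv[OF *(1)] C_inf_dderiv[OF *(2)]
    by (blast intro: differentiable_add C_inf_differentiable *)
qed (use assms in blast)

lemma C_inf_cmult:
  assumes "f \<in> C_inf UNIV"
  shows "(\<lambda>x. c * f x) \<in> C_inf UNIV"
proof (rule C_inf_coinduct[where P = "\<lambda>h. \<exists>f. f \<in> C_inf UNIV \<and> h = (\<lambda>x. c * f x)"])
  fix h :: "'a \<Rightarrow> complex"
  assume "\<exists>f. f \<in> C_inf UNIV \<and> h = (\<lambda>x. c * f x)"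
  then obtain f where *: "f \<in> C_inf UNIV" "h = (\<lambda>x. c * f x)" by blast
  show "(\<forall>x. h differentiable at x) \<and> (\<forall>v. \<exists>f. f \<in> C_inf UNIV \<and> dderiv v h = (\<lambda>x. c * f x))"
    unfolding *(2) dderiv_cmult[OF *(1)]
    using C_inf_dderiv[OF *(1)] differentiable_mult[OF differentiable_const C_inf_differentiable[OF *(1)]]
    by blast
qed (use assms in blast)

lemma dderiv_linear:
  assumes "f \<in> C_inf UNIV"
  shows "linear (\<lambda>v. dderiv v f x)"
  using has_derivative_linear[OF has_derivative_dderiv[OF C_inf_differentiable[OF assms]]] .

lemma dderiv_scaleR_dir: "f \<in> C_inf UNIV \<Longrightarrow> dderiv (c *\<^sub>R v) f x = of_real c * dderiv v f x"
  using linear_cmul[OF dderiv_linear] by (simp add: scaleR_conv_of_real)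

lemma dderiv_Basis:
  assumes "f \<in> C_inf UNIV"
  shows "dderiv v f = (\<lambda>x. \<Sum>b\<in>Basis. of_real (v \<bullet> b) * dderiv b f x)"
proof
  fix x
  have "dderiv v f x = dderiv (\<Sum>b\<in>Basis. (v \<bullet> b) *\<^sub>R b) f x" by (simp add: euclidean_representation)
  also have "\<dots> = (\<Sum>b\<in>Basis. (v \<bullet> b) *\<^sub>R dderiv b f x)"
    by (simp add: linear_sum[OF dderiv_linear[OF assms]] linear_cmul[OF dderiv_linear[OF assms]])
  finally show "dderiv v f x = (\<Sum>b\<in>Basis. of_real (v \<bullet> b) * dderiv b f x)"
    by (simp add: scaleR_conv_of_real)
qed

section \<open>Iterated derivatives and Cauchy estimates\<close>

primrec dderivs :: "'v::euclidean_space list \<Rightarrow> ('v \<Rightarrow> complex) \<Rightarrow> 'v \<Rightarrow> complex" where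
  "dderivs [] f = f"
| "dderivs (v # vs) f = dderivs vs (dderiv v f)"

lemma dderivs_add:
  "f \<in> C_inf UNIV \<Longrightarrow> g \<in> C_inf UNIV \<Longrightarrow> dderivs vs (\<lambda>x. f x + g x) = (\<lambda>x. dderivs vs f x + dderivs vs g x)"
  by (induction vs arbitrary: f g) (auto simp: dderiv_add C_inf_dderiv)

lemma dderivs_cmult: "f \<in> C_inf UNIV \<Longrightarrow> dderivs vs (\<lambda>x. c * f x) = (\<lambda>x. c * dderivs vs f x)"
  by (induction vs arbitrary: f) (auto simp: dderiv_cmult C_inf_dderiv)

lemma C_inf_zero: "(\<lambda>_. 0) \<in> C_inf UNIV"
  by (rule C_inf_coinduct[where P = "\<lambda>h. h = (\<lambda>_. 0)"]) (auto simp: dderiv_has_derivative[OF has_derivative_const])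

lemma dderivs_zero: "dderivs vs (\<lambda>_. 0) = (\<lambda>_. 0)"
proof -
  have "dderiv v (\<lambda>_. 0) = (\<lambda>_. 0)" for v :: 'a
    by (auto simp: dderiv_has_derivative[OF has_derivative_const])
  then show ?thesis by (induction vs) auto
qed

lemma C_inf_sum:
  assumes "finite A" "\<And>a. a \<in> A \<Longrightarrow> f a \<in> C_inf UNIV"
  shows "(\<lambda>x. \<Sum>a\<in>A. f a x) \<in> C_inf UNIV"
  using assms by (induction A rule: finite_induct) (auto simp: C_inf_zero intro!: C_inf_add)

lemma dderivs_sum:
  assumes "finite A" "\<And>a. a \<in> A \<Longrightarrow> f a \<in> C_inf UNIV"
  shows "dderivs vs (\<lambda>x. \<Sum>a\<in>A. f a x) = (\<lambda>x. \<Sum>a\<in>A. dderivs vs (f a) x)"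
  using assms by (induction A rule: finite_induct) (auto simp: dderivs_zero dderivs_add C_inf_sum)

lemma dderivs_replicate: "dderivs (replicate n v) f = (dderiv v ^^ n) f"
  by (induction n arbitrary: f) (auto simp: funpow_Suc_right simp del: funpow.simps(2))

text \<open>Noncommutative expansion of the \<open>n\<close>-th power of the sum of
  \<open>(h \<bullet> b) \<partial>_b\<close> over the basis: every word stays a term of its
  own.\<close>

lemma dderiv_funpow_eq_psum:
  assumes "f \<in> C_inf UNIV"
  shows "(dderiv h ^^ n) f x = psum n (\<lambda>l. dderivs l f x) h"
  using assms
proof (induction n arbitrary: f)
  case (Suc n)
  have "(dderiv h ^^ Suc n) f x = psum n (\<lambda>l. dderivs l (dderiv h f) x) h"
    using Suc.IH[OF C_inf_dderiv[OF Suc.prems]] by (simp add: funpow_Suc_right del: funpow.simps)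
  also have "\<dots> = psum n (\<lambda>l. \<Sum>b\<in>Basis. of_real (h \<bullet> b) * dderivs l (dderiv b f) x) h"
    by (subst dderiv_Basis[OF Suc.prems])
       (simp add: dderivs_sum dderivs_cmult C_inf_cmult C_inf_dderiv Suc.prems)
  also have "\<dots> = psum (Suc n) (\<lambda>l. dderivs l f x) h"
    by (simp add: psum_sum psum_cmult)
  finally show ?case .
qed auto

text \<open>The directions are arbitrary vectors weighted by their norms, so that a linear isometry
  merely replaces them by others of the same weight.\<close>

definition cauchy_bound :: "('v::euclidean_space \<Rightarrow> complex) \<Rightarrow> 'v \<Rightarrow> real \<Rightarrow> real \<Rightarrow> bool" where
  "cauchy_bound f y C M \<longleftrightarrow>
     (\<forall>vs. norm (dderivs vs f y) \<le> C * M ^ length vs * fact (length vs) * prod_list (map norm vs))"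

text \<open>This turns out to be the same as \<^const>\<open>C_omega\<close>; unlike power series, Cauchy estimates are easily
  transported through $Q_{k,a}$, isometries and derivatives.\<close>

definition tame :: "('v::euclidean_space \<Rightarrow> complex) \<Rightarrow> bool" where
  "tame f \<longleftrightarrow> f \<in> C_inf UNIV \<and> (\<forall>x. \<exists>r>0. \<exists>C\<ge>0. \<exists>M\<ge>1. \<forall>y\<in>ball x r. cauchy_bound f y C M)"

text \<open>A local expansion together with its constants. \<open>k\<close> records the number of
  derivatives already taken; the radius \<open>s\<close> and the rate \<open>N\<close> are common to
  all of them.\<close>

definition psum_at ::
  "('v::euclidean_space \<Rightarrow> complex) \<Rightarrow> 'v \<Rightarrow> real \<Rightarrow> real \<Rightarrow> real \<Rightarrow> nat \<Rightarrow> ('v list \<Rightarrow> complex) \<Rightarrow> bool" where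
  "psum_at f x s K N k d \<longleftrightarrow> s > 0 \<and> K \<ge> 0 \<and> N > 0 \<and> s \<le> 1 / (4 * N * DIM('v)) \<and> majorized K N k d \<and>
     (\<forall>h. norm h < s \<longrightarrow> f (x + h) = (\<Sum>n. psum n d h))"

lemma psum_at_dderiv:
  fixes x :: "'v::euclidean_space"
  assumes p: "psum_at f x s K N k d"
  shows "\<And>h. norm h < s \<Longrightarrow> f differentiable (at (x + h))"
    and "psum_at (dderiv v f) x s (K * (DIM('v) * norm v)) N (Suc k)
           (\<lambda>l. \<Sum>b\<in>Basis. of_real (v \<bullet> b) * deriv_coeff b l d)"
proof -
  have *: "(f has_derivative (\<lambda>v. \<Sum>n. psum n (\<lambda>l. \<Sum>b\<in>Basis. of_real (v \<bullet> b) * deriv_coeff b l d) h)) (at (x + h))"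
    if h: "norm h < s" for h
  proof (rule has_derivative_transform_within_open[where s = "ball x s"])
    have "((\<lambda>h. \<Sum>n. psum n d h) has_derivative
           (\<lambda>v. \<Sum>n. psum n (\<lambda>l. \<Sum>b\<in>Basis. of_real (v \<bullet> b) * deriv_coeff b l d) h)) (at h)"
      using p h by (intro psum_series_has_derivative) (auto simp: psum_at_def)
    then show "((\<lambda>y. \<Sum>n. psum n d (y - x)) has_derivative
           (\<lambda>v. \<Sum>n. psum n (\<lambda>l. \<Sum>b\<in>Basis. of_real (v \<bullet> b) * deriv_coeff b l d) h)) (at (x + h))"
      by (intro has_derivative_compose[where g = "\<lambda>h. \<Sum>n. psum n d h" and f = "\<lambda>y. y - x"
              and f' = "\<lambda>v. v" , simplified])
         (auto intro!: derivative_eq_intros)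
    show "x + h \<in> ball x s" using h by (simp add: dist_norm)
    show "(\<Sum>n. psum n d (y - x)) = f y" if "y \<in> ball x s" for y
    proof -
      have "norm (y - x) < s" using that by (simp add: dist_norm norm_minus_commute)
      then have "f (x + (y - x)) = (\<Sum>n. psum n d (y - x))" using p unfolding psum_at_def by blast
      then show ?thesis by simp
    qed
  qed auto
  show "f differentiable (at (x + h))" if "norm h < s" for h
    using *[OF that] by (auto simp: differentiable_def)
  have "majorized (K * (DIM('v) * norm v)) N (Suc k) (\<lambda>l. \<Sum>b\<in>Basis. of_real (v \<bullet> b) * deriv_coeff b l d)"
    using p by (intro majorized_sum majorized_deriv_coeff) (auto simp: psum_at_def)
  then show "psum_at (dderiv v f) x s (K * (DIM('v) * norm v)) N (Suc k)
           (\<lambda>l. \<Sum>b\<in>Basis. of_real (v \<bullet> b) * deriv_coeff b l d)"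
    using p dderiv_has_derivative[OF *] unfolding psum_at_def by simp
qed

lemma psum_at_imp_C_inf:
  assumes "\<And>x. \<exists>s K N k d. psum_at f x s K N k d"
  shows "f \<in> C_inf UNIV"
proof (rule C_inf_coinduct[where P = "\<lambda>f. \<forall>x. \<exists>s K N k d. psum_at f x s K N k d"])
  fix g :: "'a \<Rightarrow> complex" assume g: "\<forall>x. \<exists>s K N k d. psum_at g x s K N k d"
  have "g differentiable at x" for x
  proof -
    obtain s K N k d where p: "psum_at g x s K N k d" using g by blast
    then have "s > 0" by (auto simp: psum_at_def)
    then show ?thesis using psum_at_dderiv(1)[OF p, of 0] by simp
  qed
  moreover have "\<forall>x. \<exists>s K N k d. psum_at (dderiv v g) x s K N k d" for v
    using g psum_at_dderiv(2) by meson
  ultimately show "(\<forall>x. g differentiable at x) \<and> (\<forall>v x. \<exists>s K N k d. psum_at (dderiv v g) x s K N k d)"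
    by blast
qed (use assms in auto)

text \<open>Each derivative multiplies \<open>K\<close> by \<open>DIM('v) * norm v\<close> and
  raises \<open>k\<close> by one. After the last one the bound on the sum of the series applies at
  every point within the radius \<open>s\<close>.\<close>

lemma psum_at_imp_bound:
  fixes x :: "'v::euclidean_space"
  assumes "psum_at f x s K N k d" "norm h < s"
  shows "norm (dderivs vs f (x + h)) \<le> 2 * K * (2 * N) ^ (k + length vs) * fact (k + length vs) *
     DIM('v) ^ length vs * prod_list (map norm vs)"
  using assms
proof (induction vs arbitrary: f K k d)
  case Nil
  then show ?case using psum_summable(2)[of K N k d h] unfolding psum_at_def by simp
next
  case (Cons v vs)
  show ?case using Cons.IH[OF psum_at_dderiv(2)[OF Cons.prems(1)] Cons.prems(2), of v]
    by (simp add: mult_ac)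
qed

lemma psum_at_imp_tame:
  fixes f :: "'v::euclidean_space \<Rightarrow> complex"
  assumes p: "\<And>x. \<exists>s K N d. psum_at f x s K N 0 d"
  shows "tame f"
  unfolding tame_def
proof (intro conjI allI)
  show "f \<in> C_inf UNIV" using psum_at_imp_C_inf p by blast
  fix x :: 'v
  obtain s K N d where p: "psum_at f x s K N 0 d" using p by blast
  then have pos: "s > 0" "K \<ge> 0" "N > 0" by (auto simp: psum_at_def)
  \<comment> \<open>In \<open>psum_at_imp_bound\<close> with \<open>k = 0\<close> every derivative
    costs \<open>2 * N\<close>, and expanding its direction in the basis costs
    \<open>DIM('v)\<close>. The maximum secures \<open>M \<ge> 1\<close>.\<close>
  define M where "M = max 1 (2 * N * DIM('v))"
  have "cauchy_bound f y (2 * K) M" if y: "y \<in> ball x s" for y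
    unfolding cauchy_bound_def
  proof
    fix vs :: "'v list"
    have nn: "prod_list (map norm vs) \<ge> 0" by (induction vs) auto
    have "norm (dderivs vs f (x + (y - x))) \<le> 2 * K * (2 * N) ^ (0 + length vs) * fact (0 + length vs) *
     DIM('v) ^ length vs * prod_list (map norm vs)"
      by (rule psum_at_imp_bound[OF p]) (use y in \<open>auto simp: dist_norm norm_minus_commute\<close>)
    also have "\<dots> = 2 * K * (2 * N * DIM('v)) ^ length vs * fact (length vs) * prod_list (map norm vs)"
      by (simp add: power_mult_distrib)
    also have "\<dots> \<le> 2 * K * M ^ length vs * fact (length vs) * prod_list (map norm vs)"
      using pos nn by (intro mult_right_mono mult_left_mono power_mono) (auto simp: M_def)
    finally show "norm (dderivs vs f y) \<le> 2 * K * M ^ length vs * fact (length vs) * prod_list (map norm vs)"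
      by simp
  qed
  then show "\<exists>r>0. \<exists>C\<ge>0. \<exists>M\<ge>1. \<forall>y\<in>ball x r. cauchy_bound f y C M"
    using pos by (intro exI[of _ s] conjI exI[of _ "2 * K"] exI[of _ M]) (auto simp: M_def)
qed

section \<open>From Cauchy estimates to multivariate power series and back\<close>

definition blists :: "nat \<Rightarrow> 'v::euclidean_space list set" where
  "blists n = {l. set l \<subseteq> Basis \<and> length l = n}"

lemma finite_blists [simp]: "finite (blists n)"
  unfolding blists_def by (rule finite_lists_length_eq) simp

lemma blists_0 [simp]: "blists 0 = {[]}"
  by (auto simp: blists_def)

lemma blists_Suc: "blists (Suc n) = (\<lambda>(b, l). b # l) ` (Basis \<times> blists n)"
  by (auto simp: blists_def image_iff length_Suc_conv)

lemma sum_blists_Suc: "(\<Sum>l\<in>blists (Suc n). F l) = (\<Sum>b\<in>Basis. \<Sum>l\<in>blists n. F (b # l))"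
  unfolding blists_Suc
  by (subst sum.reindex) (auto simp: inj_on_def sum.cartesian_product case_prod_beta)

lemma card_blists: "card (blists n :: 'v::euclidean_space list set) = DIM('v) ^ n"
  unfolding blists_def by (rule card_lists_length_eq) simp

definition monomial :: "'v::euclidean_space list \<Rightarrow> 'v \<Rightarrow> real" where
  "monomial l h = prod_list (map (\<lambda>b. h \<bullet> b) l)"

lemma psum_eq_sum: "psum n d h = (\<Sum>l\<in>blists n. d l * of_real (monomial l h))"
  by (induction n arbitrary: d)
     (auto simp: monomial_def sum_blists_Suc sum_distrib_left mult_ac)

lemma monomial_count:
  assumes "set l \<subseteq> Basis"
  shows "monomial l h = (\<Prod>b\<in>Basis. (h \<bullet> b) ^ count_list l b)"
  using assms
proof (induction l)
  case (Cons a l)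
  have "(\<Prod>b\<in>Basis. (h \<bullet> b) ^ count_list (a # l) b)
      = (\<Prod>b\<in>Basis. (if a = b then h \<bullet> b else 1) * (h \<bullet> b) ^ count_list l b)"
    by (rule prod.cong) auto
  also have "\<dots> = (h \<bullet> a) * (\<Prod>b\<in>Basis. (h \<bullet> b) ^ count_list l b)"
    using Cons.prems by (simp add: prod.distrib)
  finally show ?case using Cons by (simp add: monomial_def)
qed (simp add: monomial_def)

lemma abs_monomial_le:
  assumes "set l \<subseteq> Basis"
  shows "\<bar>monomial l h\<bar> \<le> norm h ^ length l"
  using assms
proof (induction l)
  case (Cons a l)
  have "\<bar>h \<bullet> a\<bar> \<le> norm h" using Cons.prems by (auto intro: Basis_le_norm)
  with Cons show ?case by (auto simp: monomial_def abs_mult intro!: mult_mono)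
qed (simp add: monomial_def)

lemma prod_power_count:
  assumes "set l \<subseteq> Basis"
  shows "(\<Prod>b\<in>(Basis::'v::euclidean_space set). x ^ count_list l b) = (x::real) ^ length l"
  by (subst power_sum[symmetric], subst sum_count_set[OF assms]) auto

definition multi_indices :: "('v::euclidean_space \<Rightarrow> nat) set" where
  "multi_indices = {m. \<forall>b. b \<notin> Basis \<longrightarrow> m b = 0}"

lemma count_list_replicate: "count_list (replicate n a) b = (if a = b then n else 0)"
  by (induction n) auto

text \<open>Writing each letter in a block of the prescribed multiplicity gives such a word. With
  \<open>A = Basis\<close> this selects one word for every multi-index.\<close>

lemma ex_list_count:
  assumes "finite A" "\<And>b. b \<notin> A \<Longrightarrow> m b = (0::nat)"
  shows "\<exists>l. set l \<subseteq> A \<and> count_list l = m"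
  using assms
proof (induction A arbitrary: m rule: finite_induct)
  case empty
  then show ?case by (intro exI[of _ "[]"]) auto
next
  case (insert a A)
  obtain l where l: "set l \<subseteq> A" "count_list l = m(a := 0)"
    using insert.IH[of "m(a := 0)"] insert.prems by (metis fun_upd_apply insert_iff)
  have "count_list (replicate (m a) a @ l) b = m b" for b
    using fun_cong[OF l(2), of b] by (auto simp: count_list_replicate)
  then show ?case
    using l(1) by (intro exI[of _ "replicate (m a) a @ l"]) auto
qed

lemma has_sum_blists:
  fixes F :: "'v::euclidean_space list \<Rightarrow> complex"
  shows "(F has_sum S) {l. set l \<subseteq> Basis} \<longleftrightarrow> ((\<lambda>(n, l). F l) has_sum S) (SIGMA n:UNIV. blists n)"
proof -
  have "bij_betw snd (SIGMA n:UNIV. blists n) {l. set l \<subseteq> (Basis :: 'v set)}"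
    by (rule bij_betwI[where g = "\<lambda>l. (length l, l)"]) (auto simp: blists_def)
  from has_sum_reindex_bij_betw[OF this, of F S] show ?thesis unfolding case_prod_beta by (rule sym)
qed

text \<open>The whole coefficient of a multi-index \<open>m\<close> is put on one chosen word
  \<open>L m\<close>, all other words get \<open>0\<close>. The growth of the coefficients is read
  off at a single point of the ball, where the series converges absolutely.\<close>

lemma C_omega_imp_psum_at:
  fixes f :: "'v::euclidean_space \<Rightarrow> complex"
  assumes "f \<in> C_omega"
  shows "\<exists>s K N d. psum_at f x s K N 0 d"
proof -
  obtain r c where r: "r > 0" and c: "\<And>y. y \<in> ball x r \<Longrightarrow>
     ((\<lambda>m. c m * of_real (\<Prod>b\<in>Basis. ((y - x) \<bullet> b) ^ m b)) has_sum f y) multi_indices"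
    using assms unfolding C_omega_def multi_indices_def by blast
  \<comment> \<open>All coordinates of \<open>h0\<close> will be \<open>\<rho>\<close>: then
    \<open>norm h0 \<le> DIM('v) * \<rho> = r / 2\<close> keeps it in the ball, and every monomial
    of degree \<open>n\<close> takes the value \<open>\<rho> ^ n\<close> there.\<close>
  define \<rho> where "\<rho> = r / (2 * DIM('v))"
  have \<rho>: "\<rho> > 0" using r by (simp add: \<rho>_def)
  define h0 :: 'v where "h0 = (\<Sum>b\<in>Basis. \<rho> *\<^sub>R b)"
  have "norm h0 \<le> (\<Sum>b\<in>(Basis::'v set). \<rho>)"
    unfolding h0_def by (rule sum_norm_le) (use \<rho> in auto)
  also have "\<dots> < r" using r by (simp add: \<rho>_def)
  finally have h0: "x + h0 \<in> ball x r" by (simp add: dist_norm)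
  have h0b: "h0 \<bullet> b = \<rho>" if "b \<in> Basis" for b
    using that by (simp add: h0_def inner_sum_left inner_Basis if_distrib sum.delta' cong: if_cong)
  let ?F = "\<lambda>m. c m * of_real (\<Prod>b\<in>(Basis::'v set). \<rho> ^ m b)"
  have "(?F has_sum f (x + h0)) multi_indices"
    using c[OF h0] h0b by (simp cong: prod.cong)
  then have "?F summable_on multi_indices" by (rule has_sum_imp_summable)
  \<comment> \<open>Complex summability is absolute, so a single term is at most the sum of all
    norms. This is the coefficient estimate with \<open>N = 1 / \<rho>\<close>.\<close>
  then have as: "(\<lambda>m. norm (?F m)) summable_on multi_indices"
    by (simp only: summable_on_iff_abs_summable_on_complex)
  define K where "K = infsum (\<lambda>m. norm (?F m)) multi_indices"
  have K: "norm (?F m) \<le> K" if "m \<in> multi_indices" for m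
    using finite_sum_le_infsum[OF as, of "{m}"] that by (simp add: K_def)
  have K0: "K \<ge> 0" unfolding K_def by (rule infsum_nonneg) simp
  define N where "N = 1 / \<rho>"
  have N: "N > 0" using \<rho> by (simp add: N_def)
  have "\<exists>l. set l \<subseteq> Basis \<and> count_list l = m" if "m \<in> multi_indices" for m :: "'v \<Rightarrow> nat"
    by (rule ex_list_count) (use that in \<open>auto simp: multi_indices_def\<close>)
  then obtain L :: "('v \<Rightarrow> nat) \<Rightarrow> 'v list" where
    L: "\<And>m. m \<in> multi_indices \<Longrightarrow> set (L m) \<subseteq> Basis \<and> count_list (L m) = m" by metis
  have cm: "count_list l \<in> multi_indices" if "set l \<subseteq> Basis" for l :: "'v list"
    using that by (auto simp: multi_indices_def count_list_0_iff)
  define d where "d l = (if set l \<subseteq> Basis \<and> l = L (count_list l) then c (count_list l) else 0)" for l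
  have dK: "norm (d l) \<le> K * N ^ length l" for l
  proof (cases "set l \<subseteq> Basis \<and> l = L (count_list l)")
    case True
    then have "norm (?F (count_list l)) \<le> K" using K cm by blast
    then have "norm (d l) * \<rho> ^ length l \<le> K"
      using True \<rho> by (simp add: d_def norm_mult prod_power_count norm_power)
    then show ?thesis using \<rho> by (simp add: N_def power_divide field_simps)
  qed (use K0 N in \<open>auto simp: d_def\<close>)
  have hs: "(\<lambda>n. psum n d h) sums f (x + h)" if h: "norm h < r" for h
  proof -
    have "((\<lambda>m. c m * of_real (\<Prod>b\<in>Basis. (h \<bullet> b) ^ m b)) has_sum f (x + h)) multi_indices"
      using c[of "x + h"] h by (simp add: dist_norm)
    also have "?this \<longleftrightarrow> ((\<lambda>l. d l * of_real (monomial l h)) \<circ> L has_sum f (x + h)) multi_indices"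
    proof (rule has_sum_cong)
      fix m :: "'v \<Rightarrow> nat" assume m: "m \<in> multi_indices"
      show "c m * of_real (\<Prod>b\<in>Basis. (h \<bullet> b) ^ m b) = ((\<lambda>l. d l * of_real (monomial l h)) \<circ> L) m"
        using L[OF m] by (simp add: d_def monomial_count)
    qed
    also have "\<dots> \<longleftrightarrow> ((\<lambda>l. d l * of_real (monomial l h)) has_sum f (x + h)) (L ` multi_indices)"
      by (rule has_sum_reindex[symmetric]) (metis L inj_onI)
    also have "\<dots> \<longleftrightarrow> ((\<lambda>l. d l * of_real (monomial l h)) has_sum f (x + h)) {l. set l \<subseteq> Basis}"
    proof (rule has_sum_cong_neutral)
      fix l :: "'v list" assume "l \<in> {l. set l \<subseteq> Basis} - L ` multi_indices"
      then have "l \<noteq> L (count_list l)" using cm by blast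
      then show "d l * of_real (monomial l h) = 0" by (simp add: d_def)
    qed (use L in auto)
    also have "\<dots> \<longleftrightarrow> ((\<lambda>(n, l). d l * of_real (monomial l h)) has_sum f (x + h)) (SIGMA n:UNIV. blists n)"
      by (rule has_sum_blists)
    finally have "((\<lambda>n. psum n d h) has_sum f (x + h)) UNIV"
      by (rule has_sum_SigmaD) (simp add: psum_eq_sum has_sum_finite)
    then show ?thesis by (rule has_sum_imp_sums)
  qed
  have "psum_at f x (min r (1 / (4 * N * DIM('v)))) K N 0 d"
    using r N K0 dK hs unfolding psum_at_def majorized_def by (auto simp: sums_iff)
  then show ?thesis by blast
qed

lemma C_omega_imp_tame: "f \<in> C_omega \<Longrightarrow> tame f"
  by (rule psum_at_imp_tame) (rule C_omega_imp_psum_at)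

lemma has_vector_derivative_line:
  assumes "f \<in> C_inf UNIV"
  shows "((\<lambda>t. f (x + t *\<^sub>R h)) has_vector_derivative dderiv h f (x + t *\<^sub>R h)) (at t within S)"
proof -
  have "((\<lambda>t. f (x + t *\<^sub>R h)) has_derivative (\<lambda>s. dderiv (s *\<^sub>R h) f (x + t *\<^sub>R h))) (at t within S)"
    by (rule has_derivative_compose[where f = "\<lambda>t. x + t *\<^sub>R h"])
       (auto intro!: derivative_eq_intros has_derivative_dderiv C_inf_differentiable assms)
  then show ?thesis
    by (simp add: has_vector_derivative_def linear_cmul[OF dderiv_linear[OF assms]])
qed

text \<open>Taylor's formula on the segment from \<open>x\<close> to \<open>x + h\<close> with
  integral remainder: the remainder of order \<open>p\<close> is at most
  \<open>C * p * q ^ p\<close> with \<open>q = M * norm h < 1\<close>, the factor \<open>p\<close>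
  being \<open>fact p / fact (p - 1)\<close>.\<close>

lemma taylor_sums:
  fixes h :: "'v::euclidean_space"
  assumes f: "f \<in> C_inf UNIV" and b: "\<And>y. y \<in> ball x r \<Longrightarrow> cauchy_bound f y C M"
    and C: "C \<ge> 0" and M: "M \<ge> 0" and h: "norm h < r" "M * norm h < 1"
  shows "(\<lambda>n. (dderiv h ^^ n) f x / fact n) sums f (x + h)"
proof -
  define q where "q = M * norm h"
  have q: "0 \<le> q" "q < 1" using M h by (auto simp: q_def)
  have bd: "norm ((dderiv h ^^ n) f (x + t *\<^sub>R h)) \<le> C * q ^ n * fact n" if t: "t \<in> {0..1}" for n t
  proof -
    have "norm (t *\<^sub>R h) \<le> norm h" using t by (simp add: mult_left_le_one_le)
    then have "x + t *\<^sub>R h \<in> ball x r" using h by (simp add: dist_norm)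
    from b[OF this] have "norm (dderivs (replicate n h) f (x + t *\<^sub>R h)) \<le> C * M ^ n * fact n * norm h ^ n"
      unfolding cauchy_bound_def by (metis length_replicate map_replicate prod_list_replicate)
    then show ?thesis by (simp add: dderivs_replicate q_def power_mult_distrib mult_ac)
  qed
  have est: "norm (f (x + h) - (\<Sum>n<p. (dderiv h ^^ n) f x / fact n)) \<le> C * (real p * q ^ p)"
    if p: "p > 0" for p
  proof -
    define Df where "Df n t = (dderiv h ^^ n) f (x + t *\<^sub>R h)" for n t
    define i where "i t = ((1 - t) ^ (p - 1) / fact (p - 1)) *\<^sub>R Df p t" for t :: real
    have "(i has_integral Df 0 1 - (\<Sum>n<p. ((1 - 0) ^ n / fact n) *\<^sub>R Df n 0)) {0..1}"
      unfolding i_def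
    proof (rule Taylor_has_integral[OF p refl])
      show "(Df m has_vector_derivative Df (Suc m) t) (at t within {0..1})" for m t
        using has_vector_derivative_line[OF C_inf_funpow_dderiv[OF f]] unfolding Df_def[abs_def]
        by simp
    qed auto
    then have int: "(i has_integral f (x + h) - (\<Sum>n<p. (dderiv h ^^ n) f x / fact n)) (cbox 0 1)"
      by (simp add: Df_def scaleR_conv_of_real field_simps)
    have "norm (i t) \<le> C * (real p * q ^ p)" if "t \<in> cbox 0 1" for t
    proof -
      have t: "t \<in> {0..1}" using that by simp
      have "norm (i t) = ((1 - t) ^ (p - 1) / fact (p - 1)) * norm (Df p t)"
        using t by (simp add: i_def)
      also have "\<dots> \<le> (1 / fact (p - 1)) * (C * q ^ p * fact p)"
        using bd[OF t, of p] t C q unfolding Df_def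
        by (intro mult_mono divide_right_mono power_le_one) auto
      also have "\<dots> = C * (real p * q ^ p)"
        using p by (simp add: fact_reduce)
      finally show ?thesis .
    qed
    from has_integral_bound[OF _ int this] C q show ?thesis by simp
  qed
  have "(\<lambda>p. C * (real p * q ^ p)) \<longlonglongrightarrow> C * 0"
    using q by (intro tendsto_mult_left) (use powser_times_n_limit_0[of q] in auto)
  then have "(\<lambda>p. f (x + h) - (\<Sum>n<p. (dderiv h ^^ n) f x / fact n)) \<longlonglongrightarrow> 0"
    by (intro Lim_null_comparison[OF eventually_mono[OF eventually_gt_at_top[of 0] est]]) auto
  from tendsto_diff[OF tendsto_const[of "f (x + h)"] this] show ?thesis
    by (simp add: sums_def)
qed

text \<open>The Taylor series is absolutely summable over all words and may be regrouped: by length,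
  which identifies its value through \<open>taylor_sums\<close>, and by multi-index, which gives the
  required form.\<close>

lemma tame_imp_C_omega:
  fixes f :: "'v::euclidean_space \<Rightarrow> complex"
  assumes "tame f"
  shows "f \<in> C_omega"
  unfolding C_omega_def
proof (intro CollectI allI)
  fix x :: 'v
  have f: "f \<in> C_inf UNIV" using assms by (simp add: tame_def)
  obtain r C M where r: "r > 0" and C: "C \<ge> 0" and M: "M \<ge> 1"
    and b: "\<And>y. y \<in> ball x r \<Longrightarrow> cauchy_bound f y C M"
    using assms unfolding tame_def by blast
  \<comment> \<open>There are \<open>DIM('v) ^ n\<close> words of length \<open>n\<close>, each
    contributing at most \<open>C * (M * norm h) ^ n\<close>; with this radius the sums over words
    of fixed length decay like \<open>(1/2) ^ n\<close>.\<close>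
  define s where "s = min r (1 / (2 * M * DIM('v)))"
  have s: "s > 0" using r M by (simp add: s_def)
  define d where "d l = dderivs l f x / fact (length l)" for l
  define c where "c m = (\<Sum>l | set l \<subseteq> Basis \<and> count_list l = m. d l)" for m :: "'v \<Rightarrow> nat"
  have "((\<lambda>m. c m * of_real (\<Prod>b\<in>Basis. ((y - x) \<bullet> b) ^ m b)) has_sum f y) multi_indices"
    if y: "y \<in> ball x s" for y
  proof -
    define h where "h = y - x"
    have h: "norm h < s" using y by (simp add: h_def dist_norm norm_minus_commute)
    have "M * norm h \<le> M * (1 / (2 * M * DIM('v)))"
      using h M by (intro mult_left_mono) (auto simp: s_def)
    then have q: "DIM('v) * (M * norm h) \<le> 1 / 2" using M by (simp add: field_simps)
    have "1 * (M * norm h) \<le> DIM('v) * (M * norm h)"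
      using M by (intro mult_right_mono) (auto simp: DIM_positive Suc_leI)
    with q have q1: "M * norm h < 1" by simp
    have "(\<lambda>n. (dderiv h ^^ n) f x / fact n) sums f (x + h)"
      by (rule taylor_sums[OF f b C]) (use M h q1 in \<open>auto simp: s_def\<close>)
    moreover have "(dderiv h ^^ n) f x / fact n = (\<Sum>l\<in>blists n. d l * of_real (monomial l h))" for n
      unfolding dderiv_funpow_eq_psum[OF f] psum_eq_sum sum_divide_distrib
      by (rule sum.cong) (auto simp: d_def blists_def)
    ultimately have sums: "(\<lambda>n. \<Sum>l\<in>blists n. d l * of_real (monomial l h)) sums f (x + h)" by simp
    have bl: "norm (d l * of_real (monomial l h)) \<le> C * (M * norm h) ^ n" if l: "l \<in> blists n" for l n
    proof -
      have ll: "set l \<subseteq> Basis" "length l = n" using l by (auto simp: blists_def)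
      have "prod_list (map norm l) = 1" using ll(1) by (induction l) auto
      moreover have "cauchy_bound f x C M" using b r by simp
      ultimately have "norm (dderivs l f x) \<le> C * M ^ n * fact n"
        using ll(2) unfolding cauchy_bound_def by (metis mult.right_neutral)
      then have "norm (d l) \<le> C * M ^ n" by (simp add: d_def norm_divide ll(2) divide_le_eq)
      then have "norm (d l * of_real (monomial l h)) \<le> (C * M ^ n) * norm h ^ n"
        using abs_monomial_le[OF ll(1), of h] ll(2) using C M unfolding norm_mult norm_of_real
        by (intro mult_mono) auto
      then show ?thesis by (simp add: power_mult_distrib mult_ac)
    qed
    have "(\<lambda>z. norm (case z of (n, l) \<Rightarrow> d l * of_real (monomial l h))) summable_on (SIGMA n:UNIV. blists n)"
      unfolding Infinite_Sum.abs_summable_on_Sigma_iff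
    proof (intro conjI ballI)
      have "norm (\<Sum>l\<in>blists n. norm (d l * of_real (monomial l h))) \<le> C * (1/2) ^ n" for n
      proof -
        have "(\<Sum>l\<in>blists n. norm (d l * of_real (monomial l h))) \<le> real (card (blists n :: 'v list set)) * (C * (M * norm h) ^ n)"
          by (rule sum_bounded_above) (rule bl)
        also have "\<dots> = C * (DIM('v) * (M * norm h)) ^ n"
          by (simp add: card_blists power_mult_distrib)
        also have "\<dots> \<le> C * (1/2) ^ n"
          using q C M by (intro mult_left_mono power_mono) auto
        finally show ?thesis by (simp add: sum_nonneg)
      qed
      then have "summable (\<lambda>n. norm (\<Sum>l\<in>blists n. norm (d l * of_real (monomial l h))))"
        by (intro summable_comparison_test[OF _ summable_mult[OF summable_geometric[of "1/2 :: real"]]]) auto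
      then show "(\<lambda>n. norm (infsum (\<lambda>l. norm (case (n, l) of (n, l) \<Rightarrow> d l * of_real (monomial l h))) (blists n))) summable_on UNIV"
        by (subst summable_on_UNIV_nonneg_real_iff) auto
    qed auto
    then have "(\<lambda>(n, l). d l * of_real (monomial l h)) summable_on (SIGMA n:UNIV. blists n)"
      by (rule Infinite_Sum.abs_summable_summable)
    then obtain S where S: "((\<lambda>(n, l). d l * of_real (monomial l h)) has_sum S) (SIGMA n:UNIV. blists n)"
      by (auto simp: summable_on_def)
    then have "((\<lambda>n. \<Sum>l\<in>blists n. d l * of_real (monomial l h)) has_sum S) UNIV"
      by (rule has_sum_SigmaD) (simp add: has_sum_finite)
    then have "S = f y" using has_sum_imp_sums sums_unique2[OF _ sums] by (auto simp: h_def)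
    with S have S: "((\<lambda>l. d l * of_real (monomial l h)) has_sum f y) {l. set l \<subseteq> Basis}"
      by (simp add: has_sum_blists)
    let ?L = "\<lambda>m::'v\<Rightarrow>nat. {l. set l \<subseteq> Basis \<and> count_list l = m}"
    have bij: "bij_betw snd (SIGMA m:multi_indices. ?L m) {l. set l \<subseteq> (Basis :: 'v set)}"
      by (rule bij_betwI[where g = "\<lambda>l. (count_list l, l)"]) (auto simp: multi_indices_def count_list_0_iff)
    have "((\<lambda>z. d (snd z) * of_real (monomial (snd z) h)) has_sum f y) (SIGMA m:multi_indices. ?L m)"
      using has_sum_reindex_bij_betw[OF bij, of "\<lambda>l. d l * of_real (monomial l h)"] S by simp
    then show ?thesis
    proof (rule has_sum_SigmaD)
      fix m :: "'v \<Rightarrow> nat" assume m: "m \<in> multi_indices"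
      \<comment> \<open>A word with letter counts \<open>m\<close> has the total of \<open>m\<close>
        as its length, so the fibres of the regrouping are finite.\<close>
      have "?L m \<subseteq> blists (\<Sum>b\<in>Basis. m b)"
        by (auto simp: blists_def sum_count_set)
      then have "finite (?L m)" using finite_subset finite_blists by blast
      moreover have "(\<Sum>l\<in>?L m. d (snd (m, l)) * of_real (monomial (snd (m, l)) h))
          = c m * of_real (\<Prod>b\<in>Basis. ((y - x) \<bullet> b) ^ m b)"
        unfolding c_def sum_distrib_right by (rule sum.cong) (auto simp: monomial_count h_def)
      ultimately show "((\<lambda>l. d (snd (m, l)) * of_real (monomial (snd (m, l)) h)) has_sum
          c m * of_real (\<Prod>b\<in>Basis. ((y - x) \<bullet> b) ^ m b)) (?L m)"
        by (intro has_sum_finiteI) auto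
    qed
  qed
  then show "\<exists>r>0. \<exists>c :: ('v \<Rightarrow> nat) \<Rightarrow> complex. \<forall>y\<in>ball x r.
     ((\<lambda>m. c m * of_real (\<Prod>b\<in>Basis. ((y - x) \<bullet> b) ^ m b)) has_sum f y)
       {m. \<forall>b. b \<notin> Basis \<longrightarrow> m b = 0}"
    using s unfolding multi_indices_def by blast
qed

lemma C_omega_eq_tame: "C_omega = {f. tame f}"
  using C_omega_imp_tame tame_imp_C_omega by blast

section \<open>Closure properties of Cauchy estimates\<close>

lemma prod_list_norm_nonneg [simp]: "0 \<le> prod_list (map norm vs)"
  by (induction vs) auto

lemma cauchy_bound_mono:
  assumes "cauchy_bound f y C M" "C \<le> C'" "M \<le> M'" "0 \<le> C" "0 \<le> M"
  shows "cauchy_bound f y C' M'"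
  unfolding cauchy_bound_def
proof
  fix vs
  have "norm (dderivs vs f y) \<le> C * M ^ length vs * fact (length vs) * prod_list (map norm vs)"
    using assms(1) by (auto simp: cauchy_bound_def)
  also have "\<dots> \<le> C' * M' ^ length vs * fact (length vs) * prod_list (map norm vs)"
    using assms by (intro mult_right_mono mult_mono power_mono) auto
  finally show "norm (dderivs vs f y) \<le> C' * M' ^ length vs * fact (length vs) * prod_list (map norm vs)" .
qed

lemma cauchy_bound_add:
  assumes "f \<in> C_inf UNIV" "g \<in> C_inf UNIV" "cauchy_bound f y C M" "cauchy_bound g y C' M"
  shows "cauchy_bound (\<lambda>x. f x + g x) y (C + C') M"
  using assms unfolding cauchy_bound_def
  by (auto simp: dderivs_add ring_distribs intro!: order_trans[OF norm_triangle_ineq] add_mono)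

text \<open>The extra letter contributes the factor \<open>length vs + 1\<close> from the factorial,
  which doubling \<open>M\<close> absorbs.\<close>

lemma cauchy_bound_dderiv:
  fixes v :: "'v::euclidean_space"
  assumes "cauchy_bound f y C M" "C \<ge> 0" "M \<ge> 0"
  shows "cauchy_bound (dderiv v f) y (C * M * norm v) (2 * M)"
  unfolding cauchy_bound_def
proof
  fix vs :: "'v list"
  have "real (Suc (length vs)) \<le> 2 ^ length vs"
    using Suc_leI[OF less_exp[of "length vs"]] by (metis of_nat_le_iff of_nat_numeral of_nat_power)
  have "norm (dderivs (v # vs) f y) \<le> C * M ^ length (v # vs) * fact (length (v # vs)) * prod_list (map norm (v # vs))"
    using assms(1) unfolding cauchy_bound_def by blast
  also have "\<dots> = real (Suc (length vs)) * (C * M * norm v * M ^ length vs * fact (length vs) * prod_list (map norm vs))"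
    by simp
  also have "\<dots> \<le> 2 ^ length vs * (C * M * norm v * M ^ length vs * fact (length vs) * prod_list (map norm vs))"
    using assms by (intro mult_right_mono \<open>real (Suc (length vs)) \<le> 2 ^ length vs\<close>) auto
  also have "\<dots> = C * M * norm v * (2 * M) ^ length vs * fact (length vs) * prod_list (map norm vs)"
    by (simp add: power_mult_distrib)
  finally show "norm (dderivs vs (dderiv v f) y) \<le> \<dots>" by simp
qed

lemma tame_C_inf: "tame f \<Longrightarrow> f \<in> C_inf UNIV"
  by (simp add: tame_def)

lemma tame_dderiv:
  assumes "tame f"
  shows "tame (dderiv v f)"
  unfolding tame_def
proof (intro conjI allI C_inf_dderiv tame_C_inf assms)
  fix x
  obtain r C M where *: "r > 0" "C \<ge> 0" "M \<ge> 1" "\<And>y. y \<in> ball x r \<Longrightarrow> cauchy_bound f y C M"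
    using assms unfolding tame_def by blast
  show "\<exists>r>0. \<exists>C\<ge>0. \<exists>M\<ge>1. \<forall>y\<in>ball x r. cauchy_bound (dderiv v f) y C M"
    using * by (intro exI[of _ r] conjI exI[of _ "C * M * norm v"] exI[of _ "2 * M"])
      (auto intro: cauchy_bound_dderiv)
qed

lemma tame_add:
  assumes "tame f" "tame g"
  shows "tame (\<lambda>x. f x + g x)"
  unfolding tame_def
proof (intro conjI allI C_inf_add tame_C_inf assms)
  fix x
  obtain r C M where 1: "r > 0" "C \<ge> 0" "M \<ge> 1" "\<And>y. y \<in> ball x r \<Longrightarrow> cauchy_bound f y C M"
    using assms(1) unfolding tame_def by blast
  obtain r' C' M' where 2: "r' > 0" "C' \<ge> 0" "M' \<ge> 1" "\<And>y. y \<in> ball x r' \<Longrightarrow> cauchy_bound g y C' M'"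
    using assms(2) unfolding tame_def by blast
  have "cauchy_bound (\<lambda>x. f x + g x) y (C + C') (max M M')" if "y \<in> ball x (min r r')" for y
  proof (intro cauchy_bound_add tame_C_inf assms)
    show "cauchy_bound f y C (max M M')"
      by (rule cauchy_bound_mono[OF 1(4)]) (use 1(1-3) that in auto)
    show "cauchy_bound g y C' (max M M')"
      by (rule cauchy_bound_mono[OF 2(4)]) (use 2(1-3) that in auto)
  qed
  then show "\<exists>r>0. \<exists>C\<ge>0. \<exists>M\<ge>1. \<forall>y\<in>ball x r. cauchy_bound (\<lambda>x. f x + g x) y C M"
    using 1 2 by (intro exI[of _ "min r r'"] conjI exI[of _ "C + C'"] exI[of _ "max M M'"]) auto
qed

lemma tame_cmult:
  assumes "tame f"
  shows "tame (\<lambda>x. c * f x)"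
  unfolding tame_def
proof (intro conjI allI C_inf_cmult tame_C_inf assms)
  fix x
  obtain r C M where 1: "r > 0" "C \<ge> 0" "M \<ge> 1" "\<And>y. y \<in> ball x r \<Longrightarrow> cauchy_bound f y C M"
    using assms(1) unfolding tame_def by blast
  have "cauchy_bound (\<lambda>x. c * f x) y (norm c * C) M" if "y \<in> ball x r" for y
    using 1(4)[OF that] unfolding cauchy_bound_def dderivs_cmult[OF tame_C_inf[OF assms]] norm_mult
    by (auto simp: mult.assoc intro!: mult_left_mono)
  then show "\<exists>r>0. \<exists>C\<ge>0. \<exists>M\<ge>1. \<forall>y\<in>ball x r. cauchy_bound (\<lambda>x. c * f x) y C M"
    using 1 by (intro exI[of _ r] conjI exI[of _ "norm c * C"] exI[of _ M]) auto
qed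

lemma tame_diff: "tame f \<Longrightarrow> tame g \<Longrightarrow> tame (\<lambda>x. f x - g x)"
  using tame_add[of f "\<lambda>x. (-1) * g x"] tame_cmult[of g "-1"] by simp

lemma tame_zero: "tame (\<lambda>_. 0)"
  unfolding tame_def
  by (auto simp: C_inf_zero cauchy_bound_def dderivs_zero intro!: exI[of _ 1])

section \<open>Composition with affine isometries\<close>

definition affine_isometry :: "('v::euclidean_space \<Rightarrow> 'v) \<Rightarrow> ('v \<Rightarrow> 'v) \<Rightarrow> bool" where
  "affine_isometry w L \<longleftrightarrow> linear L \<and> (\<forall>v. norm (L v) = norm v) \<and> (\<forall>x v. w (x + v) = w x + L v)"

lemma dderiv_compose:
  assumes "affine_isometry w L"
  shows "dderiv v (\<lambda>x. f (w x)) = (\<lambda>x. dderiv (L v) f (w x))"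
  using assms unfolding affine_isometry_def dderiv_def by (simp add: linear_cmul)

lemma dderiv_funpow_compose:
  assumes "affine_isometry w L"
  shows "(dderiv v ^^ r) (\<lambda>x. f (w x)) = (\<lambda>x. (dderiv (L v) ^^ r) f (w x))"
  by (induction r) (auto simp: dderiv_compose[OF assms])

lemma dderivs_compose:
  assumes "affine_isometry w L"
  shows "dderivs vs (\<lambda>x. f (w x)) = (\<lambda>x. dderivs (map L vs) f (w x))"
  by (induction vs arbitrary: f) (auto simp: dderiv_compose[OF assms])

lemma affine_isometry_differentiable:
  assumes "affine_isometry w L"
  shows "w differentiable (at x)"
proof -
  have "w = (\<lambda>y. w 0 + L y)" using assms unfolding affine_isometry_def by (metis add_0)
  moreover have "(\<lambda>y. w 0 + L y) differentiable (at x)"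
    using assms unfolding affine_isometry_def
    by (intro differentiable_add differentiable_const linear_imp_differentiable) auto
  ultimately show ?thesis by simp
qed

lemma affine_isometry_dist:
  assumes "affine_isometry w L"
  shows "dist (w x) (w y) = dist x y"
proof -
  have "w (y + (x - y)) = w y + L (x - y)" "norm (L (x - y)) = norm (x - y)"
    using assms unfolding affine_isometry_def by blast+
  then have "w x - w y = L (x - y)" by simp
  then show ?thesis using \<open>norm (L (x - y)) = norm (x - y)\<close> by (simp add: dist_norm)
qed

lemma C_inf_compose:
  assumes "affine_isometry w L" "f \<in> C_inf UNIV"
  shows "(\<lambda>x. f (w x)) \<in> C_inf UNIV"
proof (rule C_inf_coinduct[where P = "\<lambda>h. \<exists>f. f \<in> C_inf UNIV \<and> h = (\<lambda>x. f (w x))"])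
  fix h :: "'a \<Rightarrow> complex"
  assume "\<exists>f. f \<in> C_inf UNIV \<and> h = (\<lambda>x. f (w x))"
  then obtain f where *: "f \<in> C_inf UNIV" "h = (\<lambda>x. f (w x))" by blast
  have "h differentiable at x" for x
    unfolding *(2)
    by (rule differentiable_compose[OF C_inf_differentiable[OF *(1)] affine_isometry_differentiable[OF assms(1)]])
  then show "(\<forall>x. h differentiable at x) \<and> (\<forall>v. \<exists>f. f \<in> C_inf UNIV \<and> dderiv v h = (\<lambda>x. f (w x)))"
    unfolding *(2) dderiv_compose[OF assms(1)] using C_inf_dderiv[OF *(1)] by blast
qed (use assms in blast)

lemma tame_compose:
  assumes w: "affine_isometry w L" and f: "tame f"
  shows "tame (\<lambda>x. f (w x))"
  unfolding tame_def
proof (intro conjI allI C_inf_compose[OF w] tame_C_inf f)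
  fix x
  obtain r C M where 1: "r > 0" "C \<ge> 0" "M \<ge> 1" "\<And>y. y \<in> ball (w x) r \<Longrightarrow> cauchy_bound f y C M"
    using f unfolding tame_def by blast
  have "norm (L v) = norm v" for v using w by (simp add: affine_isometry_def)
  then have L: "map norm (map L vs) = map norm vs" for vs by simp
  have "cauchy_bound (\<lambda>x. f (w x)) y C M" if "y \<in> ball x r" for y
  proof -
    have "w y \<in> ball (w x) r" using that affine_isometry_dist[OF w] by simp
    from 1(4)[OF this] show ?thesis
      unfolding cauchy_bound_def dderivs_compose[OF w] by (metis L length_map)
  qed
  then show "\<exists>r>0. \<exists>C\<ge>0. \<exists>M\<ge>1. \<forall>y\<in>ball x r. cauchy_bound (\<lambda>x. f (w x)) y C M"
    using 1 by blast
qed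

section \<open>Uniform estimates on balls and the identity theorem\<close>

lemma tame_bound_cball:
  fixes f :: "'v::euclidean_space \<Rightarrow> complex"
  assumes "tame f"
  obtains C M where "C \<ge> 0" "M \<ge> 1" "\<And>y. y \<in> cball x \<rho> \<Longrightarrow> cauchy_bound f y C M"
proof -
  have "\<forall>x. \<exists>r C M. r > 0 \<and> C \<ge> 0 \<and> M \<ge> 1 \<and> (\<forall>y\<in>ball x r. cauchy_bound f y C M)"
    using assms unfolding tame_def by blast
  then obtain r C M where *: "\<And>x. r x > (0::real)" "\<And>x. C x \<ge> (0::real)" "\<And>x. M x \<ge> (1::real)"
    "\<And>x y. y \<in> ball x (r x) \<Longrightarrow> cauchy_bound f y (C x) (M x)" by metis
  have "cball x \<rho> \<subseteq> (\<Union>x\<in>UNIV. ball x (r x))"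
  proof
    fix y
    have "y \<in> ball y (r y)" using *(1) by simp
    then show "y \<in> (\<Union>x\<in>UNIV. ball x (r x))" by blast
  qed
  then obtain D where D: "finite D" "cball x \<rho> \<subseteq> (\<Union>x\<in>D. ball x (r x))"
    by (rule compactE_image[OF compact_cball, rotated]) auto
  have M0: "M z \<ge> 0" for z using *(3)[of z] by simp
  \<comment> \<open>Sums over the finite subcover dominate the local constants. The summand 1 keeps
    the second one at least 1 even if \<open>D\<close> is empty.\<close>
  have "cauchy_bound f y (\<Sum>x\<in>D. C x) (1 + (\<Sum>x\<in>D. M x))" if yx: "y \<in> cball x \<rho>" for y
  proof -
    obtain z where z: "z \<in> D" "y \<in> ball z (r z)" using D(2) yx by blast
    have "C z \<le> (\<Sum>x\<in>D. C x)" "M z \<le> (\<Sum>x\<in>D. M x)"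
      using D z * M0 by (auto intro!: member_le_sum)
    then show ?thesis
      by (intro cauchy_bound_mono[OF *(4)[OF z(2)]]) (use *(2) M0 in auto)
  qed
  moreover have "0 \<le> (\<Sum>x\<in>D. C x)" "1 \<le> 1 + (\<Sum>x\<in>D. M x)"
    using * M0 by (auto intro: sum_nonneg)
  ultimately show ?thesis using that by blast
qed

text \<open>Taylor's formula at \<open>z\<close>, all of whose terms vanish. Half of the radius
  available at \<open>x\<close> is spent on moving to \<open>z\<close> and the other half on the
  expansion there, so one \<open>e\<close> serves all centres near \<open>x\<close>.\<close>

lemma tame_vanish_uniform:
  assumes "tame f"
  shows "\<exists>e>0. \<forall>z\<in>ball x e. \<forall>h. norm h < e \<longrightarrow> (\<forall>n. (dderiv h ^^ n) f z = 0) \<longrightarrow> f (z + h) = 0"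
proof -
  obtain r C M where 1: "r > 0" "C \<ge> 0" "M \<ge> 1" "\<And>y. y \<in> ball x r \<Longrightarrow> cauchy_bound f y C M"
    using assms unfolding tame_def by blast
  define e where "e = min (r / 2) (1 / M)"
  have e: "e > 0" using 1 by (simp add: e_def)
  have "f (z + h) = 0" if z: "z \<in> ball x e" and h: "norm h < e" and d: "\<And>n. (dderiv h ^^ n) f z = 0" for z h
  proof -
    have b: "cauchy_bound f y C M" if "y \<in> ball z (r / 2)" for y
    proof -
      have "dist x y < r" using z that dist_triangle[of x y z] by (auto simp: e_def)
      then show ?thesis using 1(4) by simp
    qed
    have q: "M * norm h < 1" using h 1 by (simp add: e_def field_simps)
    have "(\<lambda>n. (dderiv h ^^ n) f z / fact n) sums f (z + h)"
      by (rule taylor_sums[where r = "r / 2", OF tame_C_inf[OF assms] b]) (use 1(1-3) h q in \<open>auto simp: e_def\<close>)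
    then show ?thesis by (simp add: d sums_iff)
  qed
  then show ?thesis using e by blast
qed

lemma dderiv_funpow_zero: "(dderiv h ^^ n) (\<lambda>_. 0) = (\<lambda>_. 0)"
  using dderivs_zero[of "replicate n h"] by (simp add: dderivs_replicate)

text \<open>The radius in \<open>tame_vanish_uniform\<close> is locally uniform, so the interior of the zero set is closed.\<close>

lemma tame_identity:
  fixes f :: "'v::euclidean_space \<Rightarrow> complex"
  assumes f: "tame f" and U: "open U" "U \<noteq> {}" "\<And>y. y \<in> U \<Longrightarrow> f y = 0"
  shows "f x = 0"
proof -
  define Z where "Z = interior {y. f y = 0}"
  have UZ: "U \<subseteq> Z" unfolding Z_def by (rule interior_maximal) (use U in auto)
  have oZ: "open Z" by (simp add: Z_def)
  have "closed Z"
  proof -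
    have "y \<in> Z" if y: "y \<in> closure Z" for y
    proof -
      obtain e where e: "e > 0" "\<And>z h. z \<in> ball y e \<Longrightarrow> norm h < e \<Longrightarrow>
          (\<forall>n. (dderiv h ^^ n) f z = 0) \<Longrightarrow> f (z + h) = 0"
        using tame_vanish_uniform[OF f, of y] by blast
      obtain z where z: "z \<in> Z" "dist z y < e" using y e(1) by (auto simp: closure_approachable)
      have "f v = 0" if "v \<in> ball z e" for v
      proof -
        have "(dderiv h ^^ n) f z = 0" for n h
          using dderiv_funpow_cong_open[OF oZ, where f = f and g = "\<lambda>_. 0" and x = z and v = h and r = n] z interior_subset
          by (auto simp: dderiv_funpow_zero Z_def)
        then have "f (z + (v - z)) = 0"
          using that z by (intro e(2)) (auto simp: dist_norm norm_minus_commute)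
        then show ?thesis by simp
      qed
      then have "ball z e \<subseteq> Z" unfolding Z_def by (intro interior_maximal) auto
      then show ?thesis using z by (auto simp: dist_commute)
    qed
    then have "closure Z \<subseteq> Z" by blast
    then show ?thesis by (simp add: closure_subset_eq)
  qed
  then have "Z = UNIV" using oZ UZ U(2) clopen[of Z] by blast
  then show ?thesis using interior_subset unfolding Z_def by blast
qed

lemma tame_eqI:
  fixes f :: "'v::euclidean_space \<Rightarrow> complex"
  assumes "tame f" "tame g" "open U" "U \<noteq> {}" "\<And>y. y \<in> U \<Longrightarrow> f y = g y"
  shows "f = g"
  using tame_identity[OF tame_diff[OF assms(1,2)] assms(3,4)] assms(5) by (intro ext) auto

section \<open>Affine roots and reflections\<close>

lemma aff_simps [simp]:
  "aff (- a) x = - aff a x" "aff (a + b) x = aff a x + aff b x" "aff (a - b) x = aff a x - aff b x"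
  "aff (c *\<^sub>R a) x = c * aff a x"
  by (auto simp: aff_def inner_diff_left inner_add_left algebra_simps)

lemma aff_sum: "aff (\<Sum>b\<in>X. c b *\<^sub>R b) x = (\<Sum>b\<in>X. c b * aff b x)"
proof -
  have "aff (0 :: 'a \<times> real) x = 0" by (simp add: aff_def)
  then show ?thesis by (induction X rule: infinite_finite_induct) auto
qed

lemma aff_add_vec: "aff a (x + v) = aff a x + fst a \<bullet> v"
  by (simp add: aff_def inner_add_right)

lemma aff_inj:
  assumes "\<And>x. aff a x = aff b x"
  shows "a = b"
proof (rule prod_eqI)
  show s: "snd a = snd b" using assms[of 0] by (simp add: aff_def)
  have "fst a \<bullet> x = fst b \<bullet> x" for x using assms[of x] s by (simp add: aff_def)
  then show "fst a = fst b" by (metis vector_eq_rdot)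
qed

lemma inner_coroot: "\<alpha> \<noteq> 0 \<Longrightarrow> \<alpha> \<bullet> coroot \<alpha> = 2"
  by (simp add: coroot_def)

lemma aff_refl: "aff b (refl a x) = aff b x - aff a x * (fst b \<bullet> coroot (fst a))"
  by (simp add: refl_def aff_def inner_diff_right algebra_simps)

lemma refl_fixes: "aff a x = 0 \<Longrightarrow> refl a x = x"
  by (simp add: refl_def)

lemma refl_refl:
  assumes "fst a \<noteq> 0"
  shows "refl a (refl a x) = x"
  using aff_refl[of a a x] inner_coroot[OF assms] by (simp add: refl_def)

lemma refl_uminus: "refl (- a) = refl a"
  by (auto simp: refl_def coroot_def)

lemma affine_isometry_refl:
  assumes "fst a \<noteq> 0"
  shows "affine_isometry (refl a) (refl (fst a, 0))"
  unfolding affine_isometry_def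
proof (intro conjI allI)
  show "linear (refl (fst a, 0))"
    by (auto intro!: linearI simp: refl_def aff_def inner_add_right algebra_simps)
  fix v
  define c where "c = 2 * (fst a \<bullet> v) / (fst a \<bullet> fst a)"
  have r: "refl (fst a, 0) v = v - c *\<^sub>R fst a" by (simp add: refl_def aff_def coroot_def c_def)
  have "c * (fst a \<bullet> fst a) = 2 * (fst a \<bullet> v)" using assms by (simp add: c_def)
  then have "(v - c *\<^sub>R fst a) \<bullet> (v - c *\<^sub>R fst a) = v \<bullet> v"
    by (simp add: inner_diff_left inner_diff_right inner_commute algebra_simps)
  then show "norm (refl (fst a, 0) v) = norm v" by (simp add: r norm_eq)
qed (auto simp: refl_def aff_def inner_add_right algebra_simps)

lemma affine_isometry_comp:
  "affine_isometry w L \<Longrightarrow> affine_isometry w' L' \<Longrightarrow> affine_isometry (w \<circ> w') (L \<circ> L')"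
  unfolding affine_isometry_def by (auto simp: linear_compose)

lemma affine_isometry_id: "affine_isometry id id"
  unfolding affine_isometry_def by (auto simp: linear_id)

text \<open>Comparing linear parts shows that the transpose of \<open>L\<close> maps the gradient of
  \<open>a\<close> to that of \<open>b\<close>; for an isometry the transpose is the
  inverse.\<close>

lemma affine_isometry_gradient:
  assumes w: "affine_isometry w L" and b: "\<And>x. aff b x = aff a (w x)"
  shows "L (fst b) = fst a" "L (coroot (fst b)) = coroot (fst a)"
proof -
  have lin: "linear L" and iso: "\<And>v. norm (L v) = norm v" and add: "\<And>x v. w (x + v) = w x + L v"
    using w by (auto simp: affine_isometry_def)
  have inn: "L u \<bullet> L v = u \<bullet> v" for u v
    unfolding dot_norm by (metis iso linear_add[OF lin])
  have "inj L"
    unfolding linear_injective_0[OF lin] using iso by (metis norm_eq_zero)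
  then have surj: "surj L" using linear_injective_imp_surjective[OF lin] by blast
  have "fst b \<bullet> v = fst a \<bullet> L v" for v
    using b[of "0 + v"] b[of 0] by (simp only: add aff_add_vec)
  then have "L (fst b) \<bullet> L v = fst a \<bullet> L v" for v by (simp add: inn)
  then have "L (fst b) \<bullet> v = fst a \<bullet> v" for v using surj by (metis surjD)
  then show L: "L (fst b) = fst a" by (metis vector_eq_rdot)
  have "fst b \<bullet> fst b = fst a \<bullet> fst a" using inn[of "fst b" "fst b"] L by simp
  then show "L (coroot (fst b)) = coroot (fst a)" by (simp add: coroot_def linear_cmul[OF lin] L)
qed

text \<open>The conjugation formula \<open>s_{w b} = w s_b w^{-1}\<close>, written without
  inverses.\<close>

lemma refl_conj:
  assumes w: "affine_isometry w L" and b: "\<And>x. aff b x = aff a (w x)"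
  shows "refl a (w x) = w (refl b x)"
proof -
  have lin: "linear L" and add: "\<And>x v. w (x + v) = w x + L v"
    using w by (auto simp: affine_isometry_def)
  have "w (refl b x) = w (x + - aff b x *\<^sub>R coroot (fst b))" by (simp add: refl_def)
  also have "\<dots> = w x - aff b x *\<^sub>R coroot (fst a)"
    unfolding add linear_cmul[OF lin] affine_isometry_gradient(2)[OF w b] by simp
  finally show ?thesis by (simp add: refl_def b)
qed

lemma real_linear_eq_inner:
  fixes f :: "'v::euclidean_space \<Rightarrow> real"
  assumes "linear f"
  shows "\<exists>p. \<forall>x. f x = x \<bullet> p"
proof (intro exI allI)
  fix x
  have "f x = f (\<Sum>e\<in>Basis. (x \<bullet> e) *\<^sub>R e)" by (simp add: euclidean_representation)
  also have "\<dots> = x \<bullet> (\<Sum>e\<in>Basis. f e *\<^sub>R e)"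
    by (simp add: linear_sum[OF assms] linear_cmul[OF assms] inner_sum_right mult.commute)
  finally show "f x = x \<bullet> (\<Sum>e\<in>Basis. f e *\<^sub>R e)" .
qed

lemma nat_combination_0: "nat_combination X 0"
  unfolding nat_combination_def by (rule exI[of _ "\<lambda>_. 0"]) simp

lemma nat_combination_add:
  assumes "nat_combination X x" "nat_combination X y"
  shows "nat_combination X (x + y)"
proof -
  obtain c d where "x = (\<Sum>b\<in>X. real (c b) *\<^sub>R b)" "y = (\<Sum>b\<in>X. real (d b) *\<^sub>R b)"
    using assms by (auto simp: nat_combination_def)
  then show ?thesis unfolding nat_combination_def
    by (intro exI[of _ "\<lambda>b. c b + d b"]) (simp add: sum.distrib scaleR_add_left)
qed

lemma nat_combination_scale: "nat_combination X x \<Longrightarrow> nat_combination X (real n *\<^sub>R x)"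
  by (induction n) (auto simp: nat_combination_0 nat_combination_add scaleR_add_left)

lemma nat_combination_base:
  assumes "finite X" "b \<in> X"
  shows "nat_combination X b"
  unfolding nat_combination_def
proof
  have "(\<Sum>a\<in>X. real (if a = b then 1 else 0) *\<^sub>R a) = (\<Sum>a\<in>X. if a = b then a else 0)"
    by (rule sum.cong) auto
  then show "b = (\<Sum>a\<in>X. real (if a = b then 1 else 0) *\<^sub>R a)" using assms by simp
qed

lemma nat_combination_mono_image:
  assumes "nat_combination X x" "finite Y" "linear f" "f ` X \<subseteq> Y"
  shows "nat_combination Y (f x)"
proof -
  obtain c where c: "x = (\<Sum>b\<in>X. real (c b) *\<^sub>R b)" using assms by (auto simp: nat_combination_def)
  have "nat_combination Y (\<Sum>b\<in>Z. real (c b) *\<^sub>R f b)" if "Z \<subseteq> X" for Z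
    using that assms(4)
    by (induction Z rule: infinite_finite_induct)
       (auto intro!: nat_combination_0 nat_combination_add nat_combination_scale intro: nat_combination_base[OF assms(2)])
  from this[of X] show ?thesis by (simp add: c linear_sum[OF assms(3)] linear_cmul[OF assms(3)])
qed

section \<open>Positive affine roots and the fundamental alcove\<close>

locale affine_root_system =
  fixes R B :: "'v::euclidean_space set" and \<phi> :: 'v
  assumes irr: "irreducible_root_system R" and basis: "root_basis R B" and high: "highest_root R B \<phi>"
begin

abbreviation "Sg \<equiv> aff_roots R"
abbreviation "Sp \<equiv> pos_aff_roots R B \<phi>"
abbreviation "I \<equiv> simple_aff_roots B \<phi>"
abbreviation "W \<equiv> weyl R"
abbreviation "Cp \<equiv> fund_alcove B \<phi>"
abbreviation "Cbar \<equiv> closure (fund_alcove B \<phi>)"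

lemma finite_R: "finite R" and R_nonzero: "\<alpha> \<in> R \<Longrightarrow> \<alpha> \<noteq> 0" and span_R: "span R = UNIV"
  and refl_R: "\<alpha> \<in> R \<Longrightarrow> \<beta> \<in> R \<Longrightarrow> \<beta> - (\<beta> \<bullet> coroot \<alpha>) *\<^sub>R \<alpha> \<in> R"
  and cryst: "\<alpha> \<in> R \<Longrightarrow> \<beta> \<in> R \<Longrightarrow> \<beta> \<bullet> coroot \<alpha> \<in> \<int>"
  and reduced: "\<alpha> \<in> R \<Longrightarrow> c *\<^sub>R \<alpha> \<in> R \<Longrightarrow> c = 1 \<or> c = -1"
proof -
  note i = irr[unfolded irreducible_root_system_def]
  note c2 = i[THEN conjunct2]
  note c3 = c2[THEN conjunct2]
  note c4 = c3[THEN conjunct2]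
  note c5 = c4[THEN conjunct2]
  note c6 = c5[THEN conjunct2]
  show "finite R" by (rule i[THEN conjunct1])
  show "\<alpha> \<in> R \<Longrightarrow> \<alpha> \<noteq> 0" using c2[THEN conjunct1] by blast
  show "span R = UNIV" by (rule c3[THEN conjunct1])
  show "\<alpha> \<in> R \<Longrightarrow> \<beta> \<in> R \<Longrightarrow> \<beta> - (\<beta> \<bullet> coroot \<alpha>) *\<^sub>R \<alpha> \<in> R" using c4[THEN conjunct1] by blast
  show "\<alpha> \<in> R \<Longrightarrow> \<beta> \<in> R \<Longrightarrow> \<beta> \<bullet> coroot \<alpha> \<in> \<int>" using c5[THEN conjunct1] by blast
  show "\<alpha> \<in> R \<Longrightarrow> c *\<^sub>R \<alpha> \<in> R \<Longrightarrow> c = 1 \<or> c = -1" using c6[THEN conjunct1] by blast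
qed

lemma neg_R: "\<alpha> \<in> R \<Longrightarrow> - \<alpha> \<in> R"
  using refl_R[of \<alpha> \<alpha>] inner_coroot[OF R_nonzero] by (simp add: scaleR_2)

lemma B_R: "B \<subseteq> R" and indep_B: "independent B"
  and R_comb: "\<alpha> \<in> R \<Longrightarrow> nat_combination B \<alpha> \<or> nat_combination B (- \<alpha>)"
  using basis by (auto simp: root_basis_def)

lemma phi_R: "\<phi> \<in> R" and phi_high: "\<alpha> \<in> R \<Longrightarrow> nat_combination B (\<phi> - \<alpha>)"
  using high by (auto simp: highest_root_def)

lemma finite_B: "finite B"
  using finite_subset[OF B_R finite_R] .

lemma finite_I: "finite I"
  using finite_B by (simp add: simple_aff_roots_def)

text \<open>Adding the two expansions gives a linear relation with nonnegative coefficients;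
  independence kills it, hence every single coefficient.\<close>

lemma nat_comb_B_eq_0:
  assumes "nat_combination B x" "nat_combination B (- x)"
  shows "x = 0"
proof -
  obtain c d where c: "x = (\<Sum>b\<in>B. real (c b) *\<^sub>R b)" and d: "- x = (\<Sum>b\<in>B. real (d b) *\<^sub>R b)"
    using assms by (auto simp: nat_combination_def)
  have "(\<Sum>b\<in>B. (real (c b) + real (d b)) *\<^sub>R b)
      = (\<Sum>b\<in>B. real (c b) *\<^sub>R b) + (\<Sum>b\<in>B. real (d b) *\<^sub>R b)"
    by (simp add: scaleR_add_left sum.distrib)
  also have "\<dots> = x + - x" by (simp only: c[symmetric] d[symmetric])
  finally have "(\<Sum>b\<in>B. (real (c b) + real (d b)) *\<^sub>R b) = 0" by simp
  then have "real (c b) + real (d b) = 0" if "b \<in> B" for b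
    using independentD[OF indep_B finite_B subset_refl _ that, of "\<lambda>b. real (c b) + real (d b)"] by simp
  then have "c b = 0" if "b \<in> B" for b using that by fastforce
  then show ?thesis by (simp add: c)
qed

text \<open>Since \<open>- \<phi>\<close> is a root, maximality makes
  \<open>\<phi> - (- \<phi>) = 2 \<phi>\<close> a natural combination. If \<open>- \<phi>\<close>
  were one as well, \<open>\<phi>\<close> would vanish.\<close>

lemma phi_comb: "nat_combination B \<phi>"
proof (rule ccontr)
  assume *: "\<not> nat_combination B \<phi>"
  then have m: "nat_combination B (- \<phi>)" using R_comb[OF phi_R] by blast
  have "nat_combination B (\<phi> - (- \<phi>))" using phi_high neg_R phi_R by blast
  then have "nat_combination B (2 *\<^sub>R \<phi>)" by (simp add: scaleR_2)
  moreover have "nat_combination B (- (2 *\<^sub>R \<phi>))"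
    using nat_combination_add[OF m m] by (simp add: scaleR_2)
  ultimately have "2 *\<^sub>R \<phi> = 0" by (rule nat_comb_B_eq_0)
  then show False using R_nonzero phi_R by auto
qed

text \<open>The gradients of \<open>I\<close> are linearly dependent, but the constant part of
  \<open>(- \<phi>, 1)\<close> separates it from the span of \<open>B \<times> {0}\<close>.
  Coefficients with respect to \<open>I\<close> are therefore well defined.\<close>

lemma indep_I: "independent I"
proof -
  have lin: "linear (\<lambda>b::'v. (b, 0::real))" by (auto intro!: linearI)
  have "independent ((\<lambda>b. (b, 0::real)) ` B)"
    by (rule linear_independent_injective_image[OF lin indep_B]) (auto simp: inj_on_def)
  moreover have "(\<lambda>b. (b, 0::real)) ` B = B \<times> {0}" by auto
  ultimately have i: "independent (B \<times> {0::real})" by simp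
  have "span (B \<times> {0::real}) \<subseteq> {p. snd p = 0}"
    by (rule span_minimal) (auto intro!: subspaceI)
  then have "(- \<phi>, 1) \<notin> span (B \<times> {0::real})" by auto
  then show ?thesis unfolding simple_aff_roots_def using i by (rule independent_insertI)
qed

lemma I_coeffs_unique:
  assumes "(\<Sum>a\<in>I. x a *\<^sub>R a) = (\<Sum>a\<in>I. y a *\<^sub>R a)" "a \<in> I"
  shows "x a = y a"
proof -
  have "(\<Sum>a\<in>I. (x a - y a) *\<^sub>R a) = 0"
    using assms(1) by (simp add: scaleR_diff_left sum_subtractf)
  then show ?thesis
    using independentD[OF indep_I finite_I subset_refl _ assms(2), of "\<lambda>a. x a - y a"] by simp
qed

lemma Sg_iff: "a \<in> Sg \<longleftrightarrow> fst a \<in> R \<and> snd a \<in> \<int>"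
  by (auto simp: aff_roots_def mem_Times_iff)

lemma Sg_uminus: "a \<in> Sg \<Longrightarrow> - a \<in> Sg"
  by (auto simp: Sg_iff neg_R)

lemma Sg_nonzero: "a \<in> Sg \<Longrightarrow> fst a \<noteq> 0"
  using R_nonzero by (auto simp: Sg_iff)

lemma I_Sg: "a \<in> I \<Longrightarrow> a \<in> Sg"
  using B_R phi_R neg_R by (auto simp: Sg_iff simple_aff_roots_def)

lemma Sp_iff: "a \<in> Sp \<longleftrightarrow> a \<in> Sg \<and> nat_combination I a"
  by (simp add: pos_aff_roots_def)

lemma I_Sp: "a \<in> I \<Longrightarrow> a \<in> Sp"
  by (simp add: Sp_iff I_Sg nat_combination_base[OF finite_I])

lemma Sp_Sg: "a \<in> Sp \<Longrightarrow> a \<in> Sg"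
  by (simp add: Sp_iff)

lemma comb_lift:
  assumes "nat_combination B x"
  shows "nat_combination I (x, 0)"
  by (rule nat_combination_mono_image[OF assms finite_I, of "\<lambda>b. (b, 0)", simplified])
     (auto intro!: linearI simp: simple_aff_roots_def)

text \<open>For a root with gradient \<open>\<alpha>\<close> and constant \<open>n \<ge> 1\<close>
  write \<open>\<alpha> + n = (\<phi> + \<alpha>) + (n - 1) \<phi> + n a_0\<close>. The first
  summand is a natural combination because \<open>\<phi>\<close> dominates the root
  \<open>- \<alpha>\<close>.\<close>

lemma Sg_pos_const:
  assumes "a \<in> Sg" "snd a \<ge> 1"
  shows "a \<in> Sp"
proof -
  obtain z where z: "snd a = of_int z" using assms by (auto simp: Sg_iff elim: Ints_cases)
  define n where "n = nat z"
  have n: "snd a = real n" "n \<ge> 1" using z assms by (auto simp: n_def)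
  have "nat_combination B (\<phi> - (- fst a))" using assms(1) by (intro phi_high neg_R) (auto simp: Sg_iff)
  then have "nat_combination B (\<phi> - (- fst a) + real (n - 1) *\<^sub>R \<phi>)"
    by (intro nat_combination_add nat_combination_scale phi_comb)
  then have "nat_combination I (\<phi> - (- fst a) + real (n - 1) *\<^sub>R \<phi>, 0)" by (rule comb_lift)
  moreover have "nat_combination I (real n *\<^sub>R (- \<phi>, 1))"
    by (intro nat_combination_scale nat_combination_base[OF finite_I]) (simp add: simple_aff_roots_def)
  ultimately have "nat_combination I ((\<phi> - (- fst a) + real (n - 1) *\<^sub>R \<phi>, 0) + real n *\<^sub>R (- \<phi>, 1))"
    by (rule nat_combination_add)
  moreover have "(\<phi> - (- fst a) + real (n - 1) *\<^sub>R \<phi>, 0) + real n *\<^sub>R (- \<phi>, 1) = a"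
    using n by (intro prod_eqI) (auto simp: of_nat_diff algebra_simps)
  ultimately show ?thesis using assms by (simp add: Sp_iff)
qed

lemma Sg_cases: "a \<in> Sg \<Longrightarrow> a \<in> Sp \<or> - a \<in> Sp"
proof -
  assume a: "a \<in> Sg"
  then obtain z where z: "snd a = of_int z" by (auto simp: Sg_iff elim: Ints_cases)
  consider "z \<ge> 1" | "z \<le> -1" | "z = 0" by linarith
  then show ?thesis
  proof cases
    case 1
    then show ?thesis using Sg_pos_const[OF a] z by simp
  next
    case 2
    then show ?thesis using Sg_pos_const[OF Sg_uminus[OF a]] z by simp
  next
    case 3
    then have s: "a = (fst a, 0)" "- a = (- fst a, 0)" using z by (auto intro: prod_eqI)
    have "nat_combination B (fst a) \<or> nat_combination B (- fst a)"
      using a R_comb by (auto simp: Sg_iff)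
    then have "nat_combination I a \<or> nat_combination I (- a)"
      using comb_lift s by metis
    then show ?thesis using a Sg_uminus by (auto simp: Sp_iff)
  qed
qed

lemma Cp_iff: "x \<in> Cp \<longleftrightarrow> (\<forall>a\<in>I. aff a x > 0)"
  by (auto simp: fund_alcove_def)

lemma ex_prescribed: "\<exists>p. \<forall>b\<in>B. b \<bullet> p = g b"
proof -
  obtain f :: "'v \<Rightarrow> real" where f: "linear f" "\<And>b. b \<in> B \<Longrightarrow> f b = g b"
    using linear_independent_extend[OF indep_B, of g] by blast
  then show ?thesis using real_linear_eq_inner by metis
qed

lemma phi_coeffs: "\<exists>n. (\<forall>p. \<phi> \<bullet> p = (\<Sum>b\<in>B. real (n b) * (b \<bullet> p))) \<and> (\<exists>b\<in>B. n b > 0)"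
proof -
  obtain n where n: "\<phi> = (\<Sum>b\<in>B. real (n b) *\<^sub>R b)" using phi_comb by (auto simp: nat_combination_def)
  have "\<exists>b\<in>B. n b > 0"
  proof (rule ccontr)
    assume "\<not> ?thesis"
    then have "\<phi> = 0" using n by simp
    then show False using R_nonzero phi_R by blast
  qed
  moreover have "\<phi> \<bullet> p = (\<Sum>b\<in>B. real (n b) * (b \<bullet> p))" for p
    by (subst n) (simp add: inner_sum_left)
  ultimately show ?thesis by blast
qed

lemma ex_point:
  fixes g :: "'v \<Rightarrow> real"
  assumes "\<And>b. b \<in> B \<Longrightarrow> g b \<ge> 0"
  shows "\<exists>p. (\<forall>b\<in>B. b \<bullet> p \<ge> 0 \<and> (b \<bullet> p = 0 \<longleftrightarrow> g b = 0)) \<and> \<phi> \<bullet> p < 1"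
proof -
  obtain p where p: "\<And>b. b \<in> B \<Longrightarrow> b \<bullet> p = g b" using ex_prescribed by metis
  obtain n where n: "\<And>p. \<phi> \<bullet> p = (\<Sum>b\<in>B. real (n b) * (b \<bullet> p))" using phi_coeffs by blast
  have h: "\<phi> \<bullet> p \<ge> 0" unfolding n by (intro sum_nonneg) (auto simp: p assms)
  show ?thesis
    \<comment> \<open>Dividing by \<open>\<phi> \<bullet> p + 1\<close> pushes the value of
      \<open>\<phi>\<close> below 1 and keeps the signs and zeros of the values on
      \<open>B\<close>.\<close>
    by (rule exI[of _ "(1 / (\<phi> \<bullet> p + 1)) *\<^sub>R p"]) (use h p assms in \<open>auto simp: field_simps\<close>)
qed

lemma Cp_nonempty: "\<exists>p. p \<in> Cp"
proof -
  obtain p where "\<forall>b\<in>B. b \<bullet> p \<ge> 0 \<and> b \<bullet> p \<noteq> 0" "\<phi> \<bullet> p < 1"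
    using ex_point[of "\<lambda>_. 1"] by auto
  then show ?thesis by (intro exI[of _ p]) (auto simp: Cp_iff simple_aff_roots_def aff_def order_less_le)
qed

text \<open>Provides a point in the relative interior of each facet of the alcove. For the affine
  simple root a point with all \<open>b \<bullet> p = 1\<close> is rescaled to
  \<open>\<phi> \<bullet> p = 1\<close>; for the others one coordinate is put to 0.\<close>

lemma ex_wall_point:
  assumes "a \<in> I"
  shows "\<exists>p. aff a p = 0 \<and> (\<forall>c\<in>I. c \<noteq> a \<longrightarrow> aff c p > 0)"
proof (cases "a = (- \<phi>, 1)")
  case True
  obtain p where p: "\<And>b. b \<in> B \<Longrightarrow> b \<bullet> p = 1" using ex_prescribed[of "\<lambda>_. 1"] by auto
  obtain n b where n: "\<And>p. \<phi> \<bullet> p = (\<Sum>b\<in>B. real (n b) * (b \<bullet> p))" "b \<in> B" "n b > (0::nat)"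
    using phi_coeffs by blast
  have h: "\<phi> \<bullet> p > 0" unfolding n(1)
    by (rule sum_pos2[OF finite_B n(2)]) (use n(3) p n(2) in auto)
  show ?thesis
    by (rule exI[of _ "(1 / (\<phi> \<bullet> p)) *\<^sub>R p"])
       (use h p True in \<open>auto simp: aff_def simple_aff_roots_def\<close>)
next
  case False
  then obtain b where b: "b \<in> B" "a = (b, 0)" using assms by (auto simp: simple_aff_roots_def)
  obtain p where "\<forall>c\<in>B. c \<bullet> p \<ge> 0 \<and> (c \<bullet> p = 0 \<longleftrightarrow> c = b)" "\<phi> \<bullet> p < 1"
    using ex_point[of "\<lambda>c. of_bool (c \<noteq> b)"] by auto
  then show ?thesis using b
    by (intro exI[of _ p]) (auto simp: simple_aff_roots_def aff_def order_less_le)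
qed

lemma Sp_nonneg:
  assumes "a \<in> Sp" "\<And>b. b \<in> I \<Longrightarrow> aff b x \<ge> 0"
  shows "aff a x \<ge> 0"
proof -
  obtain c where "a = (\<Sum>b\<in>I. real (c b) *\<^sub>R b)" using assms(1) by (auto simp: Sp_iff nat_combination_def)
  then show ?thesis using assms(2) by (simp add: aff_sum sum_nonneg)
qed

lemma Sp_pos_on_Cp:
  assumes "a \<in> Sp" "x \<in> Cp"
  shows "aff a x > 0"
proof -
  obtain c where c: "a = (\<Sum>b\<in>I. real (c b) *\<^sub>R b)" using assms(1) by (auto simp: Sp_iff nat_combination_def)
  have "\<exists>b\<in>I. c b > 0"
  proof (rule ccontr)
    assume "\<not> ?thesis"
    then have "a = 0" using c by simp
    then show False using Sg_nonzero[OF Sp_Sg[OF assms(1)]] by simp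
  qed
  then obtain b where "b \<in> I" "c b > 0" by blast
  then have "(\<Sum>b\<in>I. real (c b) * aff b x) > 0"
    using assms(2) by (intro sum_pos2[OF finite_I, of b]) (auto simp: Cp_iff less_imp_le)
  then show ?thesis by (simp add: c aff_sum)
qed

lemma Sp_not_uminus: "a \<in> Sp \<Longrightarrow> - a \<notin> Sp"
  using Cp_nonempty Sp_pos_on_Cp[of a] Sp_pos_on_Cp[of "- a"] by fastforce

text \<open>A point satisfying the weak inequalities is the limit of points on the segment towards
  an interior point \<open>p\<close>, at which the inequalities are strict.\<close>

lemma Cbar_iff: "x \<in> Cbar \<longleftrightarrow> (\<forall>a\<in>I. aff a x \<ge> 0)"
proof
  have "closed {x. \<forall>a\<in>I. aff a x \<ge> 0}"
    unfolding aff_def Collect_ball_eq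
    by (intro closed_INT ballI closed_Collect_le continuous_intros)
  moreover have "Cp \<subseteq> {x. \<forall>a\<in>I. aff a x \<ge> 0}" by (auto simp: Cp_iff less_imp_le)
  ultimately have "Cbar \<subseteq> {x. \<forall>a\<in>I. aff a x \<ge> 0}" by (rule closure_minimal[rotated])
  then show "x \<in> Cbar \<Longrightarrow> \<forall>a\<in>I. aff a x \<ge> 0" by blast
next
  assume x: "\<forall>a\<in>I. aff a x \<ge> 0"
  obtain p where p: "p \<in> Cp" using Cp_nonempty by blast
  show "x \<in> Cbar" unfolding closure_approachable
  proof (intro allI impI)
    fix e :: real assume e: "e > 0"
    define t where "t = min 1 (e / (2 * (1 + norm (p - x))))"
    have t: "0 < t" "t \<le> 1" using e by (auto simp: t_def add_pos_nonneg)
    have "aff a (x + t *\<^sub>R (p - x)) = (1 - t) * aff a x + t * aff a p" for a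
      by (simp add: aff_def inner_diff_right inner_add_right algebra_simps)
    moreover have "(1 - t) * aff a x + t * aff a p > 0" if "a \<in> I" for a
      using x p t that by (intro add_nonneg_pos mult_nonneg_nonneg mult_pos_pos) (auto simp: Cp_iff)
    ultimately have "x + t *\<^sub>R (p - x) \<in> Cp" by (simp add: Cp_iff)
    moreover have "t * norm (p - x) < e"
    proof -
      have "t * norm (p - x) \<le> e / (2 * (1 + norm (p - x))) * norm (p - x)"
        by (intro mult_right_mono) (auto simp: t_def)
      also have "\<dots> < e" using e by (simp add: field_simps add_pos_nonneg)
      finally show ?thesis .
    qed
    then have "dist (x + t *\<^sub>R (p - x)) x < e" using t by (simp add: dist_norm)
    ultimately show "\<exists>y\<in>Cp. dist y x < e" by blast
  qed
qed

section \<open>The affine Weyl group and its action on affine roots\<close>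

lemma weyl_affine: "w \<in> W \<Longrightarrow> \<exists>L. affine_isometry w L"
proof (induction rule: weyl.induct)
  case (weyl_refl a w)
  then show ?case using affine_isometry_comp affine_isometry_refl Sg_nonzero by blast
qed (use affine_isometry_id in blast)

lemma weyl_comp: "u \<in> W \<Longrightarrow> w \<in> W \<Longrightarrow> u \<circ> w \<in> W"
  by (induction rule: weyl.induct) (auto simp: comp_assoc intro: weyl.intros)

lemma refl_W: "a \<in> Sg \<Longrightarrow> refl a \<in> W"
  using weyl.weyl_refl[OF _ weyl.weyl_id, of a R] by simp

lemma weyl_inverse: "w \<in> W \<Longrightarrow> \<exists>w'\<in>W. w \<circ> w' = id \<and> w' \<circ> w = id"
proof (induction rule: weyl.induct)
  case weyl_id
  then show ?case by (intro bexI[of _ id]) (auto intro: weyl.weyl_id)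
next
  case (weyl_refl a w)
  then obtain w' where w': "w' \<in> W" "w \<circ> w' = id" "w' \<circ> w = id" by blast
  have r: "refl a \<circ> refl a = id" using refl_refl[OF Sg_nonzero[OF weyl_refl(1)]] by auto
  have "w' \<circ> refl a \<in> W" using weyl_comp[OF w'(1) refl_W[OF weyl_refl(1)]] .
  moreover have "(refl a \<circ> w) \<circ> (w' \<circ> refl a) = id"
    by (metis comp_assoc comp_id w'(2) r)
  moreover have "(w' \<circ> refl a) \<circ> (refl a \<circ> w) = id"
    by (metis comp_assoc comp_id w'(3) r)
  ultimately show ?case by blast
qed

lemma weyl_bij: "w \<in> W \<Longrightarrow> bij w"
  using weyl_inverse o_bij by metis

lemma inv_W: "w \<in> W \<Longrightarrow> inv w \<in> W"
  using weyl_inverse inv_unique_comp by metis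

lemma inv_weyl [simp]: "w \<in> W \<Longrightarrow> inv w (w x) = x" "w \<in> W \<Longrightarrow> w (inv w x) = x"
  using weyl_bij by (auto simp: bij_is_inj bij_is_surj surj_f_inv_f)

text \<open>\<open>pull w a\<close> is the affine root $w^{-1} a$.\<close>

definition pull :: "('v \<Rightarrow> 'v) \<Rightarrow> 'v \<times> real \<Rightarrow> 'v \<times> real" where
  "pull w a = (THE a'. \<forall>x. aff a' x = aff a (w x))"

lemma pull_eqI: "(\<And>x. aff a' x = aff a (w x)) \<Longrightarrow> pull w a = a'"
  unfolding pull_def by (rule the_equality) (auto intro: aff_inj)

text \<open>Composing with \<open>refl b\<close> subtracts a multiple of \<open>b\<close>. The
  crystallographic condition makes the multiple an integer, so the constant part stays
  integral.\<close>

lemma ex_pull: "w \<in> W \<Longrightarrow> a \<in> Sg \<Longrightarrow> \<exists>a'\<in>Sg. \<forall>x. aff a' x = aff a (w x)"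
proof (induction arbitrary: a rule: weyl.induct)
  case (weyl_refl b w)
  define a' where "a' = a - (fst a \<bullet> coroot (fst b)) *\<^sub>R b"
  have "a' \<in> Sg"
    using weyl_refl refl_R cryst by (auto simp: Sg_iff a'_def intro!: Ints_diff Ints_mult)
  moreover have "aff a (refl b x) = aff a' x" for x by (simp add: a'_def aff_refl)
  ultimately show ?case using weyl_refl.IH[of a'] by simp
qed auto

lemma pull_Sg: "w \<in> W \<Longrightarrow> a \<in> Sg \<Longrightarrow> pull w a \<in> Sg"
  and aff_pull: "w \<in> W \<Longrightarrow> a \<in> Sg \<Longrightarrow> aff (pull w a) x = aff a (w x)"
  using ex_pull pull_eqI by metis+

lemma pull_comp: "u \<in> W \<Longrightarrow> w \<in> W \<Longrightarrow> a \<in> Sg \<Longrightarrow> pull (u \<circ> w) a = pull w (pull u a)"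
  by (rule pull_eqI) (simp add: aff_pull pull_Sg)

lemma pull_uminus: "w \<in> W \<Longrightarrow> a \<in> Sg \<Longrightarrow> pull w (- a) = - pull w a"
  by (rule pull_eqI) (simp add: aff_pull)

lemma pull_id: "pull id a = a"
  by (rule pull_eqI) simp

lemma pull_refl: "pull (refl a) b = b - (fst b \<bullet> coroot (fst a)) *\<^sub>R a"
  by (rule pull_eqI) (simp add: aff_refl)

lemma pull_refl_self: "a \<in> Sg \<Longrightarrow> pull (refl a) a = - a"
  by (simp add: pull_refl inner_coroot Sg_nonzero scaleR_2)

lemma pull_refl_refl: "a \<in> Sg \<Longrightarrow> pull (refl a) (pull (refl a) b) = b"
  by (rule pull_eqI) (simp add: pull_refl aff_refl inner_coroot Sg_nonzero algebra_simps)

lemma pull_inj: "w \<in> W \<Longrightarrow> a \<in> Sg \<Longrightarrow> b \<in> Sg \<Longrightarrow> pull w a = pull w b \<Longrightarrow> a = b"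
  by (metis aff_inj aff_pull inv_weyl(2))

lemma sum_I_single:
  assumes "a \<in> I"
  shows "(\<Sum>c\<in>I. (if c = a then y else 0) *\<^sub>R c) = y *\<^sub>R a"
proof -
  have "(\<Sum>c\<in>I. (if c = a then y else 0) *\<^sub>R c) = (\<Sum>c\<in>I. if c = a then y *\<^sub>R c else 0)"
    by (rule sum.cong) auto
  then show ?thesis using assms finite_I by simp
qed

text \<open>A positive root supported on one simple root is a nonnegative multiple of it, and
  reducedness leaves only the multiple 1.\<close>

lemma Sp_single:
  assumes "d \<in> Sp" "a \<in> I" "d = (\<Sum>i\<in>I. real (n i) *\<^sub>R i)" "\<And>i. i \<in> I \<Longrightarrow> i \<noteq> a \<Longrightarrow> n i = 0"
  shows "d = a"
proof -
  have "d = (\<Sum>i\<in>I. (if i = a then real (n a) else 0) *\<^sub>R i)"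
    unfolding assms(3) by (rule sum.cong) (auto simp: assms(4))
  then have da: "d = real (n a) *\<^sub>R a" by (simp only: sum_I_single[OF assms(2)])
  then have "real (n a) *\<^sub>R fst a \<in> R" "fst a \<in> R"
    using Sp_Sg[OF assms(1)] I_Sg[OF assms(2)] by (auto simp: Sg_iff)
  then have "real (n a) = 1" using reduced by fastforce
  then show ?thesis using da by simp
qed

text \<open>\<open>pull (refl a) b\<close> differs from \<open>b\<close> only in the coefficient of
  \<open>a\<close>. Were it negative, all other coefficients of \<open>b\<close> would vanish,
  forcing \<open>b = a\<close>.\<close>

lemma simple_refl_pos:
  assumes a: "a \<in> I" and b: "b \<in> Sp" and "b \<noteq> a"
  shows "pull (refl a) b \<in> Sp"
proof (rule ccontr)
  assume "pull (refl a) b \<notin> Sp"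
  moreover have "pull (refl a) b \<in> Sg" using a b by (intro pull_Sg refl_W I_Sg Sp_Sg)
  ultimately have "- pull (refl a) b \<in> Sp" using Sg_cases by blast
  then obtain m where m: "- pull (refl a) b = (\<Sum>c\<in>I. real (m c) *\<^sub>R c)"
    by (auto simp: Sp_iff nat_combination_def)
  obtain n where n: "b = (\<Sum>c\<in>I. real (n c) *\<^sub>R c)" using b by (auto simp: Sp_iff nat_combination_def)
  let ?z = "fst b \<bullet> coroot (fst a)"
  have "(\<Sum>c\<in>I. (real (n c) + real (m c)) *\<^sub>R c) = b - pull (refl a) b"
    by (subst n, subst diff_conv_add_uminus, subst m) (simp add: scaleR_add_left sum.distrib)
  also have "\<dots> = (\<Sum>c\<in>I. (if c = a then ?z else 0) *\<^sub>R c)" by (simp add: pull_refl sum_I_single[OF a])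
  finally have "real (n c) + real (m c) = (if c = a then ?z else 0)" if "c \<in> I" for c
    using I_coeffs_unique[OF _ that, of "\<lambda>c. real (n c) + real (m c)" "\<lambda>c. if c = a then ?z else 0"] by simp
  then have nc: "n c = 0" if "c \<in> I" "c \<noteq> a" for c using that by fastforce
  have "b = a" using Sp_single[OF b a n nc] .
  then show False using \<open>b \<noteq> a\<close> by simp
qed

section \<open>The affine Weyl group as a Coxeter group\<close>

text \<open>The first letter acts first: \<open>word [a, b]\<close> is $s_b s_a$.\<close>

primrec word :: "('v \<times> real) list \<Rightarrow> 'v \<Rightarrow> 'v" where
  "word [] = id"
| "word (c # cs) = word cs \<circ> refl c"

lemma word_append: "word (as @ bs) = word bs \<circ> word as"
  by (induction as) (auto simp: comp_assoc)

lemma word_W: "set cs \<subseteq> I \<Longrightarrow> word cs \<in> W"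
  by (induction cs) (auto intro: weyl.weyl_id weyl_comp refl_W I_Sg)

text \<open>Expand \<open>fst b \<bullet> fst b > 0\<close> in the simple roots: some term must be
  positive.\<close>

lemma Sp_coeffs_inner:
  assumes "b = (\<Sum>i\<in>I. real (c i) *\<^sub>R i)" "fst b \<noteq> 0"
  shows "\<exists>a\<in>I. fst b \<bullet> fst a > 0"
proof (rule ccontr)
  assume *: "\<not> ?thesis"
  have "fst b \<bullet> fst b = (\<Sum>i\<in>I. real (c i) * (fst b \<bullet> fst i))"
    by (subst (2) assms(1)) (simp add: fst_sum inner_sum_right)
  also have "\<dots> \<le> 0" using * by (intro sum_nonpos) (auto simp: not_less intro: mult_nonneg_nonpos)
  finally show False using assms(2) by (metis inner_gt_zero_iff not_less)
qed

text \<open>Induction on the height: a positive root $b$ that is not simple has positive inner product with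
  some simple root $a$, and then $s_a b$ is positive and of smaller height.\<close>

lemma refl_word_aux:
  assumes "b \<in> Sp" "b = (\<Sum>i\<in>I. real (c i) *\<^sub>R i)"
  shows "\<exists>cs. set cs \<subseteq> I \<and> refl b = word cs"
  using assms
proof (induction "\<Sum>i\<in>I. c i" arbitrary: b c rule: less_induct)
  case less
  show ?case
  proof (cases "b \<in> I")
    case True
    then show ?thesis by (intro exI[of _ "[b]"]) auto
  next
    case False
    obtain a where a: "a \<in> I" "fst b \<bullet> fst a > 0"
      using Sp_coeffs_inner[OF less.prems(2)] Sg_nonzero Sp_Sg less.prems(1) by blast
    let ?b = "pull (refl a) b"
    let ?z = "fst b \<bullet> coroot (fst a)"
    have ba: "b \<noteq> a" using False a by blast
    have b': "?b \<in> Sp" by (rule simple_refl_pos[OF a(1) less.prems(1) ba])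
    have z: "?z > 0" using a Sg_nonzero[OF I_Sg[OF a(1)]] by (simp add: coroot_def)
    obtain c' where c': "?b = (\<Sum>i\<in>I. real (c' i) *\<^sub>R i)"
      using b' by (auto simp: Sp_iff nat_combination_def)
    have "(\<Sum>i\<in>I. (real (c i) - (if i = a then ?z else 0)) *\<^sub>R i)
        = (\<Sum>i\<in>I. real (c i) *\<^sub>R i) - (\<Sum>i\<in>I. (if i = a then ?z else 0) *\<^sub>R i)"
      by (simp only: scaleR_diff_left sum_subtractf)
    also have "\<dots> = (\<Sum>i\<in>I. real (c' i) *\<^sub>R i)"
      unfolding sum_I_single[OF a(1)] less.prems(2)[symmetric] c'[symmetric] by (simp add: pull_refl)
    finally have eq: "real (c i) - (if i = a then ?z else 0) = real (c' i)" if "i \<in> I" for i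
      using I_coeffs_unique[OF _ that, of "\<lambda>i. real (c i) - (if i = a then ?z else 0)" "\<lambda>i. real (c' i)"] by simp
    have "(\<Sum>i\<in>I. c' i) < (\<Sum>i\<in>I. c i)"
    proof (rule sum_strict_mono_ex1[OF finite_I])
      show "\<forall>i\<in>I. c' i \<le> c i"
      proof
        fix i assume "i \<in> I"
        then show "c' i \<le> c i" using eq[of i] z by (cases "i = a") auto
      qed
      show "\<exists>i\<in>I. c' i < c i" using eq[OF a(1)] z a(1) by (intro bexI[of _ a]) auto
    qed
    from less.hyps[OF this b' c'] obtain cs where cs: "set cs \<subseteq> I" "refl ?b = word cs" by blast
    have aS: "a \<in> Sg" and bS: "b \<in> Sg" using a I_Sg less.prems Sp_Sg by auto
    \<comment> \<open>Conjugation by \<open>refl a\<close> turns the word found for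
      \<open>?b\<close> into one for \<open>b\<close>.\<close>
    have "refl b (refl a x) = refl a (refl ?b x)" for x
      by (rule refl_conj[OF affine_isometry_refl[OF Sg_nonzero[OF aS]]])
         (rule aff_pull[OF refl_W[OF aS] bS])
    from this[of "refl a _"] have "refl b x = refl a (refl ?b (refl a x))" for x
      using refl_refl[OF Sg_nonzero[OF aS]] by simp
    then have "refl b = word (a # cs @ [a])" by (auto simp: word_append cs(2))
    then show ?thesis using cs(1) a(1) by (intro exI[of _ "a # cs @ [a]"]) auto
  qed
qed

lemma refl_word:
  assumes "b \<in> Sg"
  shows "\<exists>cs. set cs \<subseteq> I \<and> refl b = word cs"
proof -
  have "\<exists>cs. set cs \<subseteq> I \<and> refl b = word cs" if "b \<in> Sp" for b
    using refl_word_aux[OF that] that by (auto simp: Sp_iff nat_combination_def)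
  from this[of b] this[of "- b"] show ?thesis using Sg_cases[OF assms] by (auto simp: refl_uminus)
qed

lemma weyl_word: "w \<in> W \<Longrightarrow> \<exists>cs. set cs \<subseteq> I \<and> w = word cs"
proof (induction rule: weyl.induct)
  case weyl_id
  then show ?case by (intro exI[of _ "[]"]) auto
next
  case (weyl_refl a w)
  then obtain cs cs' where "set cs \<subseteq> I" "w = word cs" "set cs' \<subseteq> I" "refl a = word cs'"
    using refl_word by metis
  then show ?case by (intro exI[of _ "cs @ cs'"]) (auto simp: word_append)
qed

text \<open>Pulling \<open>a\<close> back through the word letter by letter, from the last to the
  first, leads from a positive root to one that is not. Where the sign changes,
  \<open>simple_refl_pos\<close> forces the current root to be the letter itself, and by conjugation
  \<open>refl a\<close> cancels that letter.\<close>

lemma exchange: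
  assumes "set cs \<subseteq> I" "a \<in> I" "pull (word cs) a \<notin> Sp"
  shows "\<exists>cs'. set cs' \<subseteq> I \<and> length cs = Suc (length cs') \<and> refl a \<circ> word cs = word cs'"
  using assms
proof (induction cs)
  case Nil
  then show ?case using I_Sp[OF Nil.prems(2)] unfolding word.simps pull_id by blast
next
  case (Cons c cs)
  have c: "c \<in> I" and cs: "set cs \<subseteq> I" using Cons.prems by auto
  have w: "word cs \<in> W" by (rule word_W[OF cs])
  note aS = I_Sg[OF Cons.prems(2)]
  show ?case
  proof (cases "pull (word cs) a \<in> Sp")
    case False
    then obtain cs' where cs': "set cs' \<subseteq> I" "length cs = Suc (length cs')" "refl a \<circ> word cs = word cs'"
      using Cons.IH[OF cs Cons.prems(2)] by blast
    have "refl a \<circ> word (c # cs) = word (c # cs')"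
      unfolding word.simps cs'(3)[symmetric] comp_assoc ..
    moreover have "set (c # cs') \<subseteq> I" "length (c # cs) = Suc (length (c # cs'))" using c cs' by simp_all
    ultimately show ?thesis by blast
  next
    case True
    have "pull (refl c) (pull (word cs) a) \<notin> Sp"
      using Cons.prems(3) unfolding word.simps pull_comp[OF w refl_W[OF I_Sg[OF c]] aS] .
    then have eq: "pull (word cs) a = c" using simple_refl_pos[OF c True] by blast
    obtain L where L: "affine_isometry (word cs) L" using weyl_affine[OF w] by blast
    have "refl a (word cs x) = word cs (refl c x)" for x
      by (rule refl_conj[OF L]) (use aff_pull[OF w aS] eq in simp)
    then have "(refl a \<circ> word (c # cs)) x = word cs x" for x
      using refl_refl[OF Sg_nonzero[OF I_Sg[OF c]]] by simp
    then show ?thesis using cs by (intro exI[of _ cs]) auto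
  qed
qed

text \<open>Let $a$ be the last letter of a shortest word for $w$. By the exchange property $w^{-1} a$ is
  negative, so $a(wv) = 0$ and $a$ can be split off.\<close>

lemma fundamental_domain:
  assumes "w \<in> W" "v \<in> Cbar" "w v \<in> Cbar"
  shows "w v = v \<and> (\<exists>cs. set cs \<subseteq> {a \<in> I. aff a v = 0} \<and> w = word cs)"
proof -
  have *: "w v = v \<and> (\<exists>cs. set cs \<subseteq> {a \<in> I. aff a v = 0} \<and> w = word cs)"
    if "set as \<subseteq> I" "w = word as" "w v \<in> Cbar" for as w
    using that
  proof (induction "length as" arbitrary: as w rule: less_induct)
    case less
    show ?case
    proof (cases as rule: rev_cases)
      case Nil
      then show ?thesis using less.prems by (intro conjI exI[of _ "[]"]) auto
    next
      case (snoc cs a)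
      have a: "a \<in> I" and cs: "set cs \<subseteq> I" using less.prems snoc by auto
      have wW: "word cs \<in> W" "refl a \<in> W" and aS: "a \<in> Sg" using word_W cs refl_W I_Sg a by auto
      have w: "w = refl a \<circ> word cs" using less.prems snoc by (simp add: word_append)
      show ?thesis
      proof (cases "pull (word cs) a \<in> Sp")
        \<comment> \<open>The word is not reduced: exchange replaces it by one that is two letters
          shorter.\<close>
        case False
        then obtain cs' where "set cs' \<subseteq> I" "length cs = Suc (length cs')" "refl a \<circ> word cs = word cs'"
          using exchange[OF cs a] by blast
        then show ?thesis using less.hyps[of cs' w] less.prems w snoc by simp
      next
        case True
        \<comment> \<open>The last letter reverses the sign of \<open>a\<close>. As \<open>v\<close>
          and \<open>w v\<close> both lie in the closed alcove, the two sides have opposite signs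
          and vanish.\<close>
        have "aff a (w v) = - aff (pull (word cs) a) v"
          using w aff_pull[OF wW(1) aS] inner_coroot[OF Sg_nonzero[OF aS]] by (simp add: aff_refl)
        moreover have "aff (pull (word cs) a) v \<ge> 0" using Sp_nonneg[OF True] assms(2) by (auto simp: Cbar_iff)
        moreover have "aff a (w v) \<ge> 0" using less.prems(3) a by (auto simp: Cbar_iff)
        ultimately have 0: "aff a (w v) = 0" by linarith
        have "word cs v = refl a (w v)" using w refl_refl[OF Sg_nonzero[OF aS]] by simp
        then have wc: "word cs v = w v" using refl_fixes[OF 0] by simp
        then have "word cs v = v \<and> (\<exists>cs'. set cs' \<subseteq> {a \<in> I. aff a v = 0} \<and> word cs = word cs')"
          using less.hyps[of cs "word cs"] cs snoc less.prems(3) by simp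
        then obtain cs' where "word cs v = v" "set cs' \<subseteq> {a \<in> I. aff a v = 0}" "word cs = word cs'" by blast
        then show ?thesis using a 0 wc w
          by (intro conjI exI[of _ "cs' @ [a]"]) (auto simp: word_append)
      qed
    qed
  qed
  then show ?thesis using weyl_word[OF assms(1)] assms(3) by blast
qed

section \<open>Local finiteness of the hyperplane arrangement\<close>

lemma finite_Sg_bounded: "finite {a \<in> Sg. \<bar>snd a\<bar> \<le> M}"
proof (rule finite_subset)
  show "{a \<in> Sg. \<bar>snd a\<bar> \<le> M} \<subseteq> R \<times> (of_int ` {\<lfloor>- M\<rfloor>..\<lceil>M\<rceil>})"
  proof
    fix a assume a: "a \<in> {a \<in> Sg. \<bar>snd a\<bar> \<le> M}"
    then obtain z where z: "snd a = of_int z" by (auto simp: Sg_iff elim: Ints_cases)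
    with a have "\<bar>real_of_int z\<bar> \<le> M" by auto
    then have "z \<in> {\<lfloor>- M\<rfloor>..\<lceil>M\<rceil>}" by (auto simp: floor_le_iff le_ceiling_iff)
    then show "a \<in> R \<times> (of_int ` {\<lfloor>- M\<rfloor>..\<lceil>M\<rceil>})" using a z by (auto simp: Sg_iff mem_Times_iff)
  qed
qed (use finite_R in auto)

lemma inner_R_le: "\<alpha> \<in> R \<Longrightarrow> \<bar>\<alpha> \<bullet> x\<bar> \<le> (\<Sum>\<alpha>\<in>R. norm \<alpha>) * norm x"
  by (rule order_trans[OF Cauchy_Schwarz_ineq2])
     (auto intro!: mult_right_mono member_le_sum finite_R)

lemma finite_Sg_small: "finite {a \<in> Sg. \<bar>aff a x\<bar> < K}"
  by (rule finite_subset[OF _ finite_Sg_bounded[of "K + (\<Sum>\<alpha>\<in>R. norm \<alpha>) * norm x"]])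
     (use inner_R_le[of _ x] in \<open>fastforce simp: aff_def Sg_iff\<close>)

text \<open>These roots index the hyperplanes that strictly separate \<open>x\<close> from
  \<open>Cp\<close>; their number measures how far \<open>x\<close> is from the closed
  alcove.\<close>

definition neg_roots :: "'v \<Rightarrow> ('v \<times> real) set" where
  "neg_roots x = {b \<in> Sp. aff b x < 0}"

text \<open>The constant part of a positive root is its coefficient at the affine simple root, hence
  nonnegative. Negativity at \<open>x\<close> bounds it from above.\<close>

lemma finite_neg_roots: "finite (neg_roots x)"
proof (rule finite_subset)
  show "neg_roots x \<subseteq> {a \<in> Sg. \<bar>snd a\<bar> \<le> (\<Sum>\<alpha>\<in>R. norm \<alpha>) * norm x}"
  proof
    fix b assume b: "b \<in> neg_roots x"
    then obtain c where c: "b = (\<Sum>i\<in>I. real (c i) *\<^sub>R i)" by (auto simp: neg_roots_def Sp_iff nat_combination_def)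
    have "snd b \<ge> 0" by (subst c) (auto simp: snd_sum simple_aff_roots_def intro!: sum_nonneg)
    then show "b \<in> {a \<in> Sg. \<bar>snd a\<bar> \<le> (\<Sum>\<alpha>\<in>R. norm \<alpha>) * norm x}"
      using b inner_R_le[of "fst b" x] by (auto simp: neg_roots_def aff_def Sp_iff Sg_iff)
  qed
qed (rule finite_Sg_bounded)

text \<open>\<open>pull (refl a)\<close> permutes the positive roots other than \<open>a\<close>. It
  thus embeds the separating roots of the reflected point into those of \<open>x\<close>, and
  \<open>a\<close> is missed.\<close>

lemma card_neg_roots_refl:
  assumes a: "a \<in> I" "aff a x < 0"
  shows "card (neg_roots (refl a x)) < card (neg_roots x)"
proof -
  have aS: "a \<in> Sg" "refl a \<in> W" using a I_Sg refl_W by auto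
  have "pull (refl a) ` neg_roots (refl a x) \<subseteq> neg_roots x - {a}"
  proof (intro image_subsetI)
    fix b assume b: "b \<in> neg_roots (refl a x)"
    then have bS: "b \<in> Sp" "b \<in> Sg" "aff b (refl a x) < 0" by (auto simp: neg_roots_def Sp_Sg)
    have "b \<noteq> a"
      using bS(3) a(2) inner_coroot[OF Sg_nonzero[OF aS(1)]] by (auto simp: aff_refl)
    then have "pull (refl a) b \<in> Sp" using simple_refl_pos[OF a(1) bS(1)] by blast
    moreover have "aff (pull (refl a) b) x < 0" using aff_pull[OF aS(2) bS(2)] bS(3) by simp
    moreover have "pull (refl a) b \<noteq> a"
    proof
      assume "pull (refl a) b = a"
      then have "b = - a" using pull_refl_refl[OF aS(1), of b] pull_refl_self[OF aS(1)] by simp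
      then show False using Sp_not_uminus[OF I_Sp[OF a(1)]] bS(1) by simp
    qed
    ultimately show "pull (refl a) b \<in> neg_roots x - {a}" by (auto simp: neg_roots_def)
  qed
  then have "card (pull (refl a) ` neg_roots (refl a x)) \<le> card (neg_roots x - {a})"
    by (intro card_mono) (auto simp: finite_neg_roots)
  moreover have "card (pull (refl a) ` neg_roots (refl a x)) = card (neg_roots (refl a x))"
    by (rule card_image) (metis inj_onI pull_refl_refl[OF aS(1)])
  moreover have "card (neg_roots x - {a}) < card (neg_roots x)"
    by (rule card_Diff1_less[OF finite_neg_roots]) (use a I_Sp[OF a(1)] in \<open>simp add: neg_roots_def\<close>)
  ultimately show ?thesis by linarith
qed

lemma ex_weyl_Cbar: "\<exists>w\<in>W. w x \<in> Cbar"
proof (induction "card (neg_roots x)" arbitrary: x rule: less_induct)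
  case less
  show ?case
  proof (cases "x \<in> Cbar")
    case True
    then show ?thesis using weyl.weyl_id by (metis id_apply)
  next
    case False
    then obtain a where a: "a \<in> I" "aff a x < 0" by (auto simp: Cbar_iff not_le)
    obtain w where "w \<in> W" "w (refl a x) \<in> Cbar" using less[OF card_neg_roots_refl[OF a]] by blast
    then show ?thesis using weyl_comp[OF _ refl_W[OF I_Sg[OF a(1)]]] by (intro bexI[of _ "w \<circ> refl a"]) auto
  qed
qed

text \<open>All these $w$ agree at $x$, hence are determined by their linear parts, which permute $R$.\<close>

lemma finite_weyl_Cbar: "finite {w \<in> W. w x \<in> Cbar}"
proof (cases "{w \<in> W. w x \<in> Cbar} = {}")
  case False
  then obtain w0 where w0: "w0 \<in> W" "w0 x \<in> Cbar" by blast
  have fixed: "w x = w0 x" if "w \<in> W" "w x \<in> Cbar" for w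
    using fundamental_domain[of "w \<circ> inv w0" "w0 x"] that w0 weyl_comp inv_W by simp
  define lin where "lin w = (\<lambda>v. w (x + v) - w x)" for w :: "'v \<Rightarrow> 'v"
  have lin: "linear (lin w)" and linR: "\<alpha> \<in> R \<Longrightarrow> lin w \<alpha> \<in> R" if w: "w \<in> W" for w \<alpha>
  proof -
    obtain L where L: "affine_isometry w L" using weyl_affine[OF w] by blast
    then have eq: "lin w = L" by (auto simp: lin_def affine_isometry_def)
    then show "linear (lin w)" using L by (simp add: affine_isometry_def)
    assume "\<alpha> \<in> R"
    then have aS: "(\<alpha>, 0) \<in> Sg" by (auto simp: Sg_iff)
    have "aff (\<alpha>, 0) y = aff (pull (inv w) (\<alpha>, 0)) (w y)" for y
      using aff_pull[OF inv_W[OF w] aS] w by simp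
    then have "L (fst (\<alpha>, 0::real)) = fst (pull (inv w) (\<alpha>, 0))" by (rule affine_isometry_gradient(1)[OF L])
    then show "lin w \<alpha> \<in> R" using pull_Sg[OF inv_W[OF w] aS] by (simp add: eq Sg_iff)
  qed
  have "inj_on (\<lambda>w. restrict (lin w) R) {w \<in> W. w x \<in> Cbar}"
  proof (rule inj_onI)
    fix w w' assume w: "w \<in> {w \<in> W. w x \<in> Cbar}" "w' \<in> {w \<in> W. w x \<in> Cbar}"
      and eq: "restrict (lin w) R = restrict (lin w') R"
    have "lin w \<alpha> = lin w' \<alpha>" if "\<alpha> \<in> R" for \<alpha> using fun_cong[OF eq, of \<alpha>] that by simp
    then have "lin w v = lin w' v" for v
      using linear_eq_on_span[of "lin w" "lin w'" R v] lin w span_R by auto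
    then have "w (x + v) = w' (x + v)" for v
      using fixed w by (simp add: lin_def) (metis diff_add_cancel)
    from this[of "_ - x"] show "w = w'" by auto
  qed
  moreover have "(\<lambda>w. restrict (lin w) R) ` {w \<in> W. w x \<in> Cbar} \<subseteq> R \<rightarrow>\<^sub>E R"
    using linR by auto
  moreover have "finite (R \<rightarrow>\<^sub>E R)" using finite_R by (intro finite_PiE) auto
  ultimately show ?thesis by (meson finite_imageD finite_subset)
next
  case True
  then show ?thesis by (simp only: finite.emptyI)
qed

text \<open>Only finitely many affine roots are smaller than 1 in absolute value at
  \<open>x\<close>, so the nonzero values are bounded away from 0; and all affine roots have the
  common Lipschitz constant \<open>N\<close>.\<close>

lemma sign_stable:
  "\<exists>\<delta>>0. \<forall>a\<in>Sg. aff a x \<noteq> 0 \<longrightarrow> (\<forall>y\<in>ball x \<delta>. aff a y * aff a x > 0)"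
proof -
  define N where "N = 1 + (\<Sum>\<alpha>\<in>R. norm \<alpha>)"
  have N: "N > 0" unfolding N_def by (intro add_pos_nonneg sum_nonneg) auto
  \<comment> \<open>The element 1 makes the set nonempty and covers the roots whose value at
    \<open>x\<close> is at least 1 in absolute value.\<close>
  define F where "F = insert 1 ((\<lambda>a. \<bar>aff a x\<bar>) ` {a \<in> Sg. aff a x \<noteq> 0 \<and> \<bar>aff a x\<bar> < 1})"
  have F: "finite F" unfolding F_def
    by (intro finite.insertI finite_imageI finite_subset[OF _ finite_Sg_small[of x 1]]) auto
  define e where "e = Min F"
  have e: "e > 0" unfolding e_def by (subst Min_gr_iff[OF F]) (auto simp: F_def)
  have e1: "e \<le> \<bar>aff a x\<bar>" if "a \<in> Sg" "aff a x \<noteq> 0" for a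
  proof (cases "\<bar>aff a x\<bar> < 1")
    case True
    then show ?thesis unfolding e_def using that by (intro Min_le[OF F]) (auto simp: F_def)
  next
    case False
    moreover have "e \<le> 1" unfolding e_def by (intro Min_le[OF F]) (auto simp: F_def)
    ultimately show ?thesis by linarith
  qed
  have "aff a y * aff a x > 0" if a: "a \<in> Sg" "aff a x \<noteq> 0" and y: "y \<in> ball x (e / N)" for a y
  proof -
    have "\<bar>fst a \<bullet> (y - x)\<bar> \<le> (\<Sum>\<alpha>\<in>R. norm \<alpha>) * norm (y - x)"
      using a by (intro inner_R_le) (auto simp: Sg_iff)
    also have "\<dots> \<le> N * norm (y - x)" by (intro mult_right_mono) (auto simp: N_def)
    also have "\<dots> < e" using y N by (simp add: dist_norm norm_minus_commute field_simps)
    also have "e \<le> \<bar>aff a x\<bar>" by (rule e1[OF a])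
    finally have "\<bar>aff a y - aff a x\<bar> < \<bar>aff a x\<bar>" by (simp add: aff_def inner_diff_right)
    then show ?thesis using a(2) by (auto simp: zero_less_mult_iff abs_if split: if_splits)
  qed
  then show ?thesis using e N by (intro exI[of _ "e / N"]) auto
qed

section \<open>Chambers and walls\<close>

lemma V_reg_iff: "x \<in> V_reg R B \<phi> \<longleftrightarrow> (\<forall>a\<in>Sg. aff a x \<noteq> 0)"
proof -
  have "x \<in> V_reg R B \<phi> \<longleftrightarrow> (\<forall>a\<in>Sp. aff a x \<noteq> 0)" by (auto simp: V_reg_def hyperplane_def)
  also have "\<dots> \<longleftrightarrow> (\<forall>a\<in>Sg. aff a x \<noteq> 0)"
    using Sg_cases Sp_Sg by (metis aff_simps(1) neg_equal_0_iff_equal)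
  finally show ?thesis .
qed

lemma V_reg_weyl_imp: "w \<in> W \<Longrightarrow> x \<in> V_reg R B \<phi> \<Longrightarrow> w x \<in> V_reg R B \<phi>"
  unfolding V_reg_iff by (metis aff_pull pull_Sg)

lemma V_reg_weyl: "w \<in> W \<Longrightarrow> w x \<in> V_reg R B \<phi> \<longleftrightarrow> x \<in> V_reg R B \<phi>"
  using V_reg_weyl_imp inv_W inv_weyl(1) by metis

lemma Cp_V_reg: "x \<in> Cp \<Longrightarrow> x \<in> V_reg R B \<phi>"
  unfolding V_reg_iff using Sp_pos_on_Cp Sg_cases by (metis aff_simps(1) less_irrefl neg_equal_0_iff_equal)

lemma Cp_Cbar: "x \<in> Cp \<Longrightarrow> x \<in> Cbar"
  using closure_subset by blast

lemma V_reg_ex_Cp: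
  assumes "x \<in> V_reg R B \<phi>"
  shows "\<exists>w\<in>W. w x \<in> Cp"
proof -
  obtain w where w: "w \<in> W" "w x \<in> Cbar" using ex_weyl_Cbar by blast
  have "w x \<in> V_reg R B \<phi>" using V_reg_weyl[OF w(1)] assms by blast
  then have "w x \<in> Cp" using w(2) I_Sg unfolding V_reg_iff Cbar_iff Cp_iff
    by (metis order_less_le)
  then show ?thesis using w by blast
qed

lemma open_V_reg: "open (V_reg R B \<phi>)"
  unfolding open_contains_ball
proof
  fix x assume x: "x \<in> V_reg R B \<phi>"
  obtain \<delta> where \<delta>: "\<delta> > 0" "\<And>a y. a \<in> Sg \<Longrightarrow> aff a x \<noteq> 0 \<Longrightarrow> y \<in> ball x \<delta> \<Longrightarrow> aff a y * aff a x > 0"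
    using sign_stable[of x] by blast
  have "ball x \<delta> \<subseteq> V_reg R B \<phi>"
    unfolding V_reg_iff[abs_def] subset_iff using \<delta>(2) x V_reg_iff by (metis less_irrefl mult_zero_left)
  then show "\<exists>e>0. ball x e \<subseteq> V_reg R B \<phi>" using \<delta>(1) by blast
qed

text \<open>The alcove \<open>w^{-1} C_+\<close>. The inverse matches the convention in
  \<open>T_op\<close>, so that on \<open>chamber w\<close> the propagated function is
  \<open>QW w f\<close> composed with \<open>w\<close>.\<close>

definition chamber :: "('v \<Rightarrow> 'v) \<Rightarrow> 'v set" where
  "chamber w = {y. w y \<in> Cp}"

lemma chamber_iff: "w \<in> W \<Longrightarrow> y \<in> chamber w \<longleftrightarrow> (\<forall>a\<in>I. aff (pull w a) y > 0)"
  by (auto simp: chamber_def Cp_iff aff_pull I_Sg)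

lemma chamber_eq: "w \<in> W \<Longrightarrow> chamber w = (\<Inter>a\<in>I. {y. fst (pull w a) \<bullet> y > - snd (pull w a)})"
proof -
  have "aff p y > 0 \<longleftrightarrow> fst p \<bullet> y > - snd p" for p :: "'v \<times> real" and y
    unfolding aff_def by linarith
  then show "w \<in> W \<Longrightarrow> ?thesis" by (simp add: set_eq_iff chamber_iff)
qed

lemma open_chamber: "w \<in> W \<Longrightarrow> open (chamber w)"
  unfolding chamber_eq using finite_I by (intro open_INT ballI open_halfspace_gt) auto

lemma convex_chamber: "w \<in> W \<Longrightarrow> convex (chamber w)"
  unfolding chamber_eq by (intro convex_INT convex_halfspace_gt)

lemma chamber_V_reg: "w \<in> W \<Longrightarrow> chamber w \<subseteq> V_reg R B \<phi>"
  using Cp_V_reg V_reg_weyl by (auto simp: chamber_def)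

lemma chamber_nonempty: "w \<in> W \<Longrightarrow> chamber w \<noteq> {}"
proof -
  assume w: "w \<in> W"
  obtain p where "p \<in> Cp" using Cp_nonempty by blast
  then have "inv w p \<in> chamber w" using w by (simp add: chamber_def)
  then show ?thesis by blast
qed

text \<open>A chamber is convex, hence contained in a component. Conversely, by the intermediate
  value theorem a pulled-back simple root cannot change its sign on a connected subset of
  \<open>V_reg\<close>.\<close>

lemma chamber_component:
  assumes w: "w \<in> W" and x: "x \<in> chamber w"
  shows "connected_component_set (V_reg R B \<phi>) x = chamber w"
proof
  show "chamber w \<subseteq> connected_component_set (V_reg R B \<phi>) x"
    by (rule connected_component_maximal[OF x convex_connected[OF convex_chamber[OF w]] chamber_V_reg[OF w]])
  let ?K = "connected_component_set (V_reg R B \<phi>) x"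
  have xK: "x \<in> ?K" using x chamber_V_reg[OF w] by auto
  have KV: "?K \<subseteq> V_reg R B \<phi>" by (rule connected_component_subset)
  show "?K \<subseteq> chamber w"
  proof
    fix y assume y: "y \<in> ?K"
    have "aff (pull w a) y > 0" if a: "a \<in> I" for a
    proof (rule ccontr)
      assume *: "\<not> aff (pull w a) y > 0"
      have con: "connected ((\<lambda>y. aff (pull w a) y) ` ?K)"
        unfolding aff_def by (intro connected_continuous_image continuous_intros connected_connected_component)
      have "aff (pull w a) x > 0" using x a w by (simp add: chamber_iff)
      then have "0 \<in> (\<lambda>y. aff (pull w a) y) ` ?K"
        using * by (intro connectedD_interval[OF con imageI[OF y] imageI[OF xK]]) auto
      then obtain z where z: "z \<in> ?K" "aff (pull w a) z = 0" by (metis imageE)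
      have "z \<in> V_reg R B \<phi>" using z(1) KV by (rule subsetD[rotated])
      then show False using pull_Sg[OF w I_Sg[OF a]] z(2) unfolding V_reg_iff by simp
    qed
    then show "y \<in> chamber w" using w by (simp add: chamber_iff)
  qed
qed

lemma alcoves_eq: "alcoves R B \<phi> = chamber ` W"
proof (intro equalityI subsetI)
  fix C assume "C \<in> alcoves R B \<phi>"
  then have "C \<in> connected_component_set (V_reg R B \<phi>) ` V_reg R B \<phi>"
    unfolding alcoves_def components_def .
  then obtain x where x: "C = connected_component_set (V_reg R B \<phi>) x" "x \<in> V_reg R B \<phi>"
    by (rule imageE)
  obtain w where w: "w \<in> W" "w x \<in> Cp" using V_reg_ex_Cp[OF x(2)] by blast
  then have xw: "x \<in> chamber w" by (simp add: chamber_def)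
  show "C \<in> chamber ` W" unfolding x(1) chamber_component[OF w(1) xw] using w(1) by (rule imageI)
next
  fix C assume "C \<in> chamber ` W"
  then obtain w where w: "C = chamber w" "w \<in> W" by (rule imageE)
  obtain x where x: "x \<in> chamber w" using chamber_nonempty[OF w(2)] by blast
  have "connected_component_set (V_reg R B \<phi>) x \<in> alcoves R B \<phi>"
    unfolding alcoves_def components_def by (rule imageI) (rule subsetD[OF chamber_V_reg[OF w(2)] x])
  then show "C \<in> alcoves R B \<phi>" unfolding chamber_component[OF w(2) x] w(1) .
qed

section \<open>Facets and sub-regular points\<close>

definition wall_point :: "'v \<times> real \<Rightarrow> 'v \<Rightarrow> bool" where
  "wall_point a p \<longleftrightarrow> aff a p = 0 \<and> (\<forall>c\<in>I. c \<noteq> a \<longrightarrow> aff c p > 0)"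

text \<open>Near \<open>v\<close> the other simple roots keep their signs, both at
  \<open>w y\<close> and at its mirror image, because the reflection fixes \<open>w v\<close>. The
  sign of \<open>a\<close> alone decides the chamber.\<close>

lemma wall_point_sides:
  assumes w: "w \<in> W" and a: "a \<in> I" and v: "wall_point a (w v)"
  shows "\<exists>\<delta>>0. \<forall>y\<in>ball v \<delta>. (aff a (w y) > 0 \<longrightarrow> w y \<in> Cp) \<and> (aff a (w y) < 0 \<longrightarrow> refl a (w y) \<in> Cp) \<and>
    (aff a (w y) = 0 \<longrightarrow> wall_point a (w y))"
proof -
  have aS: "a \<in> Sg" "refl a \<in> W" using a I_Sg refl_W by auto
  obtain \<delta> where \<delta>: "\<delta> > 0" "\<And>a y. a \<in> Sg \<Longrightarrow> aff a v \<noteq> 0 \<Longrightarrow> y \<in> ball v \<delta> \<Longrightarrow> aff a y * aff a v > 0"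
    using sign_stable[of v] by blast
  have pos: "aff c (u y) > 0" if "u \<in> W" "c \<in> Sg" "aff c (u v) > 0" "y \<in> ball v \<delta>" for u c y
    using \<delta>(2)[OF pull_Sg[OF that(1,2)] _ that(4)] that by (simp add: aff_pull zero_less_mult_iff)
  have c1: "aff c (w y) > 0" if "c \<in> I" "c \<noteq> a" "y \<in> ball v \<delta>" for c y
    using pos[OF w I_Sg[OF that(1)]] v that by (auto simp: wall_point_def)
  have "refl a (w v) = w v" using v by (simp add: wall_point_def refl_fixes)
  then have c2: "aff c (refl a (w y)) > 0" if "c \<in> I" "c \<noteq> a" "y \<in> ball v \<delta>" for c y
    using pos[OF weyl_comp[OF aS(2) w] I_Sg[OF that(1)]] v that by (auto simp: wall_point_def)
  have c3: "aff a (refl a (w y)) = - aff a (w y)" for y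
    using inner_coroot[OF Sg_nonzero[OF aS(1)]] by (simp add: aff_refl)
  show ?thesis
  proof (intro exI conjI ballI impI)
    fix y assume y: "y \<in> ball v \<delta>"
    show "w y \<in> Cp" if "aff a (w y) > 0" using c1[OF _ _ y] that by (metis Cp_iff)
    show "refl a (w y) \<in> Cp" if "aff a (w y) < 0" using c2[OF _ _ y] c3[of y] that
      by (metis Cp_iff neg_0_less_iff_less)
    show "wall_point a (w y)" if "aff a (w y) = 0" using c1[OF _ _ y] that by (auto simp: wall_point_def)
  qed (rule \<delta>(1))
qed

text \<open>At \<open>p\<close> all terms of the expansion of \<open>d\<close> in simple roots are
  nonnegative. If they sum to 0, only the coefficient of \<open>a\<close> can survive.\<close>

lemma wall_point_Sp:
  assumes "wall_point a p" "a \<in> I" "d \<in> Sp" "aff d p = 0"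
  shows "d = a"
proof -
  obtain n where n: "d = (\<Sum>i\<in>I. real (n i) *\<^sub>R i)" using assms(3) by (auto simp: Sp_iff nat_combination_def)
  have nn: "real (n i) * aff i p \<ge> 0" if "i \<in> I" for i
    using assms(1) that by (cases "i = a") (auto simp: wall_point_def less_imp_le)
  have "(\<Sum>i\<in>I. real (n i) * aff i p) = 0" using assms(4) unfolding n aff_sum .
  then have "real (n i) * aff i p = 0" if "i \<in> I" for i
    using sum_nonneg_eq_0_iff[OF finite_I, of "\<lambda>i. real (n i) * aff i p"] nn that by blast
  then have "n i = 0" if "i \<in> I" "i \<noteq> a" for i
    using assms(1) that unfolding wall_point_def by fastforce
  then show ?thesis using Sp_single[OF assms(3,2) n] by blast
qed

text \<open>Transporting a root that vanishes at \<open>v\<close> to the alcove by \<open>w\<close>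
  reduces the claim to \<open>wall_point_Sp\<close>. The sign of \<open>b\<close> is left open
  because \<open>pull w a\<close> may be a negative root.\<close>

lemma wall_point_subregular:
  assumes w: "w \<in> W" and a: "a \<in> I" and v: "wall_point a (w v)" and b: "b \<in> Sp" "b = pull w a \<or> b = - pull w a"
  shows "subregular R B \<phi> b v"
  unfolding subregular_def
proof (intro conjI ballI impI)
  have aS: "a \<in> Sg" using a I_Sg by blast
  have "aff (pull w a) v = 0" using v by (simp add: wall_point_def aff_pull[OF w aS])
  with b(2) have "aff b v = 0" by (elim disjE) simp_all
  then show "v \<in> hyperplane b" by (simp add: hyperplane_def)
  fix c assume c: "c \<in> Sp" "c \<noteq> b"
  show "v \<notin> hyperplane c"
  proof
    assume "v \<in> hyperplane c"
    then have cv: "aff c v = 0" by (simp add: hyperplane_def)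
    have cS: "c \<in> Sg" using c Sp_Sg by blast
    define c' where "c' = pull (inv w) c"
    have c'S: "c' \<in> Sg" unfolding c'_def using pull_Sg[OF inv_W[OF w] cS] .
    have c'0: "aff c' (w v) = 0" using aff_pull[OF inv_W[OF w] cS] w cv by (simp add: c'_def)
    have c'a: "c' = a \<or> c' = - a"
      using Sg_cases[OF c'S]
    proof
      assume "c' \<in> Sp"
      then show ?thesis using wall_point_Sp[OF v a _ c'0] by blast
    next
      assume "- c' \<in> Sp"
      then have "- c' = a" using wall_point_Sp[OF v a, of "- c'"] c'0 by simp
      then show ?thesis by auto
    qed
    have cc': "pull w c' = c" unfolding c'_def
      by (rule pull_eqI) (simp add: aff_pull[OF inv_W[OF w] cS] w)
    have "c = pull w a \<or> c = - pull w a"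
      using c'a unfolding cc'[symmetric] by (elim disjE) (simp_all add: pull_uminus[OF w aS])
    with b(2) c(2) have "c = - b" by (elim disjE) simp_all
    then show False using Sp_not_uminus[OF b(1)] c by simp
  qed
qed

text \<open>Move \<open>v\<close> into the closed alcove. The transported reflection in
  \<open>b\<close> fixes the image of \<open>v\<close>, so by \<open>fundamental_domain\<close> it
  is a word in simple reflections through that point; sub-regularity leaves room for just one of
  them.\<close>

lemma subregular_wall_point:
  assumes b: "b \<in> Sp" and v: "subregular R B \<phi> b v"
  shows "\<exists>w\<in>W. \<exists>a\<in>I. pull w a = b \<and> wall_point a (w v)"
proof -
  have bS: "b \<in> Sg" using b Sp_Sg by blast
  have bv: "aff b v = 0" using v by (simp add: subregular_def hyperplane_def)
  have uniq: "c = b \<or> c = - b" if "c \<in> Sg" "aff c v = 0" for c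
  proof -
    have *: "d = b" if "d \<in> Sp" "aff d v = 0" for d
      using v that by (auto simp: subregular_def hyperplane_def)
    from Sg_cases[OF that(1)] show ?thesis
    proof
      assume "- c \<in> Sp"
      then have "- c = b" using *[of "- c"] that(2) by simp
      then show ?thesis by auto
    qed (use * that(2) in blast)
  qed
  obtain w where w: "w \<in> W" "w v \<in> Cbar" using ex_weyl_Cbar by blast
  define b' where "b' = pull (inv w) b"
  have b'S: "b' \<in> Sg" unfolding b'_def using pull_Sg[OF inv_W[OF w(1)] bS] .
  have "aff b' (w v) = 0" using aff_pull[OF inv_W[OF w(1)] bS] w bv by (simp add: b'_def)
  then have "refl b' (w v) = w v" by (rule refl_fixes)
  then obtain cs where cs: "set cs \<subseteq> {a \<in> I. aff a (w v) = 0}" "refl b' = word cs"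
    using fundamental_domain[OF refl_W[OF b'S] w(2)] w(2) by auto
  \<comment> \<open>The word is nonempty since a reflection is not the identity; this supplies a
    simple root through \<open>w v\<close>.\<close>
  have "cs \<noteq> []"
  proof
    assume "cs = []"
    then have "aff b' (refl b' x) = aff b' x" for x using cs by simp
    then have "aff b' x = 0" for x using inner_coroot[OF Sg_nonzero[OF b'S]] by (simp add: aff_refl)
    then show False using Cp_nonempty Cp_V_reg b'S V_reg_iff by blast
  qed
  then obtain a where a: "a \<in> I" "aff a (w v) = 0" using cs(1) by (cases cs) auto
  have aS: "a \<in> Sg" using a I_Sg by blast
  have c0: "c = a" if c: "c \<in> I" "aff c (w v) = 0" for c
  proof -
    have cS: "c \<in> Sg" using c I_Sg by blast
    have "aff (pull w c) v = 0" "aff (pull w a) v = 0" using a c by (simp_all add: aff_pull[OF w(1)] cS aS)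
    then have "pull w c = b \<or> pull w c = - b" "pull w a = b \<or> pull w a = - b"
      using uniq pull_Sg[OF w(1)] cS aS by blast+
    then have "pull w c = pull w a \<or> pull w c = - pull w a" by (elim disjE) simp_all
    then have "pull w c = pull w a \<or> pull w c = pull w (- a)" unfolding pull_uminus[OF w(1) aS] .
    then have "c = a \<or> c = - a" using pull_inj[OF w(1) cS] aS Sg_uminus by blast
    then show ?thesis using Sp_not_uminus[OF I_Sp[OF a(1)]] I_Sp[OF c(1)] by (elim disjE) simp_all
  qed
  have wp: "wall_point a (w v)"
    unfolding wall_point_def using a w(2) c0 unfolding Cbar_iff by (metis order_less_le)
  have "aff (pull w a) v = 0" using a(2) by (simp add: aff_pull[OF w(1)] aS)
  then have "pull w a = b \<or> pull w a = - b" by (rule uniq[OF pull_Sg[OF w(1) aS]])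
  then show ?thesis
  proof
    \<comment> \<open>With the wrong sign, \<open>w\<close> is replaced by
      \<open>refl a \<circ> w\<close>, which has the same value at \<open>v\<close> and pulls
      \<open>a\<close> back to \<open>b\<close>.\<close>
    assume "pull w a = - b"
    then have "pull (refl a \<circ> w) a = b"
      using pull_comp[OF refl_W[OF aS] w(1) aS] pull_refl_self[OF aS] pull_uminus[OF w(1) aS] by simp
    moreover have "(refl a \<circ> w) v = w v" using a refl_fixes by simp
    moreover have "wall_point a ((refl a \<circ> w) v)" using wp \<open>(refl a \<circ> w) v = w v\<close> by (simp only:)
    ultimately show ?thesis using weyl_comp[OF refl_W[OF aS] w(1)] a(1) by blast
  qed (use wp w a in blast)
qed

end

section \<open>The integral-reflection operators preserve analyticity\<close>

lemma norm_interval_integral_le: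
  fixes g :: "real \<Rightarrow> complex"
  assumes g: "continuous_on UNIV g" and b: "\<And>t. t \<in> closed_segment 0 c \<Longrightarrow> norm (g t) \<le> Bd"
  shows "norm (LBINT t=0..ereal c. g t) \<le> \<bar>c\<bar> * Bd"
proof -
  have *: "norm (LBINT t=ereal x..ereal y. g t) \<le> Bd * (y - x)"
    if "x \<le> y" "\<And>t. t \<in> {x..y} \<Longrightarrow> norm (g t) \<le> Bd" for x y
  proof -
    have "(LBINT t=ereal x..ereal y. g t) = integral {x..y} g"
      using that(1) continuous_on_subset[OF g]
      by (intro interval_integral_eq_integral borel_integrable_atLeastAtMost') auto
    also have "norm \<dots> \<le> Bd * (y - x)"
      using that continuous_on_subset[OF g] by (intro integral_bound) auto
    finally show ?thesis .
  qed
  show ?thesis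
  proof (cases "c \<ge> 0")
    case True
    then show ?thesis using *[of 0 c] b by (simp add: closed_segment_eq_real_ivl zero_ereal_def mult.commute)
  next
    case False
    then have "norm (LBINT t=ereal c..ereal 0. g t) \<le> Bd * (0 - c)"
      using b by (intro *) (auto simp: closed_segment_eq_real_ivl)
    then show ?thesis using False
      by (subst interval_integral_endpoints_reverse) (simp add: zero_ereal_def mult.commute)
  qed
qed

text \<open>The reflected point is the end \<open>t = aff a y\<close> of the segment of integration,
  so one bound along the segment controls both terms.\<close>

lemma norm_Q_op_le:
  assumes g: "continuous_on UNIV g"
    and b: "\<And>t. t \<in> closed_segment 0 (aff a y) \<Longrightarrow> norm (g (y - t *\<^sub>R coroot (fst a))) \<le> Bd"
  shows "norm (Q_op k a g y) \<le> (1 + \<bar>k a\<bar> * \<bar>aff a y\<bar>) * Bd"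
proof -
  have "norm (LBINT t=0..aff a y. g (y - t *\<^sub>R coroot (fst a))) \<le> \<bar>aff a y\<bar> * Bd"
    by (intro norm_interval_integral_le b continuous_on_compose2[OF g] continuous_intros) auto
  then have "norm (of_real (k a) * (LBINT t=0..aff a y. g (y - t *\<^sub>R coroot (fst a)))) \<le> \<bar>k a\<bar> * (\<bar>aff a y\<bar> * Bd)"
    unfolding norm_mult norm_of_real by (intro mult_left_mono) auto
  moreover have "norm (g (refl a y)) \<le> Bd" unfolding refl_def by (rule b) auto
  ultimately show ?thesis unfolding Q_op_def
    by (intro norm_triangle_le) (simp add: algebra_simps)
qed

lemma Q_op_on_hyperplane: "aff a y = 0 \<Longrightarrow> Q_op k a g y = g y"
  by (simp add: Q_op_def refl_fixes zero_ereal_def)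

lemma refl_minus_functional: "\<alpha> \<noteq> 0 \<Longrightarrow> \<alpha> \<bullet> refl (\<alpha>, 0) v = - (\<alpha> \<bullet> v)"
  using inner_coroot[of \<alpha>] by (simp add: refl_def aff_def inner_diff_right)

lemma refl_coroot: "\<alpha> \<noteq> 0 \<Longrightarrow> refl (\<alpha>, 0) (coroot \<alpha>) = - coroot \<alpha>"
  using inner_coroot[of \<alpha>] by (simp add: refl_def aff_def scaleR_2)

lemma norm_refl_vec: "\<alpha> \<noteq> 0 \<Longrightarrow> norm (refl (\<alpha>, 0) v) = norm v"
  using affine_isometry_refl[of "(\<alpha>, 0)"] by (simp add: affine_isometry_def)

text \<open>The assumption \<open>comm\<close> is the cross relation. It makes differentiation under the integral sign
  superfluous: only the supremum of $Q_{k,a} g$ has to be estimated.\<close>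

lemma Q_op_cauchy_bound:
  assumes a: "fst a \<noteq> 0"
    and comm: "\<And>f v. f \<in> C_inf UNIV \<Longrightarrow> Q_op k a f \<in> C_inf UNIV \<and>
      dderiv v (Q_op k a f) = (\<lambda>x. Q_op k a (dderiv (refl (fst a, 0) v) f) x + of_real (k a * (fst a \<bullet> v)) * f x)"
    and f: "f \<in> C_inf UNIV" and C: "C \<ge> 0" and M: "M \<ge> 1"
    and K: "K \<ge> 1 + \<bar>k a\<bar> * \<bar>aff a y\<bar>"
    and b: "\<And>us t. t \<in> closed_segment 0 (aff a y) \<Longrightarrow>
       norm (dderivs us f (y - t *\<^sub>R coroot (fst a))) \<le> C * M ^ (length us + j) * fact (length us + j) * prod_list (map norm us)"
  shows "norm (dderivs vs (Q_op k a f) y) \<le>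
     C * (K + length vs * (\<bar>k a\<bar> * norm (fst a))) * M ^ (length vs + j) * fact (length vs + j) * prod_list (map norm vs)"
  using f C b
\<comment> \<open>A letter \<open>v\<close> replaces \<open>f\<close> by its derivative along the
  reflected direction: \<open>norm v\<close> moves into \<open>C\<close>, and \<open>j\<close>, the
  number of derivatives already inside \<open>Q_op\<close>, goes up by one.\<close>
proof (induction vs arbitrary: f C j)
  case Nil
  have "norm (Q_op k a f y) \<le> (1 + \<bar>k a\<bar> * \<bar>aff a y\<bar>) * (C * M ^ j * fact j)"
    by (rule norm_Q_op_le[OF C_inf_continuous[OF Nil.prems(1)]]) (use Nil.prems(3)[of _ "[]"] in simp)
  also have "\<dots> \<le> K * (C * M ^ j * fact j)"
    using K Nil.prems(2) M by (intro mult_right_mono) auto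
  finally show ?case by (simp add: mult_ac)
next
  case (Cons v vs)
  let ?s = "refl (fst a, 0)"
  let ?c = "\<bar>k a\<bar> * norm (fst a)"
  let ?n = "length vs"
  let ?P = "prod_list (map norm vs)"
  have "dderivs (v # vs) (Q_op k a f) y = dderivs vs (Q_op k a (dderiv (?s v) f)) y + of_real (k a * (fst a \<bullet> v)) * dderivs vs f y"
    using comm[OF Cons.prems(1), of v] comm[OF C_inf_dderiv[OF Cons.prems(1)], of "?s v"]
    by (simp add: dderivs_add dderivs_cmult C_inf_cmult Cons.prems(1))
  moreover have "norm (dderivs vs (Q_op k a (dderiv (?s v) f)) y) \<le>
     (C * norm v) * (K + ?n * ?c) * M ^ (?n + Suc j) * fact (?n + Suc j) * ?P"
  proof (rule Cons.IH)
    show "dderiv (?s v) f \<in> C_inf UNIV" by (rule C_inf_dderiv[OF Cons.prems(1)])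
    show "norm (dderivs us (dderiv (?s v) f) (y - t *\<^sub>R coroot (fst a)))
         \<le> C * norm v * M ^ (length us + Suc j) * fact (length us + Suc j) * prod_list (map norm us)"
      if "t \<in> closed_segment 0 (aff a y)" for us t
      using Cons.prems(3)[OF that, of "?s v # us"] by (simp add: norm_refl_vec[OF a] mult_ac)
  qed (use Cons.prems in auto)
  moreover have "norm (of_real (k a * (fst a \<bullet> v)) * dderivs vs f y) \<le>
     (C * norm v) * ?c * M ^ (?n + Suc j) * fact (?n + Suc j) * ?P"
  proof -
    have "\<bar>k a * (fst a \<bullet> v)\<bar> \<le> ?c * norm v"
      unfolding abs_mult mult.assoc by (intro mult_left_mono Cauchy_Schwarz_ineq2) auto
    moreover have "norm (dderivs vs f y) \<le> C * M ^ (?n + j) * fact (?n + j) * ?P"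
      using Cons.prems(3)[of 0 vs] by simp
    \<comment> \<open>The lower-order term of the cross relation lacks one derivative;
      \<open>M \<ge> 1\<close> and monotonicity of the factorial bring it to the same order.\<close>
    moreover have "C * M ^ (?n + j) * fact (?n + j) * ?P \<le> C * M ^ (?n + Suc j) * fact (?n + Suc j) * ?P"
      using Cons.prems(2) M by (intro mult_right_mono mult_mono mult_left_mono power_increasing fact_mono) auto
    ultimately have "\<bar>k a * (fst a \<bullet> v)\<bar> * norm (dderivs vs f y)
        \<le> ?c * norm v * (C * M ^ (?n + Suc j) * fact (?n + Suc j) * ?P)"
      by (intro mult_mono) auto
    then show ?thesis by (simp only: norm_mult norm_of_real mult_ac)
  qed
  ultimately have "norm (dderivs (v # vs) (Q_op k a f) y) \<le> (C * norm v) * (K + ?n * ?c) * M ^ (?n + Suc j) * fact (?n + Suc j) * ?P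
      + (C * norm v) * ?c * M ^ (?n + Suc j) * fact (?n + Suc j) * ?P"
    by (simp only:) (rule norm_triangle_mono)
  also have "\<dots> = C * (K + (?n + 1) * ?c) * M ^ (?n + Suc j) * fact (?n + Suc j) * (norm v * ?P)"
    by (simp only: distrib_left distrib_right of_nat_add of_nat_1 mult_ac add_ac mult_1_left mult_1_right)
  finally show ?case by simp
qed

lemma tame_Q_op:
  fixes a :: "'v::euclidean_space \<times> real"
  assumes a: "fst a \<noteq> 0"
    and comm: "\<And>f v. f \<in> C_inf UNIV \<Longrightarrow> Q_op k a f \<in> C_inf UNIV \<and>
      dderiv v (Q_op k a f) = (\<lambda>x. Q_op k a (dderiv (refl (fst a, 0) v) f) x + of_real (k a * (fst a \<bullet> v)) * f x)"
    and f: "tame f"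
  shows "tame (Q_op k a f)"
  unfolding tame_def
proof (intro conjI allI)
  show "Q_op k a f \<in> C_inf UNIV" using comm tame_C_inf[OF f] by blast
  fix x :: 'v
  \<comment> \<open>\<open>A\<close> bounds \<open>\<bar>aff a y\<bar>\<close> on the unit ball
    around \<open>x\<close>; with it, the ball of radius \<open>\<rho>\<close> contains all segments
    of integration that start in the unit ball.\<close>
  define A where "A = norm (fst a) * (norm x + 1) + \<bar>snd a\<bar>"
  define \<rho> where "\<rho> = 1 + A * norm (coroot (fst a))"
  define K where "K = 1 + \<bar>k a\<bar> * A"
  define c where "c = \<bar>k a\<bar> * norm (fst a)"
  obtain C M where C: "C \<ge> 0" and M: "M \<ge> 1" and b: "\<And>y. y \<in> cball x \<rho> \<Longrightarrow> cauchy_bound f y C M"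
    using tame_bound_cball[OF f] by blast
  have A: "A \<ge> 0" unfolding A_def by simp
  have K: "K \<ge> 0" and c: "c \<ge> 0" using A by (auto simp: K_def c_def)
  have "cauchy_bound (Q_op k a f) y (C * (K + c)) (2 * M)" if y: "y \<in> ball x 1" for y
    unfolding cauchy_bound_def
  proof
    fix vs :: "'v list"
    let ?n = "length vs"
    have "norm y \<le> norm x + 1" using y norm_triangle_sub[of y x] by (simp add: dist_norm norm_minus_commute)
    have Ay: "\<bar>aff a y\<bar> \<le> A"
    proof -
      have "\<bar>fst a \<bullet> y\<bar> \<le> norm (fst a) * norm y" by (rule Cauchy_Schwarz_ineq2)
      also have "\<dots> \<le> norm (fst a) * (norm x + 1)" using \<open>norm y \<le> norm x + 1\<close> by (intro mult_left_mono) auto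
      finally show ?thesis by (simp add: aff_def A_def)
    qed
    have "norm (dderivs vs (Q_op k a f) y) \<le>
      C * (K + ?n * c) * M ^ (?n + 0) * fact (?n + 0) * prod_list (map norm vs)"
      unfolding c_def
    proof (rule Q_op_cauchy_bound[OF a comm tame_C_inf[OF f] C M])
      show "1 + \<bar>k a\<bar> * \<bar>aff a y\<bar> \<le> K" unfolding K_def using Ay by (intro add_left_mono mult_left_mono) auto
      fix us t assume t: "t \<in> closed_segment 0 (aff a y)"
      have "\<bar>t\<bar> \<le> A" using t Ay by (auto simp: closed_segment_eq_real_ivl split: if_splits)
      have "dist x (y - t *\<^sub>R coroot (fst a)) \<le> dist x y + \<bar>t\<bar> * norm (coroot (fst a))"
        using dist_triangle[of x "y - t *\<^sub>R coroot (fst a)" y] by (simp add: dist_norm)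
      also have "\<dots> \<le> \<rho>" unfolding \<rho>_def using y \<open>\<bar>t\<bar> \<le> A\<close> by (intro add_mono mult_right_mono) auto
      finally have "cauchy_bound f (y - t *\<^sub>R coroot (fst a)) C M" by (intro b) simp
      then show "norm (dderivs us f (y - t *\<^sub>R coroot (fst a)))
          \<le> C * M ^ (length us + 0) * fact (length us + 0) * prod_list (map norm us)"
        by (simp add: cauchy_bound_def)
    qed
    also have "\<dots> \<le> C * (2 ^ ?n * (K + c)) * M ^ (?n + 0) * fact (?n + 0) * prod_list (map norm vs)"
    proof -
      \<comment> \<open>The factor \<open>K + n * c\<close> left over from \<open>n\<close> uses of
        the cross relation is at most \<open>2 ^ n * (K + c)\<close>, whence the new rate
        \<open>2 * M\<close>.\<close>
      have n2: "real ?n \<le> 2 ^ ?n" using less_exp[of ?n] by (metis less_imp_le of_nat_le_iff of_nat_numeral of_nat_power)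
      have "K \<le> 2 ^ ?n * K" using K mult_right_mono[of 1 "2 ^ ?n" K] by simp
      moreover have "?n * c \<le> 2 ^ ?n * c" using c n2 by (intro mult_right_mono)
      ultimately have "K + ?n * c \<le> 2 ^ ?n * (K + c)" by (simp add: algebra_simps)
      then show ?thesis using C M by (intro mult_right_mono mult_left_mono) auto
    qed
    also have "\<dots> = C * (K + c) * (2 * M) ^ ?n * fact ?n * prod_list (map norm vs)"
      by (simp add: power_mult_distrib mult_ac)
    finally show "norm (dderivs vs (Q_op k a f) y) \<le> C * (K + c) * (2 * M) ^ ?n * fact ?n * prod_list (map norm vs)" .
  qed
  then show "\<exists>r>0. \<exists>C\<ge>0. \<exists>M\<ge>1. \<forall>y\<in>ball x r. cauchy_bound (Q_op k a f) y C M"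
    using C M K c by (intro exI[of _ 1] conjI exI[of _ "C * (K + c)"] exI[of _ "2 * M"]) auto
qed

section \<open>Locality of smoothness and limits along rays\<close>

lemma Ck_on_local:
  assumes "open S" "\<And>x. x \<in> S \<Longrightarrow> \<exists>U g. open U \<and> x \<in> U \<and> g \<in> C_inf UNIV \<and> (\<forall>y\<in>U. f y = g y)"
  shows "Ck_on n S f"
  using assms(2)
proof (induction n arbitrary: f)
  case 0
  show ?case unfolding Ck_on.simps continuous_on_eq_continuous_at[OF assms(1)]
  proof
    fix x assume "x \<in> S"
    then obtain U g where U: "open U" "x \<in> U" "g \<in> C_inf UNIV" "\<forall>y\<in>U. f y = g y"
      using 0 by (metis (no_types, lifting))
    have "isCont g x" using differentiable_imp_continuous_within[OF C_inf_differentiable[OF U(3)]] .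
    moreover have "eventually (\<lambda>y. f y = g y) (nhds x)"
      using eventually_nhds_in_open[OF U(1,2)] by eventually_elim (rule bspec[OF U(4)])
    then have "isCont f x \<longleftrightarrow> isCont g x" by (rule isCont_cong)
    ultimately show "isCont f x" by blast
  qed
next
  case (Suc n)
  show ?case unfolding Ck_on.simps
  proof (intro conjI allI)
    show "f differentiable_on S"
    proof (rule differentiable_at_imp_differentiable_on)
      fix x assume "x \<in> S"
      then obtain U g where U: "open U" "x \<in> U" "g \<in> C_inf UNIV" "\<forall>y\<in>U. f y = g y"
        using Suc.prems by (metis (no_types, lifting))
      have "(f has_derivative (\<lambda>v. dderiv v g x)) (at x)"
        by (rule has_derivative_transform_within_open[OF has_derivative_dderiv[OF C_inf_differentiable[OF U(3)]] U(1,2)])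
           (simp add: U(4))
      then show "f differentiable (at x)" by (auto simp: differentiable_def)
    qed
    fix v
    show "Ck_on n S (dderiv v f)"
    proof (rule Suc.IH)
      fix x assume "x \<in> S"
      then obtain U g where U: "open U" "x \<in> U" "g \<in> C_inf UNIV" "\<forall>y\<in>U. f y = g y"
        using Suc.prems by (metis (no_types, lifting))
      show "\<exists>U g. open U \<and> x \<in> U \<and> g \<in> C_inf UNIV \<and> (\<forall>y\<in>U. dderiv v f y = g y)"
      proof (intro exI conjI ballI)
        show "dderiv v f y = dderiv v g y" if "y \<in> U" for y
          by (rule dderiv_cong_open[OF U(1) that]) (rule bspec[OF U(4)])
      qed (rule U(1,2) C_inf_dderiv[OF U(3)])+
    qed
  qed
qed

text \<open>On the open set \<open>S\<close> all derivatives of \<open>F\<close> are those of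
  \<open>g\<close>, and these are continuous up to \<open>v\<close>, which may lie on the boundary
  of \<open>S\<close>.\<close>

lemma Lim_dderiv_ray:
  assumes "open S" "\<And>y. y \<in> S \<Longrightarrow> F y = g y" "g \<in> C_inf UNIV" "\<epsilon> > 0"
    and "\<And>t. 0 < t \<Longrightarrow> t < \<epsilon> \<Longrightarrow> v + t *\<^sub>R e \<in> S"
  shows "Lim (at_right 0) (\<lambda>t. (dderiv u ^^ r) F (v + t *\<^sub>R e)) = (dderiv u ^^ r) g v"
proof (rule tendsto_Lim)
  have "isCont ((dderiv u ^^ r) g) v"
    by (rule differentiable_imp_continuous_within[OF C_inf_differentiable[OF C_inf_funpow_dderiv[OF assms(3)]]])
  moreover have "((\<lambda>t. v + t *\<^sub>R e) \<longlongrightarrow> v) (at_right 0)"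
    by (auto intro!: tendsto_eq_intros)
  ultimately have "((\<lambda>t. (dderiv u ^^ r) g (v + t *\<^sub>R e)) \<longlongrightarrow> (dderiv u ^^ r) g v) (at_right 0)"
    by (rule isCont_tendsto_compose)
  moreover have "eventually (\<lambda>t. (dderiv u ^^ r) g (v + t *\<^sub>R e) = (dderiv u ^^ r) F (v + t *\<^sub>R e)) (at_right 0)"
    unfolding eventually_at_right_field
  proof (intro exI conjI allI impI)
    fix t assume "0 < t" "t < \<epsilon>"
    then have S: "v + t *\<^sub>R e \<in> S" by (rule assms(5))
    have "(dderiv u ^^ r) F (v + t *\<^sub>R e) = (dderiv u ^^ r) g (v + t *\<^sub>R e)"
      by (rule dderiv_funpow_cong_open[OF assms(1) _ S]) (rule assms(2))
    then show "(dderiv u ^^ r) g (v + t *\<^sub>R e) = (dderiv u ^^ r) F (v + t *\<^sub>R e)" ..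
  qed (rule assms(4))
  ultimately show "((\<lambda>t. (dderiv u ^^ r) F (v + t *\<^sub>R e)) \<longlongrightarrow> (dderiv u ^^ r) g v) (at_right 0)"
    by (rule Lim_transform_eventually)
qed simp

section \<open>Modules over the algebra\<close>

lemma tensor_in_H_space: "polynomial_function p \<Longrightarrow> w \<in> weyl R \<Longrightarrow> tensor p w \<in> H_space R"
proof -
  assume p: "polynomial_function p" and w: "w \<in> weyl R"
  have "{u. tensor p w u \<noteq> (\<lambda>_. 0)} \<subseteq> {w}" by (auto simp: tensor_def)
  then show ?thesis using p w finite_subset[of _ "{w}"]
    by (auto simp: H_space_def tensor_def polynomial_function_const)
qed

lemma polynomial_function_linear_compose:
  assumes "bounded_linear L" "polynomial_function p"
  shows "polynomial_function (\<lambda>x. L (p x))"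
  unfolding polynomial_function_def
proof (intro allI impI)
  fix f :: "'b \<Rightarrow> real" assume "bounded_linear f"
  then have "bounded_linear (\<lambda>z. f (L z))" using assms(1) by (rule bounded_linear_compose)
  then have "real_polynomial_function ((\<lambda>z. f (L z)) \<circ> p)"
    using assms(2) by (auto simp: polynomial_function_def)
  then show "real_polynomial_function (f \<circ> (\<lambda>x. L (p x)))" by (simp add: o_def)
qed

lemma polynomial_function_of_real:
  "real_polynomial_function q \<Longrightarrow> polynomial_function (\<lambda>x. complex_of_real (q x))"
  by (rule polynomial_function_linear_compose[OF bounded_linear_of_real]) (simp add: real_polynomial_function_eq)

lemma polynomial_function_lin_poly: "polynomial_function (lin_poly v)"
  unfolding lin_poly_def
  by (intro polynomial_function_of_real real_polynomial_function.intros(1) bounded_linear_inner_left)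

lemma lin_poly_in_H_space: "tensor (lin_poly v) id \<in> H_space R"
  by (intro tensor_in_H_space polynomial_function_lin_poly weyl.weyl_id)

lemma group_in_H_space: "w \<in> weyl R \<Longrightarrow> tensor (\<lambda>_. 1) w \<in> H_space R"
  by (intro tensor_in_H_space polynomial_function_const)

lemma H_one_in_H_space: "H_one \<in> H_space R"
  unfolding H_one_def by (intro group_in_H_space weyl.weyl_id)

lemma H_plus_in_H_space:
  assumes "x \<in> H_space R" "y \<in> H_space R"
  shows "H_plus x y \<in> H_space R"
proof -
  have "{w. H_plus x y w \<noteq> (\<lambda>_. 0)} \<subseteq> {w. x w \<noteq> (\<lambda>_. 0)} \<union> {w. y w \<noteq> (\<lambda>_. 0)}"
    by (auto simp: H_plus_def)
  then show ?thesis using assms unfolding H_space_def H_plus_def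
    by (auto intro: finite_subset polynomial_function_add)
qed

lemma H_scale_in_H_space:
  assumes "x \<in> H_space R"
  shows "H_scale c x \<in> H_space R"
proof -
  have "{w. H_scale c x w \<noteq> (\<lambda>_. 0)} \<subseteq> {w. x w \<noteq> (\<lambda>_. 0)}"
    by (auto simp: H_scale_def)
  moreover have "polynomial_function (\<lambda>\<xi>. c * x w \<xi>)" for w
    using assms by (intro polynomial_function_linear_compose[OF bounded_linear_mult_right]) (auto simp: H_space_def)
  ultimately show ?thesis using assms unfolding H_space_def H_scale_def
    by (auto intro: finite_subset)
qed

lemma H_moduleD:
  assumes "H_module R m \<rho> X"
  shows "fun_subspace X"
    and "\<And>h f. h \<in> H_space R \<Longrightarrow> f \<in> X \<Longrightarrow> \<rho> h f \<in> X"
    and "\<And>h. h \<in> H_space R \<Longrightarrow> fun_linear_on X (\<rho> h)"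
    and "\<And>h h' f. h \<in> H_space R \<Longrightarrow> h' \<in> H_space R \<Longrightarrow> f \<in> X \<Longrightarrow> \<rho> (H_plus h h') f = (\<lambda>x. \<rho> h f x + \<rho> h' f x)"
    and "\<And>c h f. h \<in> H_space R \<Longrightarrow> f \<in> X \<Longrightarrow> \<rho> (H_scale c h) f = (\<lambda>x. c * \<rho> h f x)"
    and "\<And>h h' f. h \<in> H_space R \<Longrightarrow> h' \<in> H_space R \<Longrightarrow> f \<in> X \<Longrightarrow> \<rho> (m h h') f = \<rho> h (\<rho> h' f)"
    and "\<And>f. f \<in> X \<Longrightarrow> \<rho> H_one f = f"
  using assms by (simp_all add: H_module_def)

lemma H_algebraD:
  assumes "H_algebra R B \<phi> k m"
  shows "\<And>x y. x \<in> H_space R \<Longrightarrow> y \<in> H_space R \<Longrightarrow> m x y \<in> H_space R"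
    and "\<And>p q. polynomial_function p \<Longrightarrow> polynomial_function q \<Longrightarrow>
        m (tensor p id) (tensor q id) = tensor (\<lambda>\<xi>. p \<xi> * q \<xi>) id"
    and "\<And>p w. w \<in> weyl R \<Longrightarrow> polynomial_function p \<Longrightarrow>
        m (tensor p id) (tensor (\<lambda>_. 1) w) = tensor p w"
    and "\<And>a v. a \<in> simple_aff_roots B \<phi> \<Longrightarrow>
        H_minus (m (tensor (\<lambda>_. 1) (refl a)) (tensor (lin_poly v) id))
                (m (tensor (lin_poly (refl (fst a, 0) v)) id) (tensor (\<lambda>_. 1) (refl a))) =
        H_scale (of_real (k a * (fst a \<bullet> v))) H_one"
  using assms by (simp_all add: H_algebra_def)

text \<open>The module is arbitrary because the relation is needed both for \<open>Q\<close> and for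
  \<open>\<pi>\<close>.\<close>

lemma H_module_cross:
  assumes alg: "H_algebra R B \<phi> k m" and mod: "H_module R m \<rho> X" and f: "f \<in> X"
    and a: "a \<in> simple_aff_roots B \<phi>" "refl a \<in> weyl R"
  shows "\<rho> (tensor (\<lambda>_. 1) (refl a)) (\<rho> (tensor (lin_poly v) id) f) =
    (\<lambda>x. \<rho> (tensor (lin_poly (refl (fst a, 0) v)) id) (\<rho> (tensor (\<lambda>_. 1) (refl a)) f) x
         + of_real (k a * (fst a \<bullet> v)) * f x)"
proof -
  let ?s = "tensor (\<lambda>_. 1) (refl a)" and ?v = "tensor (lin_poly v) id"
    and ?sv = "tensor (lin_poly (refl (fst a, 0) v)) id" and ?c = "of_real (k a * (fst a \<bullet> v)) :: complex"
  have mem: "?s \<in> H_space R" "?v \<in> H_space R" "?sv \<in> H_space R" "H_scale ?c H_one \<in> H_space R"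
    using a by (auto intro: group_in_H_space lin_poly_in_H_space H_scale_in_H_space H_one_in_H_space)
  note closed = H_algebraD(1)[OF alg] and D = H_moduleD[OF mod]
  have "m ?s ?v w \<xi> = H_plus (m ?sv ?s) (H_scale ?c H_one) w \<xi>" for w \<xi>
    using fun_cong[OF fun_cong[OF H_algebraD(4)[OF alg a(1), of v], of w], of \<xi>]
    unfolding H_minus_def H_plus_def by (simp add: diff_eq_eq add.commute)
  then have eq: "m ?s ?v = H_plus (m ?sv ?s) (H_scale ?c H_one)" by (intro ext)
  have "\<rho> ?s (\<rho> ?v f) = \<rho> (H_plus (m ?sv ?s) (H_scale ?c H_one)) f"
    unfolding D(6)[OF mem(1,2) f, symmetric] eq ..
  also have "\<dots> = (\<lambda>x. \<rho> (m ?sv ?s) f x + \<rho> (H_scale ?c H_one) f x)"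
    by (rule D(4)[OF closed[OF mem(3,1)] mem(4) f])
  also have "\<dots> = (\<lambda>x. \<rho> ?sv (\<rho> ?s f) x + ?c * f x)"
    unfolding D(6)[OF mem(3,1) f] D(5)[OF H_one_in_H_space f] D(7)[OF f] ..
  finally show ?thesis .
qed

section \<open>The propagation operator\<close>

locale hecke_setup = affine_root_system R B \<phi>
  for R B :: "'v::euclidean_space set" and \<phi> :: 'v +
  fixes k :: "'v \<times> real \<Rightarrow> real" and m :: "'v hecke \<Rightarrow> 'v hecke \<Rightarrow> 'v hecke"
    and \<pi> Q :: "'v hecke \<Rightarrow> ('v \<Rightarrow> complex) \<Rightarrow> 'v \<Rightarrow> complex"
    and QW :: "('v \<Rightarrow> 'v) \<Rightarrow> ('v \<Rightarrow> complex) \<Rightarrow> 'v \<Rightarrow> complex"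
  assumes mult: "multiplicity_function R k"
    and alg: "H_algebra R B \<phi> k m"
    and pi_rep: "pi_representation R B \<phi> k m \<pi>"
    and Q_act: "Q_action R B \<phi> k QW"
    and Q_rep: "Q_representation R m QW Q"
begin

abbreviation "Vr \<equiv> V_reg R B \<phi>"
abbreviation "T \<equiv> T_op R B \<phi> QW"

lemma tame_C_cont: "tame f \<Longrightarrow> f \<in> C_cont"
  by (simp add: C_cont_def C_inf_continuous tame_C_inf)

lemma C_inf_C_cont: "f \<in> C_inf UNIV \<Longrightarrow> f \<in> C_cont"
  by (simp add: C_cont_def C_inf_continuous)

lemma QW_comp: "u \<in> W \<Longrightarrow> w \<in> W \<Longrightarrow> f \<in> C_cont \<Longrightarrow> QW (u \<circ> w) f = QW u (QW w f)"
  using Q_act unfolding Q_action_def by meson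

lemma QW_id: "f \<in> C_cont \<Longrightarrow> QW id f = f"
  using Q_act unfolding Q_action_def by meson

lemma QW_refl: "a \<in> I \<Longrightarrow> f \<in> C_cont \<Longrightarrow> QW (refl a) f = Q_op k a f"
  using Q_act unfolding Q_action_def by meson

lemma QW_C_cont: "w \<in> W \<Longrightarrow> f \<in> C_cont \<Longrightarrow> QW w f \<in> C_cont"
  using Q_act unfolding Q_action_def by meson

lemma QW_add: "w \<in> W \<Longrightarrow> f \<in> C_cont \<Longrightarrow> g \<in> C_cont \<Longrightarrow> QW w (\<lambda>x. f x + g x) = (\<lambda>x. QW w f x + QW w g x)"
  using Q_act unfolding Q_action_def fun_linear_on_def by meson

lemma QW_scale: "w \<in> W \<Longrightarrow> f \<in> C_cont \<Longrightarrow> QW w (\<lambda>x. c * f x) = (\<lambda>x. c * QW w f x)"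
  using Q_act unfolding Q_action_def fun_linear_on_def by meson

lemmas Q_mod = Q_rep[unfolded Q_representation_def, THEN conjunct1]
  and Q_lin = Q_rep[unfolded Q_representation_def, THEN conjunct2, THEN bspec, THEN conjunct1, rule_format]
  and Q_group = Q_rep[unfolded Q_representation_def, THEN conjunct2, THEN bspec, THEN conjunct2, rule_format]

lemmas pi_mod = pi_rep[unfolded pi_representation_def, THEN conjunct1]
  and pi_lin = pi_rep[unfolded pi_representation_def, THEN conjunct2, THEN bspec, THEN conjunct1, rule_format]
  and pi_group = pi_rep[unfolded pi_representation_def, THEN conjunct2, THEN bspec, THEN conjunct2, rule_format]

lemma Q_closed: "h \<in> H_space R \<Longrightarrow> f \<in> C_inf UNIV \<Longrightarrow> Q h f \<in> C_inf UNIV"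
  by (rule H_moduleD(2)[OF Q_mod])

lemma pi_closed: "h \<in> H_space R \<Longrightarrow> f \<in> C_inf Vr \<Longrightarrow> \<pi> h f \<in> C_inf Vr"
  by (rule H_moduleD(2)[OF pi_mod])

text \<open>\<open>Q_op k a\<close> is the action of a group element in the module \<open>Q\<close>.
  So smoothness of the result is closure of the module, and the derivative formula is the cross
  relation read there.\<close>

lemma Q_op_cross:
  assumes a: "a \<in> I" and f: "f \<in> C_inf UNIV"
  shows "Q_op k a f \<in> C_inf UNIV"
    and "Q_op k a (dderiv v f) = (\<lambda>x. dderiv (refl (fst a, 0) v) (Q_op k a f) x + of_real (k a * (fst a \<bullet> v)) * f x)"
proof -
  have aS: "refl a \<in> W" using a I_Sg refl_W by blast
  have eq: "Q (tensor (\<lambda>_. 1) (refl a)) g = Q_op k a g" if "g \<in> C_inf UNIV" for g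
    using Q_group[OF that aS] QW_refl[OF a C_inf_C_cont[OF that]] by simp
  show Qf: "Q_op k a f \<in> C_inf UNIV"
    using Q_closed[OF group_in_H_space[OF aS] f] eq[OF f] by simp
  show "Q_op k a (dderiv v f) = (\<lambda>x. dderiv (refl (fst a, 0) v) (Q_op k a f) x + of_real (k a * (fst a \<bullet> v)) * f x)"
    using H_module_cross[OF alg Q_mod f a aS, of v]
    by (simp only: Q_lin f eq C_inf_dderiv Qf)
qed

text \<open>The cross relation applied to the reflected vector. Reflection negates
  \<open>fst a \<bullet> v\<close>, so the scalar term changes sides with a positive sign.\<close>

lemma dderiv_Q_op:
  assumes a: "a \<in> I" and f: "f \<in> C_inf UNIV"
  shows "dderiv v (Q_op k a f) = (\<lambda>x. Q_op k a (dderiv (refl (fst a, 0) v) f) x + of_real (k a * (fst a \<bullet> v)) * f x)"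
proof -
  have nz: "fst a \<noteq> 0" using a I_Sg Sg_nonzero by blast
  then have "refl (fst a, 0) (refl (fst a, 0) v) = v" by (intro refl_refl) simp
  then show ?thesis
    using Q_op_cross(2)[OF a f, of "refl (fst a, 0) v"] by (simp add: refl_minus_functional[OF nz])
qed

lemma QW_tame: "w \<in> W \<Longrightarrow> tame f \<Longrightarrow> tame (QW w f)"
proof -
  assume w: "w \<in> W" and f: "tame f"
  obtain cs where cs: "set cs \<subseteq> I" "w = word cs" using weyl_word[OF w] by (elim exE conjE)
  have "tame (QW (word cs) f)" using cs(1) f
  proof (induction cs arbitrary: f)
    case Nil
    then show ?case using QW_id[OF tame_C_cont] by (simp only: word.simps)
  next
    case (Cons c cs)
    have c: "c \<in> I" and cs: "set cs \<subseteq> I" using Cons.prems by auto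
    have cW: "refl c \<in> W" and nz: "fst c \<noteq> 0" using c I_Sg refl_W Sg_nonzero by auto
    have "tame (Q_op k c f)"
      by (rule tame_Q_op[OF nz _ Cons.prems(2)]) (intro conjI Q_op_cross(1)[OF c] dderiv_Q_op[OF c])
    then have "tame (QW (word cs) (Q_op k c f))" by (rule Cons.IH[OF cs])
    moreover have "QW (word (c # cs)) f = QW (word cs) (Q_op k c f)"
      unfolding word.simps QW_comp[OF word_W[OF cs] cW tame_C_cont[OF Cons.prems(2)]]
        QW_refl[OF c tame_C_cont[OF Cons.prems(2)]] ..
    ultimately show ?case by (simp only:)
  qed
  then show ?thesis by (simp only: cs(2))
qed

lemma QW_stabilizer:
  assumes "set cs \<subseteq> {a \<in> I. aff a v = 0}" "f \<in> C_cont"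
  shows "QW (word cs) f v = f v"
  using assms
proof (induction cs arbitrary: f)
  case Nil
  then show ?case using QW_id by (simp only: word.simps)
next
  case (Cons c cs)
  have c: "c \<in> I" "aff c v = 0" and cs: "set cs \<subseteq> {a \<in> I. aff a v = 0}" using Cons.prems by auto
  have cW: "refl c \<in> W" using c I_Sg refl_W by auto
  have "word cs \<in> W" by (rule word_W) (use cs in auto)
  then have "QW (word (c # cs)) f v = QW (word cs) (QW (refl c) f) v"
    unfolding word.simps using QW_comp cW Cons.prems(2) by metis
  also have "\<dots> = QW (refl c) f v" by (rule Cons.IH[OF cs QW_C_cont[OF cW Cons.prems(2)]])
  also have "\<dots> = f v" using QW_refl[OF c(1) Cons.prems(2)] Q_op_on_hyperplane[OF c(2)] by metis
  finally show ?case .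
qed

lemma T_eq:
  assumes w: "w \<in> W" "w x \<in> Cbar" and f: "f \<in> C_cont"
  shows "T f x = QW w f (w x)"
  unfolding T_op_def
proof (rule the_equality)
  show "\<exists>u\<in>W. \<exists>v\<in>Cbar. x = inv u v \<and> QW w f (w x) = QW u f v"
    by (intro bexI[of _ w] bexI[of _ "w x"]) (use w in auto)
  fix y assume "\<exists>u\<in>W. \<exists>v\<in>Cbar. x = inv u v \<and> y = QW u f v"
  then obtain u v where u: "u \<in> W" "v \<in> Cbar" "x = inv u v" "y = QW u f v" by (elim bexE conjE)
  have ux: "u x = v" using u by simp
  \<comment> \<open>\<open>z\<close> connects the two representations of \<open>x\<close> inside the
    closed alcove; being there, it fixes the point and is a word in the simple reflections through
    it.\<close>
  define z where "z = u \<circ> inv w"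
  have zW: "z \<in> W" unfolding z_def by (rule weyl_comp[OF u(1) inv_W[OF w(1)]])
  have zwx: "z (w x) = v" using w(1) ux by (simp add: z_def)
  obtain cs where cs: "z (w x) = w x" "set cs \<subseteq> {a \<in> I. aff a (w x) = 0}" "z = word cs"
    using fundamental_domain[OF zW w(2)] zwx u(2) by auto
  have "u = z \<circ> w" using w(1) by (auto simp: z_def)
  then have "QW u f v = QW z (QW w f) (w x)" using QW_comp[OF zW w(1) f] cs(1) zwx by simp
  also have "\<dots> = QW w f (w x)" unfolding cs(3) by (rule QW_stabilizer[OF cs(2) QW_C_cont[OF w(1) f]])
  finally show "y = QW w f (w x)" using u(4) by simp
qed

lemma T_chamber: "w \<in> W \<Longrightarrow> x \<in> chamber w \<Longrightarrow> f \<in> C_cont \<Longrightarrow> T f x = QW w f (w x)"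
  using T_eq Cp_Cbar by (simp add: chamber_def)

lemma T_add: "f \<in> C_cont \<Longrightarrow> g \<in> C_cont \<Longrightarrow> T (\<lambda>x. f x + g x) = (\<lambda>x. T f x + T g x)"
proof
  fix x assume f: "f \<in> C_cont" and g: "g \<in> C_cont"
  obtain w where w: "w \<in> W" "w x \<in> Cbar" using ex_weyl_Cbar by blast
  have fg: "(\<lambda>x. f x + g x) \<in> C_cont" using f g by (auto simp: C_cont_def intro: continuous_on_add)
  show "T (\<lambda>x. f x + g x) x = T f x + T g x"
    by (simp only: T_eq[OF w] f g fg QW_add[OF w(1) f g])
qed

lemma T_scale: "f \<in> C_cont \<Longrightarrow> T (\<lambda>x. c * f x) = (\<lambda>x. c * T f x)"
proof
  fix x assume f: "f \<in> C_cont"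
  obtain w where w: "w \<in> W" "w x \<in> Cbar" using ex_weyl_Cbar by blast
  have fg: "(\<lambda>x. c * f x) \<in> C_cont" using f by (auto simp: C_cont_def intro: continuous_on_mult_left)
  show "T (\<lambda>x. c * f x) x = c * T f x"
    by (simp only: T_eq[OF w] f fg QW_scale[OF w(1) f])
qed

text \<open>Near \<open>x\<close> the value of \<open>T f\<close> is always given by one of the
  finitely many \<open>w\<close> that take \<open>x\<close> into the closed alcove. Each of these
  branches is continuous, and all take the value \<open>T f x\<close> at \<open>x\<close>.\<close>

lemma T_C_cont:
  assumes f: "f \<in> C_cont"
  shows "T f \<in> C_cont"
  unfolding C_cont_def mem_Collect_eq continuous_on_eq_continuous_at[OF open_UNIV]
proof
  fix x :: 'v
  obtain \<delta> where \<delta>: "\<delta> > 0" "\<And>a y. a \<in> Sg \<Longrightarrow> aff a x \<noteq> 0 \<Longrightarrow> y \<in> ball x \<delta> \<Longrightarrow> aff a y * aff a x > 0"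
    using sign_stable[of x] by blast
  \<comment> \<open>By sign stability, an affine root that is negative at \<open>x\<close> is
    negative nearby; hence no further \<open>w\<close> can occur.\<close>
  have near: "w x \<in> Cbar" if "w \<in> W" "w y \<in> Cbar" "y \<in> ball x \<delta>" for w y
    unfolding Cbar_iff
  proof (rule ballI, rule ccontr)
    fix a assume a: "a \<in> I" and "\<not> aff a (w x) \<ge> 0"
    then have "aff (pull w a) x < 0" using that(1) I_Sg by (simp add: aff_pull)
    moreover have "aff (pull w a) y \<ge> 0" using a that(1,2) I_Sg by (simp add: aff_pull Cbar_iff)
    ultimately show False
      using \<delta>(2)[OF pull_Sg[OF that(1) I_Sg[OF a]] _ that(3)] by (simp add: zero_less_mult_iff)
  qed
  have cont: "isCont (\<lambda>y. QW w f (w y)) x" if wW: "w \<in> W" for w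
  proof -
    obtain L where L: "affine_isometry w L" using weyl_affine[OF wW] by blast
    have "isCont w x" by (rule differentiable_imp_continuous_within[OF affine_isometry_differentiable[OF L]])
    moreover have "isCont (QW w f) (w x)"
      using QW_C_cont[OF wW f] by (simp add: C_cont_def continuous_on_eq_continuous_at)
    ultimately show ?thesis by (rule isCont_o2)
  qed
  show "isCont (T f) x" unfolding isCont_def tendsto_iff
  proof (intro allI impI)
    fix e :: real assume e: "e > 0"
    have "\<forall>\<^sub>F y in at x. \<forall>w\<in>{w \<in> W. w x \<in> Cbar}. dist (QW w f (w y)) (QW w f (w x)) < e"
      using cont e unfolding isCont_def tendsto_iff
      by (intro eventually_ball_finite[OF finite_weyl_Cbar]) simp
    moreover have "\<forall>\<^sub>F y in at x. y \<in> ball x \<delta>"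
      using \<delta>(1) by (intro eventually_at_in_open') auto
    ultimately show "\<forall>\<^sub>F y in at x. dist (T f y) (T f x) < e"
    proof eventually_elim
      case (elim y)
      obtain w where w: "w \<in> W" "w y \<in> Cbar" using ex_weyl_Cbar by blast
      have wx: "w x \<in> Cbar" by (rule near[OF w elim(2)])
      show ?case using elim(1) w(1) wx by (simp add: T_eq[OF w f] T_eq[OF w(1) wx f])
    qed
  qed
qed

lemma T_local:
  assumes "w \<in> W" "tame f"
  shows "tame (\<lambda>y. QW w f (w y))" "y \<in> chamber w \<Longrightarrow> T f y = QW w f (w y)"
proof -
  obtain L where L: "affine_isometry w L" using weyl_affine[OF assms(1)] by blast
  show "tame (\<lambda>y. QW w f (w y))" by (rule tame_compose[OF L QW_tame[OF assms]])
  show "y \<in> chamber w \<Longrightarrow> T f y = QW w f (w y)" by (rule T_chamber[OF assms(1) _ tame_C_cont[OF assms(2)]])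
qed

lemma CB_omega_iff:
  "F \<in> CB_omega R B \<phi> \<longleftrightarrow> F \<in> C_cont \<and> (\<forall>w\<in>W. \<exists>g. tame g \<and> (\<forall>x\<in>chamber w. F x = g x))"
  unfolding CB_omega_def alcoves_eq C_omega_eq_tame by auto

lemma T_CB_omega:
  assumes f: "tame f"
  shows "T f \<in> CB_omega R B \<phi>"
  unfolding CB_omega_iff
proof (intro conjI ballI exI)
  fix w assume w: "w \<in> W"
  show "tame (\<lambda>y. QW w f (w y))" by (rule T_local(1)[OF w f])
  show "T f x = QW w f (w x)" if "x \<in> chamber w" for x by (rule T_local(2)[OF w f that])
qed (rule T_C_cont[OF tame_C_cont[OF f]])

end

section \<open>Jumps across walls\<close>

lemma dderiv_funpow_add:
  "f \<in> C_inf UNIV \<Longrightarrow> g \<in> C_inf UNIV \<Longrightarrow>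
    (dderiv v ^^ r) (\<lambda>x. f x + g x) = (\<lambda>x. (dderiv v ^^ r) f x + (dderiv v ^^ r) g x)"
  using dderivs_add[of f g "replicate r v"] by (simp add: dderivs_replicate)

lemma dderiv_funpow_cmult:
  "f \<in> C_inf UNIV \<Longrightarrow> (dderiv v ^^ r) (\<lambda>x. c * f x) = (\<lambda>x. c * (dderiv v ^^ r) f x)"
  using dderivs_cmult[of f "replicate r v"] by (simp add: dderivs_replicate)

lemma dderiv_funpow_scaleR:
  assumes "f \<in> C_inf UNIV"
  shows "(dderiv (c *\<^sub>R v) ^^ r) f = (\<lambda>x. of_real c ^ r * (dderiv v ^^ r) f x)"
proof (induction r)
  case (Suc r)
  have C: "(dderiv v ^^ r) f \<in> C_inf UNIV" by (rule C_inf_funpow_dderiv[OF assms])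
  show ?case
  proof
    fix x
    have "(dderiv (c *\<^sub>R v) ^^ Suc r) f x = dderiv (c *\<^sub>R v) (\<lambda>x. of_real c ^ r * (dderiv v ^^ r) f x) x"
      by (simp add: Suc)
    also have "\<dots> = of_real c ^ r * (of_real c * dderiv v ((dderiv v ^^ r) f) x)"
      unfolding dderiv_cmult[OF C] dderiv_scaleR_dir[OF C] ..
    finally show "(dderiv (c *\<^sub>R v) ^^ Suc r) f x = of_real c ^ Suc r * (dderiv v ^^ Suc r) f x" by simp
  qed
qed simp

lemma dderiv_funpow_minus:
  assumes "f \<in> C_inf UNIV"
  shows "(dderiv (- v) ^^ r) f = (\<lambda>x. (-1) ^ r * (dderiv v ^^ r) f x)"
  using dderiv_funpow_scaleR[OF assms, where c = "-1" and v = v and r = r] by simp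

text \<open>On either side of the wall \<open>F\<close> agrees with a smooth function defined
  everywhere, so the one-sided limits are derivatives at \<open>v\<close> itself. Order 0 identifies
  both values with \<open>F v\<close> when \<open>F\<close> is continuous.\<close>

lemma ray_limits:
  fixes b :: "'v::euclidean_space \<times> real"
  assumes b: "fst b \<noteq> 0" "aff b v = 0" and \<delta>: "\<delta> > 0"
    and g: "gp \<in> C_inf UNIV" "gm \<in> C_inf UNIV"
    and F: "\<forall>y\<in>ball v \<delta>. aff b y > 0 \<longrightarrow> F y = gp y" "\<forall>y\<in>ball v \<delta>. aff b y < 0 \<longrightarrow> F y = gm y"
  defines "u \<equiv> coroot (fst b)"
  shows "Lim (at_right 0) (\<lambda>t. (dderiv u ^^ r) F (v + t *\<^sub>R u)) = (dderiv u ^^ r) gp v"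
    and "Lim (at_right 0) (\<lambda>t. (dderiv u ^^ r) F (v - t *\<^sub>R u)) = (dderiv u ^^ r) gm v"
    and "continuous_on UNIV F \<Longrightarrow> gp v = F v" and "continuous_on UNIV F \<Longrightarrow> gm v = F v"
proof -
  define \<epsilon> where "\<epsilon> = \<delta> / (1 + norm u)"
  have n: "1 + norm u > 0" by (simp add: add_pos_nonneg)
  have e: "\<epsilon> > 0" using \<delta> n by (simp add: \<epsilon>_def)
  have op: "open (ball v \<delta> \<inter> {y. aff b y > 0})" "open (ball v \<delta> \<inter> {y. aff b y < 0})"
    unfolding aff_def by (intro open_Int open_ball open_Collect_less continuous_intros)+
  \<comment> \<open>The pairing is positive, so the ray along \<open>u\<close> enters the positive
    side.\<close>
  have bu: "fst b \<bullet> u = 2" unfolding u_def by (rule inner_coroot[OF b(1)])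
  have near: "t * norm u < \<delta>" if "0 < t" "t < \<epsilon>" for t
  proof -
    have "t * norm u \<le> t * (1 + norm u)" using that by (intro mult_left_mono) auto
    also have "\<dots> < \<delta>" using that n by (simp add: \<epsilon>_def pos_less_divide_eq)
    finally show ?thesis .
  qed
  have inp: "v + t *\<^sub>R u \<in> ball v \<delta> \<inter> {y. aff b y > 0}" if "0 < t" "t < \<epsilon>" for t
    using near[OF that] that b(2) bu by (simp add: dist_norm aff_add_vec)
  have inm: "v + t *\<^sub>R (- u) \<in> ball v \<delta> \<inter> {y. aff b y < 0}" if "0 < t" "t < \<epsilon>" for t
    using near[OF that] that b(2) bu aff_add_vec[of b v "t *\<^sub>R (- u)"] by (simp add: dist_norm)
  have Lp: "Lim (at_right 0) (\<lambda>t. (dderiv u ^^ r) F (v + t *\<^sub>R u)) = (dderiv u ^^ r) gp v" for r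
    by (rule Lim_dderiv_ray[OF op(1) _ g(1) e inp]) (use F in auto)
  have Lm: "Lim (at_right 0) (\<lambda>t. (dderiv u ^^ r) F (v + t *\<^sub>R (- u))) = (dderiv u ^^ r) gm v" for r
    by (rule Lim_dderiv_ray[OF op(2) _ g(2) e inm]) (use F in auto)
  show "Lim (at_right 0) (\<lambda>t. (dderiv u ^^ r) F (v + t *\<^sub>R u)) = (dderiv u ^^ r) gp v" by (rule Lp)
  show "Lim (at_right 0) (\<lambda>t. (dderiv u ^^ r) F (v - t *\<^sub>R u)) = (dderiv u ^^ r) gm v"
    using Lm[of r] by simp
  have lim: "Lim (at_right 0) (\<lambda>t. F (v + t *\<^sub>R x)) = F v" if c: "continuous_on UNIV F" for x
  proof (rule tendsto_Lim)
    have "isCont F v" using c by (simp add: continuous_on_eq_continuous_at)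
    moreover have "((\<lambda>t. v + t *\<^sub>R x) \<longlongrightarrow> v) (at_right 0)" by (auto intro!: tendsto_eq_intros)
    ultimately show "((\<lambda>t. F (v + t *\<^sub>R x)) \<longlongrightarrow> F v) (at_right 0)" by (rule isCont_tendsto_compose)
  qed simp
  show "continuous_on UNIV F \<Longrightarrow> gp v = F v" using lim[of u] Lp[of 0] by simp
  show "continuous_on UNIV F \<Longrightarrow> gm v = F v" using lim[of "- u"] Lm[of 0] by simp
qed

context hecke_setup
begin

text \<open>\<open>gp\<close> and \<open>gm\<close> are the analytic functions that represent a function on the positive and on the
  negative side of the wall $V_b$ near $v$.\<close>

definition jump_cond :: "'v \<times> real \<Rightarrow> 'v \<Rightarrow> ('v \<Rightarrow> complex) \<Rightarrow> ('v \<Rightarrow> complex) \<Rightarrow> bool" where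
  "jump_cond b v gp gm \<longleftrightarrow> (\<forall>r>0.
     (dderiv (coroot (fst b)) ^^ r) gp v - (dderiv (coroot (fst b)) ^^ r) gm v =
     (1 - (-1) ^ r) * of_real (k b) * (dderiv (coroot (fst b)) ^^ (r - 1)) gp v)"

lemma C_omega_k_iff:
  "F \<in> C_omega_k R B \<phi> k \<longleftrightarrow> F \<in> CB_omega R B \<phi> \<and>
    (\<forall>b\<in>Sp. \<forall>v. subregular R B \<phi> b v \<longrightarrow> (\<forall>r>0.
        Lim (at_right 0) (\<lambda>t. (dderiv (coroot (fst b)) ^^ r) F (v + t *\<^sub>R coroot (fst b))) -
        Lim (at_right 0) (\<lambda>t. (dderiv (coroot (fst b)) ^^ r) F (v - t *\<^sub>R coroot (fst b))) =
        (1 - (-1) ^ r) * of_real (k b) *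
          Lim (at_right 0) (\<lambda>t. (dderiv (coroot (fst b)) ^^ (r - 1)) F (v + t *\<^sub>R coroot (fst b)))))"
  unfolding C_omega_k_def Let_def mem_Collect_eq ..

lemma C_omega_k_CB: "F \<in> C_omega_k R B \<phi> k \<Longrightarrow> F \<in> CB_omega R B \<phi>"
  unfolding C_omega_k_iff by (rule conjunct1)

lemma C_omega_k_jump:
  assumes "F \<in> C_omega_k R B \<phi> k" "b \<in> Sp" "subregular R B \<phi> b v" "\<delta> > 0"
    and "gp \<in> C_inf UNIV" "gm \<in> C_inf UNIV"
    and F: "\<forall>y\<in>ball v \<delta>. aff b y > 0 \<longrightarrow> F y = gp y" "\<forall>y\<in>ball v \<delta>. aff b y < 0 \<longrightarrow> F y = gm y"
  shows "jump_cond b v gp gm"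
proof -
  have b: "fst b \<noteq> 0" "aff b v = 0"
    using Sg_nonzero[OF Sp_Sg[OF assms(2)]] assms(3) by (auto simp: subregular_def hyperplane_def)
  note L = ray_limits(1,2)[OF b assms(4-6) F]
  show ?thesis
    using assms(1)[unfolded C_omega_k_iff, THEN conjunct2, THEN bspec, OF assms(2), rule_format, OF assms(3)]
    unfolding jump_cond_def L by simp
qed

lemma k_pull:
  assumes w: "w \<in> W" and a: "a \<in> Sg"
  shows "k (pull w a) = k a"
proof -
  have "inv (inv w) = w" by (rule inv_inv_eq[OF weyl_bij[OF w]])
  then have "aff (pull w a) = act (inv w) (aff a)"
    by (intro ext) (simp add: act_def aff_pull[OF w a])
  then show ?thesis
    using mult[unfolded multiplicity_function_def, THEN conjunct2, THEN conjunct1, rule_format, OF inv_W[OF w] a pull_Sg[OF w a]]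
    by simp
qed

text \<open>Iterating the cross relation, each step leaves a term \<open>- 2 k_a\<close> times a
  derivative of \<open>g\<close> of total order \<open>r - 1\<close>, with alternating signs from
  the derivatives along \<open>- u\<close>. The alternating sum yields \<open>1 - (-1) ^ r\<close>,
  and on the hyperplane the remaining \<open>Q_op\<close> disappears.\<close>

lemma dderiv_funpow_Q_op:
  assumes a: "a \<in> I" and p: "aff a p = 0" and g: "g \<in> C_inf UNIV"
  defines "u \<equiv> coroot (fst a)"
  shows "(dderiv (- u) ^^ r) (Q_op k a g) p =
    (dderiv u ^^ r) g p - of_real (k a) * (1 - (-1) ^ r) * (dderiv u ^^ (r - 1)) g p"
  using g
proof (induction r arbitrary: g)
  case 0
  then show ?case using Q_op_on_hyperplane[OF p] by simp
next
  case (Suc r)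
  have nz: "fst a \<noteq> 0" using a I_Sg Sg_nonzero by blast
  have iso: "linear (refl (fst a, 0))" using affine_isometry_refl[of "(fst a, 0)"] nz by (simp add: affine_isometry_def)
  have su: "refl (fst a, 0) (- u) = u" using refl_coroot[OF nz] linear_neg[OF iso, of u] by (simp add: u_def)
  have fu: "fst a \<bullet> (- u) = -2" using inner_coroot[OF nz] by (simp add: u_def)
  define c where "c = complex_of_real (k a * - 2)"
  have d: "dderiv (- u) (Q_op k a g) = (\<lambda>x. Q_op k a (dderiv u g) x + c * g x)"
    unfolding dderiv_Q_op[OF a Suc.prems, of "- u"] su fu c_def ..
  have "(dderiv (- u) ^^ Suc r) (Q_op k a g) p
      = (dderiv (- u) ^^ r) (Q_op k a (dderiv u g)) p + c * ((-1) ^ r * (dderiv u ^^ r) g p)"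
    unfolding funpow_Suc_right o_def d
      dderiv_funpow_add[OF Q_op_cross(1)[OF a C_inf_dderiv[OF Suc.prems]] C_inf_cmult[OF Suc.prems]]
      dderiv_funpow_cmult[OF Suc.prems] dderiv_funpow_minus[OF Suc.prems] ..
  also have "(dderiv (- u) ^^ r) (Q_op k a (dderiv u g)) p
      = (dderiv u ^^ r) (dderiv u g) p - of_real (k a) * (1 - (-1) ^ r) * (dderiv u ^^ (r - 1)) (dderiv u g) p"
    by (rule Suc.IH[OF C_inf_dderiv[OF Suc.prems]])
  \<comment> \<open>For \<open>r = 0\<close> the truncated exponent \<open>r - 1\<close> does no
    harm, as the factor \<open>1 - (-1) ^ r\<close> is 0.\<close>
  also have "of_real (k a) * (1 - (-1) ^ r) * (dderiv u ^^ (r - 1)) (dderiv u g) p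
      = of_real (k a) * (1 - (-1) ^ r) * (dderiv u ^^ r) g p"
    by (cases r) (auto simp: funpow_Suc_right simp del: funpow.simps)
  also have "(dderiv u ^^ r) (dderiv u g) p = (dderiv u ^^ Suc r) g p"
    by (simp add: funpow_Suc_right del: funpow.simps)
  finally have *: "(dderiv (- u) ^^ Suc r) (Q_op k a g) p = (dderiv u ^^ Suc r) g p
      - of_real (k a) * (1 - (-1) ^ r) * (dderiv u ^^ r) g p + c * ((-1) ^ r * (dderiv u ^^ r) g p)" .
  show ?case unfolding * c_def by (simp add: algebra_simps)
qed

lemma T_C_omega_k:
  assumes f: "tame f"
  shows "T f \<in> C_omega_k R B \<phi> k"
  unfolding C_omega_k_iff
proof (intro conjI ballI allI impI)
  show "T f \<in> CB_omega R B \<phi>" by (rule T_CB_omega[OF f])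
  fix b v and r :: nat assume bS: "b \<in> Sp" and v: "subregular R B \<phi> b v" and r: "r > 0"
  \<comment> \<open>The sign is arranged so that \<open>b\<close> is exactly
    \<open>pull w a\<close>; then the positive side of the wall belongs to
    \<open>chamber w\<close>.\<close>
  obtain w a where w: "w \<in> W" and a: "a \<in> I" and ba: "pull w a = b" and wp: "wall_point a (w v)"
    using subregular_wall_point[OF bS v] by (elim bexE conjE)
  have aS: "a \<in> Sg" and rW: "refl a \<in> W" and nz: "fst a \<noteq> 0" using a I_Sg refl_W Sg_nonzero by auto
  have rw: "refl a \<circ> w \<in> W" by (rule weyl_comp[OF rW w])
  have bw: "aff b y = aff a (w y)" for y using aff_pull[OF w aS] ba by simp
  obtain \<delta> where \<delta>: "\<delta> > 0" "\<And>y. y \<in> ball v \<delta> \<Longrightarrow> aff a (w y) > 0 \<Longrightarrow> w y \<in> Cp"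
      "\<And>y. y \<in> ball v \<delta> \<Longrightarrow> aff a (w y) < 0 \<Longrightarrow> refl a (w y) \<in> Cp"
    using wall_point_sides[OF w a wp] by (metis (no_types, lifting))
  define g where "g = QW w f"
  have gt: "tame g" unfolding g_def by (rule QW_tame[OF w f])
  note gC = tame_C_inf[OF gt]
  obtain L where L: "affine_isometry w L" using weyl_affine[OF w] by blast
  note La = affine_isometry_refl[OF nz]
  have Lu: "L (coroot (fst b)) = coroot (fst a)" by (rule affine_isometry_gradient(2)[OF L bw])
  have p: "aff a (w v) = 0" using wp by (simp add: wall_point_def)
  have QC: "Q_op k a g \<in> C_inf UNIV" by (rule Q_op_cross(1)[OF a gC])
  have gpC: "(\<lambda>y. g (w y)) \<in> C_inf UNIV" by (rule C_inf_compose[OF L gC])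
  have gmC: "(\<lambda>y. Q_op k a g (refl a (w y))) \<in> C_inf UNIV"
    by (rule C_inf_compose[OF L C_inf_compose[OF La QC]])
  have Fp: "T f y = g (w y)" if "y \<in> ball v \<delta>" "aff b y > 0" for y
    unfolding g_def using that \<delta>(2)[OF that(1)] by (intro T_local(2)[OF w f]) (simp add: chamber_def bw)
  have Fm: "T f y = Q_op k a g (refl a (w y))" if "y \<in> ball v \<delta>" "aff b y < 0" for y
  proof -
    have "T f y = QW (refl a \<circ> w) f ((refl a \<circ> w) y)"
      using that \<delta>(3)[OF that(1)] by (intro T_local(2)[OF rw f]) (simp add: chamber_def bw)
    also have "QW (refl a \<circ> w) f = Q_op k a g"
      unfolding g_def using QW_comp[OF rW w tame_C_cont[OF f]] QW_refl[OF a tame_C_cont[OF QW_tame[OF w f]]] by simp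
    finally show ?thesis by simp
  qed
  have b: "fst b \<noteq> 0" "aff b v = 0" using Sg_nonzero[OF Sp_Sg[OF bS]] bw p by auto
  have FF: "\<forall>y\<in>ball v \<delta>. aff b y > 0 \<longrightarrow> T f y = g (w y)"
    "\<forall>y\<in>ball v \<delta>. aff b y < 0 \<longrightarrow> T f y = Q_op k a g (refl a (w y))"
    using Fp Fm by simp_all
  note RL = ray_limits(1,2)[OF b \<delta>(1) gpC gmC FF]
  have dp: "(dderiv (coroot (fst b)) ^^ r) (\<lambda>y. g (w y)) v = (dderiv (coroot (fst a)) ^^ r) g (w v)" for r
    unfolding dderiv_funpow_compose[OF L] Lu ..
  \<comment> \<open>The inner map contains \<open>refl a\<close>, whose linear part reverses the
    normal; so \<open>Q_op k a g\<close> is differentiated along the negative coroot.\<close>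
  have dm: "(dderiv (coroot (fst b)) ^^ r) (\<lambda>y. Q_op k a g (refl a (w y))) v
      = (dderiv (- coroot (fst a)) ^^ r) (Q_op k a g) (w v)" for r
    unfolding dderiv_funpow_compose[OF L, of r _ "\<lambda>z. Q_op k a g (refl a z)"] Lu
      dderiv_funpow_compose[OF La] refl_coroot[OF nz] refl_fixes[OF p] ..
  have kb: "k b = k a" using k_pull[OF w aS] ba by simp
  show "Lim (at_right 0) (\<lambda>t. (dderiv (coroot (fst b)) ^^ r) (T f) (v + t *\<^sub>R coroot (fst b))) -
        Lim (at_right 0) (\<lambda>t. (dderiv (coroot (fst b)) ^^ r) (T f) (v - t *\<^sub>R coroot (fst b))) =
        (1 - (-1) ^ r) * of_real (k b) *
          Lim (at_right 0) (\<lambda>t. (dderiv (coroot (fst b)) ^^ (r - 1)) (T f) (v + t *\<^sub>R coroot (fst b)))"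
    unfolding RL dp dm dderiv_funpow_Q_op[OF a p gC] kb by simp
qed

section \<open>Uniqueness of the continuation across a wall\<close>

lemma jump_unique_minus:
  assumes "jump_cond b v gp gm" "jump_cond b v gp gm'" "gm v = gm' v"
  shows "(dderiv (coroot (fst b)) ^^ r) gm v = (dderiv (coroot (fst b)) ^^ r) gm' v"
proof (cases "r = 0")
  case False
  then have r: "r > 0" by simp
  have "(dderiv (coroot (fst b)) ^^ r) gp v - (dderiv (coroot (fst b)) ^^ r) gm v
      = (dderiv (coroot (fst b)) ^^ r) gp v - (dderiv (coroot (fst b)) ^^ r) gm' v"
    unfolding assms(1)[unfolded jump_cond_def, rule_format, OF r] assms(2)[unfolded jump_cond_def, rule_format, OF r] ..
  then show ?thesis by simp
qed (use assms(3) in simp)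

text \<open>The right-hand side of the condition of order \<open>r\<close> contains the derivative
  of order \<open>r - 1\<close> of the sought function, so the derivatives are determined
  recursively from the common value. In the opposite direction the right-hand side belongs to the
  known side.\<close>

lemma jump_unique_plus:
  assumes "jump_cond b v gp gm" "jump_cond b v gp' gm" "gp v = gp' v"
  shows "(dderiv (coroot (fst b)) ^^ r) gp v = (dderiv (coroot (fst b)) ^^ r) gp' v"
proof (induction r)
  case (Suc r)
  have "(dderiv (coroot (fst b)) ^^ Suc r) h v - (dderiv (coroot (fst b)) ^^ Suc r) gm v =
     (1 - (-1) ^ Suc r) * of_real (k b) * (dderiv (coroot (fst b)) ^^ r) h v" if "jump_cond b v h gm" for h
    using that[unfolded jump_cond_def, rule_format, of "Suc r"] by (simp only: diff_Suc_1 zero_less_Suc)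
  from this[OF assms(1)] this[OF assms(2)]
  have "(dderiv (coroot (fst b)) ^^ Suc r) gp v - (dderiv (coroot (fst b)) ^^ Suc r) gm v
      = (dderiv (coroot (fst b)) ^^ Suc r) gp' v - (dderiv (coroot (fst b)) ^^ Suc r) gm v"
    unfolding Suc by (rule trans[OF _ sym])
  then show ?case unfolding diff_eq_eq diff_add_cancel .
qed (use assms(3) in simp)

text \<open>Every point near \<open>v\<close> is reached from its foot on the hyperplane in the
  normal direction. Taylor's formula there shows that \<open>d\<close> vanishes on a neighbourhood
  of \<open>v\<close>, and the identity theorem does the rest.\<close>

lemma vanish_on_hyperplane:
  assumes d: "tame d" and b: "fst b \<noteq> 0" "aff b v = 0" and \<delta>: "\<delta> > 0"
    and z: "\<And>z r. z \<in> ball v \<delta> \<Longrightarrow> aff b z = 0 \<Longrightarrow> (dderiv (coroot (fst b)) ^^ r) d z = 0"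
  shows "d x = 0"
proof -
  define u where "u = coroot (fst b)"
  obtain e where e: "e > 0" "\<And>z h. z \<in> ball v e \<Longrightarrow> norm h < e \<Longrightarrow> (\<forall>n. (dderiv h ^^ n) d z = 0) \<Longrightarrow> d (z + h) = 0"
    using tame_vanish_uniform[OF d, of v] by (metis (no_types, lifting))
  \<comment> \<open>The normal displacement of \<open>y\<close> from the hyperplane; the 2 is the
    pairing of \<open>fst b\<close> with its coroot.\<close>
  define h where "h y = (aff b y / 2) *\<^sub>R u" for y
  define U where "U = {y. norm (y - h y - v) < min e \<delta>} \<inter> {y. norm (h y) < e}"
  have "open U" unfolding U_def h_def aff_def
    by (intro open_Int open_Collect_less continuous_intros) auto
  moreover have "v \<in> U" using b(2) e(1) \<delta> by (simp add: U_def h_def)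
  moreover have "d y = 0" if y: "y \<in> U" for y
  proof -
    let ?z = "y - h y"
    have zb: "?z \<in> ball v e" "?z \<in> ball v \<delta>" "norm (h y) < e"
      using y by (auto simp: U_def dist_norm norm_minus_commute)
    have "aff b ?z = aff b y - aff b y / 2 * (fst b \<bullet> u)" by (simp add: h_def aff_def inner_diff_right)
    then have "aff b ?z = 0" unfolding u_def inner_coroot[OF b(1)] by simp
    then have "(dderiv (h y) ^^ n) d ?z = 0" for n
      unfolding h_def[of y] dderiv_funpow_scaleR[OF tame_C_inf[OF d]] using z[OF zb(2), of n] by (simp add: u_def h_def)
    then have "d (?z + h y) = 0" by (intro e(2) zb) simp
    then show ?thesis by simp
  qed
  ultimately show ?thesis by (intro tame_identity[OF d, of U x]) auto
qed

lemma C_omega_k_propagate: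
  assumes F1: "F1 \<in> C_omega_k R B \<phi> k" and F2: "F2 \<in> C_omega_k R B \<phi> k" and w: "w \<in> W" and a: "a \<in> I"
    and eq: "\<And>x. x \<in> chamber w \<Longrightarrow> F1 x = F2 x" and x: "x \<in> chamber (refl a \<circ> w)"
  shows "F1 x = F2 x"
proof -
  have aS: "a \<in> Sg" and rW: "refl a \<in> W" using a I_Sg refl_W by auto
  have rw: "refl a \<circ> w \<in> W" by (rule weyl_comp[OF rW w])
  obtain p where p: "wall_point a p" using ex_wall_point[OF a] by (auto simp: wall_point_def)
  \<comment> \<open>\<open>v\<close> lies in the relative interior of the facet common to
    \<open>chamber w\<close> and \<open>chamber (refl a \<circ> w)\<close>.\<close>
  define v where "v = inv w p"
  have wp: "wall_point a (w v)" using p w by (simp add: v_def)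
  obtain \<delta> where \<delta>: "\<delta> > 0" "\<And>y. y \<in> ball v \<delta> \<Longrightarrow> aff a (w y) > 0 \<Longrightarrow> w y \<in> Cp"
      "\<And>y. y \<in> ball v \<delta> \<Longrightarrow> aff a (w y) < 0 \<Longrightarrow> refl a (w y) \<in> Cp"
      "\<And>y. y \<in> ball v \<delta> \<Longrightarrow> aff a (w y) = 0 \<Longrightarrow> wall_point a (w y)"
    using wall_point_sides[OF w a wp] by (metis (no_types, lifting))
  have cont: "continuous_on UNIV F1" "continuous_on UNIV F2"
    and ex: "\<And>u. u \<in> W \<Longrightarrow> \<exists>g. tame g \<and> (\<forall>x\<in>chamber u. F1 x = g x)"
      "\<And>u. u \<in> W \<Longrightarrow> \<exists>g. tame g \<and> (\<forall>x\<in>chamber u. F2 x = g x)"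
    using C_omega_k_CB[OF F1] C_omega_k_CB[OF F2] unfolding CB_omega_iff C_cont_def by simp_all
  obtain g1 where g1: "tame g1" "\<forall>x\<in>chamber w. F1 x = g1 x" using ex(1)[OF w] by (elim exE conjE)
  obtain g2 where g2: "tame g2" "\<forall>x\<in>chamber w. F2 x = g2 x" using ex(2)[OF w] by (elim exE conjE)
  obtain h1 where h1: "tame h1" "\<forall>x\<in>chamber (refl a \<circ> w). F1 x = h1 x" using ex(1)[OF rw] by (elim exE conjE)
  obtain h2 where h2: "tame h2" "\<forall>x\<in>chamber (refl a \<circ> w). F2 x = h2 x" using ex(2)[OF rw] by (elim exE conjE)
  have g12: "g2 = g1"
    \<comment> \<open>Both extensions represent the same function on an open chamber.\<close>
    by (rule tame_eqI[OF g2(1) g1(1) open_chamber[OF w] chamber_nonempty[OF w]]) (use g1(2) g2(2) eq in simp)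
  have G1: "F1 y = g1 y" and G2: "F2 y = g1 y" if "y \<in> ball v \<delta>" "aff (pull w a) y > 0" for y
    using that \<delta>(2)[OF that(1)] g1(2) g2(2) g12 by (simp_all add: aff_pull[OF w aS] chamber_def)
  have H1: "F1 y = h1 y" and H2: "F2 y = h2 y" if "y \<in> ball v \<delta>" "aff (pull w a) y < 0" for y
    using that \<delta>(3)[OF that(1)] h1(2) h2(2) by (simp_all add: aff_pull[OF w aS] chamber_def)
  note C = tame_C_inf[OF g1(1)] tame_C_inf[OF h1(1)] tame_C_inf[OF h2(1)]
  have pS: "pull w a \<in> Sg" by (rule pull_Sg[OF w aS])
  \<comment> \<open>The jump conditions refer to positive roots, and \<open>pull w a\<close> may be
    negative. Its sign decides whether the known side is the positive or the negative one, and so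
    which uniqueness lemma applies.\<close>
  have dz: "(dderiv (coroot (fst b)) ^^ r) (\<lambda>x. h1 x - h2 x) z = 0"
    if bS: "b \<in> Sp" and bp: "b = pull w a \<or> b = - pull w a" and z: "z \<in> ball v \<delta>" and z0: "aff b z = 0" for b z r
  proof -
    have nz: "fst b \<noteq> 0" using Sg_nonzero[OF Sp_Sg[OF bS]] .
    have "aff (pull w a) z = 0" using bp z0 by (elim disjE) simp_all
    then have "wall_point a (w z)" using \<delta>(4)[OF z] by (simp add: aff_pull[OF w aS])
    then have sub: "subregular R B \<phi> b z" by (rule wall_point_subregular[OF w a _ bS bp])
    obtain \<delta>' where \<delta>': "\<delta>' > 0" "ball z \<delta>' \<subseteq> ball v \<delta>" by (rule openE[OF open_ball z])
    have eqr: "(dderiv (coroot (fst b)) ^^ r) h1 z = (dderiv (coroot (fst b)) ^^ r) h2 z"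
      using bp
    proof
      assume b: "b = pull w a"
      have G: "\<forall>y\<in>ball z \<delta>'. aff b y > 0 \<longrightarrow> F1 y = g1 y" "\<forall>y\<in>ball z \<delta>'. aff b y > 0 \<longrightarrow> F2 y = g1 y"
        and H: "\<forall>y\<in>ball z \<delta>'. aff b y < 0 \<longrightarrow> F1 y = h1 y" "\<forall>y\<in>ball z \<delta>'. aff b y < 0 \<longrightarrow> F2 y = h2 y"
        using G1 G2 H1 H2 subsetD[OF \<delta>'(2)] unfolding b by simp_all
      have J: "jump_cond b z g1 h1" "jump_cond b z g1 h2"
        by (rule C_omega_k_jump[OF F1 bS sub \<delta>'(1) C(1,2) G(1) H(1)])
           (rule C_omega_k_jump[OF F2 bS sub \<delta>'(1) C(1,3) G(2) H(2)])
      have "g1 z = F1 z" "h1 z = F1 z" "g1 z = F2 z" "h2 z = F2 z"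
        by (rule ray_limits(3)[OF nz z0 \<delta>'(1) C(1,2) G(1) H(1) cont(1)],
            rule ray_limits(4)[OF nz z0 \<delta>'(1) C(1,2) G(1) H(1) cont(1)],
            rule ray_limits(3)[OF nz z0 \<delta>'(1) C(1,3) G(2) H(2) cont(2)],
            rule ray_limits(4)[OF nz z0 \<delta>'(1) C(1,3) G(2) H(2) cont(2)])
      then have "h1 z = h2 z" by simp
      then show ?thesis by (rule jump_unique_minus[OF J])
    next
      assume b: "b = - pull w a"
      have G: "\<forall>y\<in>ball z \<delta>'. aff b y < 0 \<longrightarrow> F1 y = g1 y" "\<forall>y\<in>ball z \<delta>'. aff b y < 0 \<longrightarrow> F2 y = g1 y"
        and H: "\<forall>y\<in>ball z \<delta>'. aff b y > 0 \<longrightarrow> F1 y = h1 y" "\<forall>y\<in>ball z \<delta>'. aff b y > 0 \<longrightarrow> F2 y = h2 y"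
        using G1 G2 H1 H2 subsetD[OF \<delta>'(2)] unfolding b by simp_all
      have J: "jump_cond b z h1 g1" "jump_cond b z h2 g1"
        by (rule C_omega_k_jump[OF F1 bS sub \<delta>'(1) C(2,1) H(1) G(1)])
           (rule C_omega_k_jump[OF F2 bS sub \<delta>'(1) C(3,1) H(2) G(2)])
      have "g1 z = F1 z" "h1 z = F1 z" "g1 z = F2 z" "h2 z = F2 z"
        by (rule ray_limits(4)[OF nz z0 \<delta>'(1) C(2,1) H(1) G(1) cont(1)],
            rule ray_limits(3)[OF nz z0 \<delta>'(1) C(2,1) H(1) G(1) cont(1)],
            rule ray_limits(4)[OF nz z0 \<delta>'(1) C(3,1) H(2) G(2) cont(2)],
            rule ray_limits(3)[OF nz z0 \<delta>'(1) C(3,1) H(2) G(2) cont(2)])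
      then have "h1 z = h2 z" by simp
      then show ?thesis by (rule jump_unique_plus[OF J])
    qed
    have "(\<lambda>x. h1 x - h2 x) = (\<lambda>x. h1 x + (-1) * h2 x)" by simp
    then show ?thesis
      using eqr by (simp only: dderiv_funpow_add[OF C(2) C_inf_cmult[OF C(3)]] dderiv_funpow_cmult[OF C(3)]) simp
  qed
  obtain b where bS: "b \<in> Sp" and bp: "b = pull w a \<or> b = - pull w a"
    using Sg_cases[OF pS] by (elim disjE) simp_all
  have "aff (pull w a) v = 0" using wp by (simp add: aff_pull[OF w aS] wall_point_def)
  then have "aff b v = 0" using bp by (elim disjE) simp_all
  then have "h1 x - h2 x = 0"
    by (rule vanish_on_hyperplane[OF tame_diff[OF h1(1) h2(1)] Sg_nonzero[OF Sp_Sg[OF bS]] _ \<delta>(1) dz[OF bS bp]])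
  then show ?thesis using h1(2) h2(2) x by simp
qed

text \<open>Every point lies in an image of the closed alcove, in which the corresponding open
  alcove is dense.\<close>

lemma eq_on_V_reg_imp_eq:
  assumes c: "F1 \<in> C_cont" "F2 \<in> C_cont" and eq: "\<And>x. x \<in> Vr \<Longrightarrow> F1 x = F2 x"
  shows "F1 = F2"
proof
  fix x
  obtain w where w: "w \<in> W" "w x \<in> Cbar" using ex_weyl_Cbar by blast
  obtain L where L: "affine_isometry (inv w) L" using weyl_affine[OF inv_W[OF w(1)]] by blast
  have ci: "continuous_on UNIV (inv w)"
    by (intro continuous_at_imp_continuous_on ballI
          differentiable_imp_continuous_within affine_isometry_differentiable[OF L])
  have "closed {z. F1 (inv w z) = F2 (inv w z)}"
    by (intro closed_Collect_eq continuous_on_compose2[OF _ ci]) (use c in \<open>auto simp: C_cont_def\<close>)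
  moreover have "Cp \<subseteq> {z. F1 (inv w z) = F2 (inv w z)}"
    using eq Cp_V_reg V_reg_weyl_imp[OF inv_W[OF w(1)]] by blast
  ultimately have "Cbar \<subseteq> {z. F1 (inv w z) = F2 (inv w z)}" by (rule closure_minimal[rotated])
  then show "F1 x = F2 x" using w by auto
qed

lemma C_omega_k_unique:
  assumes F1: "F1 \<in> C_omega_k R B \<phi> k" and F2: "F2 \<in> C_omega_k R B \<phi> k"
    and eq: "\<And>x. x \<in> Cp \<Longrightarrow> F1 x = F2 x"
  shows "F1 = F2"
proof (rule eq_on_V_reg_imp_eq)
  have "\<forall>x\<in>chamber (word cs). F1 x = F2 x" if "set cs \<subseteq> I" for cs
    using that
  proof (induction cs rule: rev_induct)
    case Nil
    then show ?case using eq by (simp add: chamber_def)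
  next
    case (snoc c cs)
    have c: "c \<in> I" and cs: "set cs \<subseteq> I" using snoc.prems by auto
    have eqw: "word (cs @ [c]) = refl c \<circ> word cs" by (simp add: word_append)
    show ?case unfolding eqw
      by (rule ballI) (rule C_omega_k_propagate[OF F1 F2 word_W[OF cs] c bspec[OF snoc.IH[OF cs]]])
  qed
  then show "F1 x = F2 x" if "x \<in> Vr" for x
    using V_reg_ex_Cp[OF that] weyl_word unfolding chamber_def by (metis mem_Collect_eq)
qed (use C_omega_k_CB[OF F1] C_omega_k_CB[OF F2] in \<open>auto simp: CB_omega_iff\<close>)

lemma T_on_Cp:
  assumes f: "tame f" and x: "x \<in> Cp"
  shows "T f x = f x"
proof -
  have "x \<in> chamber id" using x by (simp add: chamber_def)
  from T_chamber[OF weyl.weyl_id this tame_C_cont[OF f]] show ?thesis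
    unfolding QW_id[OF tame_C_cont[OF f]] id_apply .
qed

lemma chamber_id: "chamber id = Cp"
  by (simp add: chamber_def)

lemma T_bij: "bij_betw T C_omega (C_omega_k R B \<phi> k)"
  unfolding bij_betw_def
proof
  show "inj_on T C_omega"
  proof (rule inj_onI)
    fix f g assume "f \<in> C_omega" "g \<in> C_omega" and eq: "T f = T g"
    then have f: "tame f" and g: "tame g" by (auto simp: C_omega_eq_tame)
    show "f = g"
      by (rule tame_eqI[OF f g open_chamber[OF weyl.weyl_id] chamber_nonempty[OF weyl.weyl_id]])
         (use T_on_Cp[OF f] T_on_Cp[OF g] eq in \<open>simp add: chamber_id\<close>)
  qed
  show "T ` C_omega = C_omega_k R B \<phi> k"
  proof (intro equalityI subsetI)
    fix F assume "F \<in> T ` C_omega"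
    then show "F \<in> C_omega_k R B \<phi> k" using T_C_omega_k by (auto simp: C_omega_eq_tame)
  next
    fix F assume F: "F \<in> C_omega_k R B \<phi> k"
    \<comment> \<open>\<open>T\<close> leaves functions unchanged on \<open>Cp\<close>, so the
      preimage must be the analytic continuation of \<open>F\<close> from there.\<close>
    obtain f where f: "tame f" "\<forall>x\<in>chamber id. F x = f x"
      using C_omega_k_CB[OF F, unfolded CB_omega_iff, THEN conjunct2, THEN bspec, OF weyl.weyl_id] by (elim exE conjE)
    have "T f = F"
      by (rule C_omega_k_unique[OF T_C_omega_k[OF f(1)] F]) (use T_on_Cp[OF f(1)] f(2) in \<open>simp add: chamber_id\<close>)
    then show "F \<in> T ` C_omega" using f(1) by (auto simp: C_omega_eq_tame)
  qed
qed

end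

context hecke_setup
begin

section \<open>The intertwining property\<close>

abbreviation "Tr f \<equiv> restr Vr (T f)"

lemma restr_CB_omega:
  assumes "F \<in> CB_omega R B \<phi>"
  shows "restr Vr F \<in> C_inf Vr"
proof -
  have "Ck_on n Vr (restr Vr F)" for n
  proof (rule Ck_on_local[OF open_V_reg])
    fix x assume "x \<in> Vr"
    then obtain w where w: "w \<in> W" "w x \<in> Cp" using V_reg_ex_Cp by blast
    obtain g where g: "tame g" "\<forall>x\<in>chamber w. F x = g x"
      using assms[unfolded CB_omega_iff, THEN conjunct2, THEN bspec, OF w(1)] by (elim exE conjE)
    show "\<exists>U g. open U \<and> x \<in> U \<and> g \<in> C_inf UNIV \<and> (\<forall>y\<in>U. restr Vr F y = g y)"
    proof (intro exI conjI ballI)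
      show "open (chamber w)" by (rule open_chamber[OF w(1)])
      show "x \<in> chamber w" using w(2) by (simp add: chamber_def)
      show "g \<in> C_inf UNIV" by (rule tame_C_inf[OF g(1)])
      show "restr Vr F y = g y" if "y \<in> chamber w" for y
        using that g(2) subsetD[OF chamber_V_reg[OF w(1)] that] by (simp add: restr_def)
    qed
  qed
  then show ?thesis by (simp add: C_inf_def restr_def)
qed

lemma Tr_C_inf: "tame f \<Longrightarrow> Tr f \<in> C_inf Vr"
  by (rule restr_CB_omega[OF T_CB_omega])

text \<open>\<open>w\<close> takes \<open>x\<close> into the closed alcove exactly when
  \<open>w \<circ> u\<close> takes \<open>inv u x\<close> there; the action property of
  \<open>QW\<close> matches the two values.\<close>

lemma T_QW:
  assumes u: "u \<in> W" and f: "f \<in> C_cont"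
  shows "T (QW u f) = act u (T f)"
proof
  fix x
  obtain w where w: "w \<in> W" "w x \<in> Cbar" using ex_weyl_Cbar by blast
  have wu: "w \<circ> u \<in> W" "(w \<circ> u) (inv u x) = w x" using weyl_comp[OF w(1) u] u by simp_all
  have "T (QW u f) x = QW w (QW u f) (w x)" by (rule T_eq[OF w QW_C_cont[OF u f]])
  also have "\<dots> = QW (w \<circ> u) f ((w \<circ> u) (inv u x))" unfolding wu(2) QW_comp[OF w(1) u f] ..
  also have "\<dots> = T f (inv u x)" by (rule T_eq[OF wu(1) _ f, symmetric]) (use wu(2) w(2) in metis)
  finally show "T (QW u f) x = act u (T f) x" by (simp add: act_def)
qed

lemma restr_act: "w \<in> W \<Longrightarrow> restr Vr (act w F) = act w (restr Vr F)"
  using V_reg_weyl[OF inv_W] by (auto simp: restr_def act_def)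

lemma inv_refl: "a \<in> I \<Longrightarrow> inv (refl a) = refl a"
  by (rule inv_equality) (simp_all add: refl_refl Sg_nonzero I_Sg)

lemma Tr_add: "tame f \<Longrightarrow> tame g \<Longrightarrow> Tr (\<lambda>x. f x + g x) = (\<lambda>x. Tr f x + Tr g x)"
  by (auto simp: T_add tame_C_cont restr_def)

lemma Tr_scale: "tame f \<Longrightarrow> Tr (\<lambda>x. c * f x) = (\<lambda>x. c * Tr f x)"
  by (auto simp: T_scale tame_C_cont restr_def)

lemma pi_cross:
  assumes a: "a \<in> I" and F: "F \<in> C_inf Vr"
  shows "act (refl a) (dunkl R B \<phi> k v F) =
    (\<lambda>x. dunkl R B \<phi> k (refl (fst a, 0) v) (act (refl a) F) x + of_real (k a * (fst a \<bullet> v)) * F x)"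
proof -
  have rW: "refl a \<in> W" using a I_Sg refl_W by blast
  have d: "dunkl R B \<phi> k v F \<in> C_inf Vr"
    using pi_closed[OF lin_poly_in_H_space F] pi_lin[OF F] by metis
  have ac: "act (refl a) F \<in> C_inf Vr"
    using pi_closed[OF group_in_H_space[OF rW] F] pi_group[OF F rW] by metis
  show ?thesis
    using H_module_cross[OF alg pi_mod F a rW, of v]
    unfolding pi_lin[OF F] pi_group[OF F rW] pi_group[OF d rW] pi_lin[OF ac] .
qed

text \<open>On $C_+$ all $\chi_a$ vanish, so the Dunkl operator is $\partial_v$ there. The induction step
  applies the cross relation in both representations.\<close>

lemma T_dderiv_chamber:
  assumes "set cs \<subseteq> I" "tame f" "x \<in> chamber (word cs)"
  shows "T (dderiv v f) x = dunkl R B \<phi> k v (Tr f) x"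
  using assms
proof (induction cs arbitrary: f x v)
  case Nil
  then have x: "x \<in> Cp" by (simp add: chamber_def)
  have "chi a x = 0" if "a \<in> Sp" for a
    using Sp_pos_on_Cp[OF that x] by (simp add: chi_def)
  then have "{a \<in> Sp. chi a x \<noteq> 0} = {}" by blast
  then have "dunkl R B \<phi> k v (Tr f) x = dderiv v (Tr f) x"
    using Cp_V_reg[OF x] by (simp only: dunkl_def restr_def[of _ "\<lambda>x. dderiv v (Tr f) x + _ x"] if_True sum.empty add_0_right)
  also have "\<dots> = dderiv v f x"
  proof (rule dderiv_cong_open)
    show "open Cp" using open_chamber[OF weyl.weyl_id] by (simp only: chamber_id)
    show "Tr f y = f y" if "y \<in> Cp" for y
      using T_on_Cp[OF Nil.prems(2) that] Cp_V_reg[OF that] by (simp add: restr_def)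
  qed (rule x)
  also have "\<dots> = T (dderiv v f) x" by (rule T_on_Cp[OF tame_dderiv[OF Nil.prems(2)] x, symmetric])
  finally show ?case ..
next
  case (Cons a cs)
  have a: "a \<in> I" and cs: "set cs \<subseteq> I" using Cons.prems by auto
  have aS: "a \<in> Sg" and rW: "refl a \<in> W" using a I_Sg refl_W by auto
  note f = Cons.prems(2)
  \<comment> \<open>The letter \<open>a\<close> acts first, so \<open>y\<close> lies in the chamber
    of the shorter word, where the induction hypothesis is applied to
    \<open>QW (refl a) f\<close>.\<close>
  define y where "y = refl a x"
  define c where "c = complex_of_real (k a * (fst a \<bullet> v))"
  have xy: "refl a y = x" unfolding y_def by (rule refl_refl[OF Sg_nonzero[OF aS]])
  have y: "y \<in> chamber (word cs)" using Cons.prems(3) by (simp add: chamber_def y_def)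
  have yV: "y \<in> Vr" by (rule subsetD[OF chamber_V_reg[OF word_W[OF cs]] y])
  let ?g = "QW (refl a) f" and ?s = "refl (fst a, 0)"
  have g: "tame ?g" by (rule QW_tame[OF rW f])
  have actr: "act (refl a) F z = F (refl a z)" for F :: "'v \<Rightarrow> complex" and z
    by (simp add: act_def inv_refl[OF a])
  have cross: "QW (refl a) (dderiv v f) = (\<lambda>x. dderiv (?s v) ?g x + c * f x)"
    unfolding c_def QW_refl[OF a tame_C_cont[OF tame_dderiv[OF f]]] QW_refl[OF a tame_C_cont[OF f]]
    by (rule Q_op_cross(2)[OF a tame_C_inf[OF f]])
  have Trg: "Tr ?g = act (refl a) (Tr f)"
    unfolding T_QW[OF rW tame_C_cont[OF f]] by (rule restr_act[OF rW])
  have "T (dderiv v f) x = act (refl a) (T (dderiv v f)) y" unfolding actr xy ..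
  also have "\<dots> = T (QW (refl a) (dderiv v f)) y"
    unfolding T_QW[OF rW tame_C_cont[OF tame_dderiv[OF f]]] ..
  also have "\<dots> = T (dderiv (?s v) ?g) y + c * T f y"
    unfolding cross T_add[OF tame_C_cont[OF tame_dderiv[OF g]] tame_C_cont[OF tame_cmult[OF f]]]
      T_scale[OF tame_C_cont[OF f]] ..
  also have "T (dderiv (?s v) ?g) y = dunkl R B \<phi> k (?s v) (Tr ?g) y"
    by (rule Cons.IH[OF cs g y])
  also have "T f y = Tr f y" using yV by (simp add: restr_def)
  also have "dunkl R B \<phi> k (?s v) (Tr ?g) y + c * Tr f y = act (refl a) (dunkl R B \<phi> k v (Tr f)) y"
    unfolding Trg c_def pi_cross[OF a Tr_C_inf[OF f]] ..
  also have "\<dots> = dunkl R B \<phi> k v (Tr f) x" unfolding actr xy ..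
  finally show ?case .
qed

lemma Tr_dderiv:
  assumes f: "tame f"
  shows "Tr (dderiv v f) = dunkl R B \<phi> k v (Tr f)"
proof
  fix x
  show "Tr (dderiv v f) x = dunkl R B \<phi> k v (Tr f) x"
  proof (cases "x \<in> Vr")
    case True
    then obtain w where w: "w \<in> W" "w x \<in> Cp" using V_reg_ex_Cp by blast
    obtain cs where cs: "set cs \<subseteq> I" "w = word cs" using weyl_word[OF w(1)] by (elim exE conjE)
    have "x \<in> chamber (word cs)" using w(2) cs(2) by (simp add: chamber_def)
    from T_dderiv_chamber[OF cs(1) f this] show ?thesis using True by (simp add: restr_def)
  qed (simp add: restr_def dunkl_def)
qed

section \<open>Extension from generators to the whole algebra\<close>

definition intertwined :: "'v hecke \<Rightarrow> bool" where
  "intertwined h \<longleftrightarrow> h \<in> H_space R \<and> (\<forall>f. tame f \<longrightarrow> tame (Q h f) \<and> Tr (Q h f) = \<pi> h (Tr f))"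

lemma intertwinedI:
  assumes "h \<in> H_space R" "\<And>f. tame f \<Longrightarrow> tame (Q h f)" "\<And>f. tame f \<Longrightarrow> Tr (Q h f) = \<pi> h (Tr f)"
  shows "intertwined h"
  using assms by (simp add: intertwined_def)

lemma intertwinedD:
  assumes "intertwined h"
  shows "h \<in> H_space R" "tame f \<Longrightarrow> tame (Q h f)" "tame f \<Longrightarrow> Tr (Q h f) = \<pi> h (Tr f)"
  using assms by (simp_all add: intertwined_def)

lemma intertwined_lin_poly: "intertwined (tensor (lin_poly v) id)"
  by (rule intertwinedI)
     (simp_all only: lin_poly_in_H_space Q_lin tame_C_inf tame_dderiv Tr_dderiv pi_lin Tr_C_inf)

lemma intertwined_group:
  assumes w: "w \<in> W"
  shows "intertwined (tensor (\<lambda>_. 1) w)"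
proof (rule intertwinedI)
  show "tensor (\<lambda>_. 1) w \<in> H_space R" by (rule group_in_H_space[OF w])
  fix f :: "'v \<Rightarrow> complex" assume f: "tame f"
  note q = Q_group[OF tame_C_inf[OF f] w]
  show "tame (Q (tensor (\<lambda>_. 1) w) f)" unfolding q by (rule QW_tame[OF w f])
  show "Tr (Q (tensor (\<lambda>_. 1) w) f) = \<pi> (tensor (\<lambda>_. 1) w) (Tr f)"
    unfolding q pi_group[OF Tr_C_inf[OF f] w] T_QW[OF w tame_C_cont[OF f]] by (rule restr_act[OF w])
qed

lemma intertwined_one: "intertwined H_one"
  unfolding H_one_def by (rule intertwined_group[OF weyl.weyl_id])

lemma intertwined_plus:
  assumes "intertwined h" "intertwined h'"
  shows "intertwined (H_plus h h')"
proof (rule intertwinedI)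
  note h = intertwinedD[OF assms(1)] and h' = intertwinedD[OF assms(2)]
  show "H_plus h h' \<in> H_space R" by (rule H_plus_in_H_space[OF h(1) h'(1)])
  fix f :: "'v \<Rightarrow> complex" assume f: "tame f"
  note q = H_moduleD(4)[OF Q_mod h(1) h'(1) tame_C_inf[OF f]]
  show "tame (Q (H_plus h h') f)" unfolding q by (intro tame_add h(2) h'(2) f)
  show "Tr (Q (H_plus h h') f) = \<pi> (H_plus h h') (Tr f)"
    unfolding q Tr_add[OF h(2)[OF f] h'(2)[OF f]] H_moduleD(4)[OF pi_mod h(1) h'(1) Tr_C_inf[OF f]]
      h(3)[OF f] h'(3)[OF f] ..
qed

lemma intertwined_scale:
  assumes "intertwined h"
  shows "intertwined (H_scale c h)"
proof (rule intertwinedI)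
  note h = intertwinedD[OF assms(1)]
  show "H_scale c h \<in> H_space R" by (rule H_scale_in_H_space[OF h(1)])
  fix f :: "'v \<Rightarrow> complex" assume f: "tame f"
  note q = H_moduleD(5)[OF Q_mod h(1) tame_C_inf[OF f]]
  show "tame (Q (H_scale c h) f)" unfolding q by (intro tame_cmult h(2) f)
  show "Tr (Q (H_scale c h) f) = \<pi> (H_scale c h) (Tr f)"
    unfolding q Tr_scale[OF h(2)[OF f]] H_moduleD(5)[OF pi_mod h(1) Tr_C_inf[OF f]] h(3)[OF f] ..
qed

text \<open>The outer factor acts on \<open>Q h' f\<close>, so preservation of analyticity by
  \<open>h'\<close> has to be part of the property \<open>intertwined\<close>.\<close>

lemma intertwined_mult:
  assumes "intertwined h" "intertwined h'"
  shows "intertwined (m h h')"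
proof (rule intertwinedI)
  note h = intertwinedD[OF assms(1)] and h' = intertwinedD[OF assms(2)]
  show "m h h' \<in> H_space R" by (rule H_algebraD(1)[OF alg h(1) h'(1)])
  fix f :: "'v \<Rightarrow> complex" assume f: "tame f"
  note q = H_moduleD(6)[OF Q_mod h(1) h'(1) tame_C_inf[OF f]]
  show "tame (Q (m h h') f)" unfolding q by (intro h(2) h'(2) f)
  show "Tr (Q (m h h') f) = \<pi> (m h h') (Tr f)"
    unfolding q h(3)[OF h'(2)[OF f]] h'(3)[OF f] H_moduleD(6)[OF pi_mod h(1) h'(1) Tr_C_inf[OF f]] ..
qed

text \<open>Real polynomial functions are generated by constants and linear functionals; the latter
  are the elements \<open>lin_poly\<close> by the Riesz representation.\<close>

lemma intertwined_real_polynomial: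
  "real_polynomial_function q \<Longrightarrow> intertwined (tensor (\<lambda>\<xi>. complex_of_real (q \<xi>)) id)"
proof (induction q rule: real_polynomial_function.induct)
  case (linear f)
  then obtain p where "\<forall>x. f x = x \<bullet> p" using real_linear_eq_inner bounded_linear.linear by metis
  then have eq: "(\<lambda>\<xi>. complex_of_real (f \<xi>)) = lin_poly p" by (simp add: lin_poly_def)
  show ?case unfolding eq by (rule intertwined_lin_poly)
next
  case (const c)
  have eq: "tensor (\<lambda>\<xi>. complex_of_real c) id = H_scale (of_real c) H_one"
    by (auto simp: H_one_def H_scale_def tensor_def)
  show ?case unfolding eq by (rule intertwined_scale[OF intertwined_one])
next
  case (add f g)
  have eq: "tensor (\<lambda>\<xi>. complex_of_real (f \<xi> + g \<xi>)) id
      = H_plus (tensor (\<lambda>\<xi>. complex_of_real (f \<xi>)) id) (tensor (\<lambda>\<xi>. complex_of_real (g \<xi>)) id)"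
    by (auto simp: H_plus_def tensor_def)
  show ?case unfolding eq by (rule intertwined_plus[OF add.IH])
next
  case (mult f g)
  have eq: "tensor (\<lambda>\<xi>. complex_of_real (f \<xi> * g \<xi>)) id
      = m (tensor (\<lambda>\<xi>. complex_of_real (f \<xi>)) id) (tensor (\<lambda>\<xi>. complex_of_real (g \<xi>)) id)"
    unfolding H_algebraD(2)[OF alg polynomial_function_of_real[OF mult.hyps(1)] polynomial_function_of_real[OF mult.hyps(2)]]
    by (simp only: of_real_mult)
  show ?case unfolding eq by (rule intertwined_mult[OF mult.IH])
qed

lemma intertwined_polynomial:
  assumes p: "polynomial_function p"
  shows "intertwined (tensor p id)"
proof -
  have "real_polynomial_function (\<lambda>\<xi>. Re (p \<xi>))" "real_polynomial_function (\<lambda>\<xi>. Im (p \<xi>))"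
    using p bounded_linear_Re bounded_linear_Im by (auto simp: polynomial_function_def o_def)
  from intertwined_plus[OF intertwined_real_polynomial[OF this(1)]
        intertwined_scale[OF intertwined_real_polynomial[OF this(2)], of \<i>]]
  have "intertwined (H_plus (tensor (\<lambda>\<xi>. complex_of_real (Re (p \<xi>))) id)
      (H_scale \<i> (tensor (\<lambda>\<xi>. complex_of_real (Im (p \<xi>))) id)))" .
  also have "H_plus (tensor (\<lambda>\<xi>. complex_of_real (Re (p \<xi>))) id)
      (H_scale \<i> (tensor (\<lambda>\<xi>. complex_of_real (Im (p \<xi>))) id)) = tensor p id"
    by (auto simp: H_plus_def H_scale_def tensor_def complex_eq[symmetric])
  finally show ?thesis .
qed

lemma intertwined_tensor: "polynomial_function p \<Longrightarrow> w \<in> W \<Longrightarrow> intertwined (tensor p w)"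
  using intertwined_mult[OF intertwined_polynomial intertwined_group] H_algebraD(3)[OF alg] by metis

text \<open>Induction on a finite set containing the support, splitting off one summand
  \<open>tensor (h w) w\<close> at a time.\<close>

lemma intertwined_H_space:
  assumes "h \<in> H_space R"
  shows "intertwined h"
proof -
  have "intertwined h" if "finite S" "{w. h w \<noteq> (\<lambda>_. 0)} \<subseteq> S" "h \<in> H_space R" for S h
    using that
  proof (induction S arbitrary: h rule: finite_induct)
    case empty
    have "h w = (\<lambda>_. 0)" for w using subsetD[OF empty.prems(1), of w] by (metis (mono_tags) empty_iff mem_Collect_eq)
    then have eq: "h = H_scale 0 H_one" by (simp add: H_scale_def fun_eq_iff)
    show ?case unfolding eq by (rule intertwined_scale[OF intertwined_one])
  next
    case (insert w S)
    show ?case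
    proof (cases "h w = (\<lambda>_. 0)")
      case True
      then have "{w. h w \<noteq> (\<lambda>_. 0)} \<subseteq> S" using insert.prems(1) by auto
      then show ?thesis by (rule insert.IH[OF _ insert.prems(2)])
    next
      case False
      define h' where "h' = h(w := (\<lambda>_. 0))"
      have p: "\<And>u. polynomial_function (h u)" and fin: "finite {u. h u \<noteq> (\<lambda>_. 0)}" and sub: "{u. h u \<noteq> (\<lambda>_. 0)} \<subseteq> W"
        using insert.prems(2) by (auto simp: H_space_def)
      have sup: "{u. h' u \<noteq> (\<lambda>_. 0)} \<subseteq> {u. h u \<noteq> (\<lambda>_. 0)} - {w}" by (auto simp: h'_def)
      have "h' \<in> H_space R" unfolding H_space_def
      proof (intro CollectI conjI allI)
        show "polynomial_function (h' u)" for u using p by (simp add: h'_def)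
        show "finite {u. h' u \<noteq> (\<lambda>_. 0)}" by (rule finite_subset[OF sup finite_Diff[OF fin]])
        show "{u. h' u \<noteq> (\<lambda>_. 0)} \<subseteq> W" using sup sub by blast
      qed
      moreover have "{u. h' u \<noteq> (\<lambda>_. 0)} \<subseteq> S" using sup insert.prems(1) by blast
      ultimately have i: "intertwined h'" by (intro insert.IH)
      have "w \<in> W" by (rule subsetD[OF sub]) (simp add: False)
      then have i': "intertwined (tensor (h w) w)" by (rule intertwined_tensor[OF p])
      have eq: "h = H_plus h' (tensor (h w) w)"
      proof (intro ext)
        fix u \<xi>
        show "h u \<xi> = H_plus h' (tensor (h w) w) u \<xi>"
          by (cases "u = w") (simp_all add: H_plus_def tensor_def h'_def)
      qed
      show ?thesis by (subst eq) (rule intertwined_plus[OF i i'])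
    qed
  qed
  then show ?thesis using assms by (auto simp: H_space_def)
qed

text \<open>By surjectivity of \<open>T\<close> the space is the image of an intertwining map, which
  makes its stability under \<open>\<pi>\<close> formal.\<close>

lemma restr_C_omega_k: "restr Vr ` C_omega_k R B \<phi> k = Tr ` C_omega"
  unfolding bij_betw_imp_surj_on[OF T_bij, symmetric] image_image ..

lemma tame_subspace: "fun_subspace C_omega"
  unfolding fun_subspace_def C_omega_eq_tame by (simp add: tame_zero tame_add tame_cmult)

lemma Tr_image_subspace: "fun_subspace (Tr ` C_omega)"
  unfolding fun_subspace_def
proof (intro conjI ballI allI)
  have "Tr (\<lambda>_. 0) = (\<lambda>_. 0)" using Tr_scale[OF tame_zero, of 0] by simp
  then show "(\<lambda>_. 0) \<in> Tr ` C_omega" 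
    by (intro image_eqI[of _ _ "\<lambda>_. 0"]) (simp_all add: C_omega_eq_tame tame_zero)
next
  fix F G assume "F \<in> Tr ` C_omega" "G \<in> Tr ` C_omega"
  then obtain f g where fg: "F = Tr f" "G = Tr g" "tame f" "tame g" by (auto simp: C_omega_eq_tame)
  show "(\<lambda>x. F x + G x) \<in> Tr ` C_omega"
    unfolding fg(1,2) Tr_add[OF fg(3,4), symmetric] using tame_add[OF fg(3,4)]
    by (intro imageI) (simp add: C_omega_eq_tame)
next
  fix c F assume "F \<in> Tr ` C_omega"
  then obtain f where f: "F = Tr f" "tame f" by (auto simp: C_omega_eq_tame)
  show "(\<lambda>x. c * F x) \<in> Tr ` C_omega"
    unfolding f(1) Tr_scale[OF f(2), symmetric] using tame_cmult[OF f(2)]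
    by (intro imageI) (simp add: C_omega_eq_tame)
qed

lemma H_module_subspace:
  assumes mod: "H_module R m \<rho> X" and Y: "Y \<subseteq> X" "fun_subspace Y"
    and cl: "\<And>h f. h \<in> H_space R \<Longrightarrow> f \<in> Y \<Longrightarrow> \<rho> h f \<in> Y"
  shows "H_module R m \<rho> Y"
proof -
  note D = H_moduleD[OF mod]
  have "fun_linear_on Y (\<rho> h)" if "h \<in> H_space R" for h
    using D(3)[OF that] Y(1) unfolding fun_linear_on_def by (simp add: subset_iff)
  then show ?thesis unfolding H_module_def
    using D(4-7) Y cl by (intro conjI ballI allI) (simp_all add: subset_iff)
qed

lemma C_omega_module: "H_module R m Q C_omega"
proof (rule H_module_subspace[OF Q_mod _ tame_subspace])
  show "C_omega \<subseteq> C_inf UNIV" by (auto simp: C_omega_eq_tame tame_C_inf)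
  show "Q h f \<in> C_omega" if "h \<in> H_space R" "f \<in> C_omega" for h f
    using intertwinedD(2)[OF intertwined_H_space[OF that(1)]] that(2) by (simp add: C_omega_eq_tame)
qed

lemma Tr_image_closed:
  assumes h: "h \<in> H_space R" and F: "F \<in> Tr ` C_omega"
  shows "\<pi> h F \<in> Tr ` C_omega"
proof -
  obtain f where f: "F = Tr f" "tame f" using F by (auto simp: C_omega_eq_tame)
  note i = intertwinedD[OF intertwined_H_space[OF h]]
  show ?thesis unfolding f(1) i(3)[OF f(2), symmetric]
    using i(2)[OF f(2)] by (intro imageI) (simp add: C_omega_eq_tame)
qed

lemma Tr_image_C_inf: "Tr ` C_omega \<subseteq> C_inf Vr"
  using Tr_C_inf by (auto simp: C_omega_eq_tame)

text \<open>Restriction to \<open>Vr\<close> loses no information, because propagated functions are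
  continuous and \<open>Vr\<close> is dense.\<close>

lemma Tr_inj: "inj_on Tr C_omega"
proof (rule inj_onI)
  fix f g assume f: "f \<in> C_omega" and g: "g \<in> C_omega" and eq: "Tr f = Tr g"
  have "T f = T g"
  proof (rule eq_on_V_reg_imp_eq)
    show "T f \<in> C_cont" "T g \<in> C_cont" using f g by (auto simp: C_omega_eq_tame intro: T_C_cont tame_C_cont)
    show "T f x = T g x" if "x \<in> Vr" for x using fun_cong[OF eq, of x] that by (simp add: restr_def)
  qed
  then show "f = g" by (rule inj_onD[OF bij_betw_imp_inj_on[OF T_bij] _ f g])
qed

lemma propagation_isomorphism:
  "H_submodule R m \<pi> (C_inf (V_reg R B \<phi>)) (restr (V_reg R B \<phi>) ` C_omega_k R B \<phi> k) \<and>
   bij_betw T C_omega (C_omega_k R B \<phi> k) \<and>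
   H_module_iso R m Q C_omega \<pi> (restr (V_reg R B \<phi>) ` C_omega_k R B \<phi> k) Tr"
  unfolding restr_C_omega_k H_submodule_def H_module_iso_def
proof (intro conjI ballI)
  show "H_module R m \<pi> (Tr ` C_omega)"
    by (rule H_module_subspace[OF pi_mod Tr_image_C_inf Tr_image_subspace Tr_image_closed])
  show "bij_betw Tr C_omega (Tr ` C_omega)" by (rule inj_on_imp_bij_betw[OF Tr_inj])
  show "fun_linear_on C_omega Tr"
    unfolding fun_linear_on_def by (simp add: C_omega_eq_tame Tr_add Tr_scale)
  show "Tr (Q h f) = \<pi> h (Tr f)" if "h \<in> H_space R" "f \<in> C_omega" for h f
    using intertwinedD(3)[OF intertwined_H_space[OF that(1)]] that(2) by (simp add: C_omega_eq_tame)
qed (rule pi_mod Tr_image_C_inf Tr_image_subspace Tr_image_closed T_bij C_omega_module | assumption)+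

end

theorem theorem5p3:
  fixes R B :: "'v::euclidean_space set" and \<phi> :: 'v and k :: "'v \<times> real \<Rightarrow> real"
    and m :: "'v hecke \<Rightarrow> 'v hecke \<Rightarrow> 'v hecke"
    and \<pi> Q :: "'v hecke \<Rightarrow> ('v \<Rightarrow> complex) \<Rightarrow> 'v \<Rightarrow> complex"
    and QW :: "('v \<Rightarrow> 'v) \<Rightarrow> ('v \<Rightarrow> complex) \<Rightarrow> 'v \<Rightarrow> complex"
  assumes "irreducible_root_system R"
    and "root_basis R B"
    and "highest_root R B \<phi>"
    and "multiplicity_function R k"
    and "H_algebra R B \<phi> k m"
    and "pi_representation R B \<phi> k m \<pi>"
    and "Q_action R B \<phi> k QW"
    and "Q_representation R m QW Q"
  shows "H_submodule R m \<pi> (C_inf (V_reg R B \<phi>))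
           (restr (V_reg R B \<phi>) ` C_omega_k R B \<phi> k) \<and>
         bij_betw (T_op R B \<phi> QW) C_omega (C_omega_k R B \<phi> k) \<and>
         H_module_iso R m Q C_omega \<pi> (restr (V_reg R B \<phi>) ` C_omega_k R B \<phi> k)
           (\<lambda>f. restr (V_reg R B \<phi>) (T_op R B \<phi> QW f))"
proof -
  interpret hecke_setup R B \<phi> k m \<pi> Q QW
    using assms by unfold_locales
  show ?thesis by (rule propagation_isomorphism)
qed

end
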